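(* Let $\zeta$ be the Riemann zeta function. As distributions on $\mathbb{R}$, $$W_0(\zeta)(t)+W_0(\zeta)(-t)=2c_0(\zeta,0)\,\delta_0-\sum_{p,\,k\ge1}(\log p)\big(\delta_{k\log p}+\delta_{-k\log p}\big),$$ where $p$ runs over primes, the left-hand side is formally $\sum_\rho n_\rho e^{\rho|t|}$, and $c_0(\zeta,0)=-\log(2\pi)$.
   Context: $\zeta$ extends meromorphically to $\mathbb{C}$, of order $1$, convergence exponent $d=2$, genus $1$; $n_\rho$ is the multiplicity of $\rho$ as zero of $\zeta$ ($n_1=-1$). For $\sigma\in\mathbb{C}$: $K_{2,\sigma}(t)=\big(n_\sigma\tfrac{t^2}{2}+\sum_{\rho\ne\sigma}\tfrac{n_\rho}{(\rho-\sigma)^2}e^{(\rho-\sigma)t}\big)\mathbf{1}_{\mathbb{R}_+}(t)$ and $W_\sigma(\zeta)=e^{\sigma t}\frac{D^2}{Dt^2}\big((K_{2,\sigma}(t)-K_{2,\sigma}(0))\mathbf{1}_{\mathbb{R}_+}\big)$ (distributional derivative); $W(-t)$ is the reflected distribution. With $E_1(z)=(1-z)e^z$ and Hadamard factorization $\zeta(s)=s^{n_0}e^{Q_{\zeta,0}(s)}\prod_{\rho\ne0}E_1(s/\rho)^{n_\rho}$, $c_0(\zeta,0)$ is the constant $-Q'_{\zeta,0}$. *)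

theory Defs
  imports
    "HOL-Complex_Analysis.Complex_Analysis"
    "HOL-Computational_Algebra.Primes"
begin

section \<open>Distributions on the real line\<close>

abbreviation vderiv :: "(real \<Rightarrow> complex) \<Rightarrow> real \<Rightarrow> complex" where
  "vderiv f \<equiv> (\<lambda>t. vector_derivative f (at t))"

definition test_function :: "(real \<Rightarrow> complex) \<Rightarrow> bool" where
  "test_function \<phi> \<longleftrightarrow>
     (\<forall>n. (vderiv ^^ n) \<phi> differentiable_on UNIV) \<and> compact (closure {t. \<phi> t \<noteq> 0})"

text \<open>
  A distribution is represented by a functional on all functions from the reals to the complex
  numbers, of which only the values on test functions matter. Consequently equality of
  distributions is \<open>eq_distr\<close> below and not HOL equality.
\<close>

type_synonym distr = "(real \<Rightarrow> complex) \<Rightarrow> complex"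

definition is_distribution :: "distr \<Rightarrow> bool" where
  "is_distribution T \<longleftrightarrow>
     (\<forall>\<phi> \<psi>. test_function \<phi> \<and> test_function \<psi> \<longrightarrow> T (\<lambda>t. \<phi> t + \<psi> t) = T \<phi> + T \<psi>) \<and>
     (\<forall>c \<phi>. test_function \<phi> \<longrightarrow> T (\<lambda>t. c * \<phi> t) = c * T \<phi>) \<and>
     (\<forall>a. \<exists>C N. \<forall>\<phi>. test_function \<phi> \<and> closure {t. \<phi> t \<noteq> 0} \<subseteq> {-a..a} \<longrightarrow>
        norm (T \<phi>) \<le> C * (\<Sum>k\<le>N. SUP t. norm ((vderiv ^^ k) \<phi> t)))"

definition eq_distr :: "distr \<Rightarrow> distr \<Rightarrow> bool" where
  "eq_distr S T \<longleftrightarrow> is_distribution S \<and> is_distribution T \<and> (\<forall>\<phi>. test_function \<phi> \<longrightarrow> S \<phi> = T \<phi>)"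

definition distr_of :: "(real \<Rightarrow> complex) \<Rightarrow> distr" where
  "distr_of f = (\<lambda>\<phi>. LINT t|lborel. f t * \<phi> t)"

definition dirac :: "real \<Rightarrow> distr" where
  "dirac a = (\<lambda>\<phi>. \<phi> a)"

definition distr_deriv :: "distr \<Rightarrow> distr" where
  "distr_deriv T = (\<lambda>\<phi>. - T (vderiv \<phi>))"

definition distr_mult :: "(real \<Rightarrow> complex) \<Rightarrow> distr \<Rightarrow> distr" where
  "distr_mult g T = (\<lambda>\<phi>. T (\<lambda>t. g t * \<phi> t))"

definition distr_reflect :: "distr \<Rightarrow> distr" where
  "distr_reflect T = (\<lambda>\<phi>. T (\<lambda>t. \<phi> (- t)))"


section \<open>Newton-Cramer distributions and Hadamard factorization in genus one\<close>

text \<open>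
  The multiplicity \<open>n\<^sub>\<rho>\<close> is \<open>zorder f \<rho>\<close>: positive at zeros, negative at
  poles, and 0 at all other points.
\<close>

definition divisor_support :: "(complex \<Rightarrow> complex) \<Rightarrow> complex set" where
  "divisor_support f = {\<rho>. zorder f \<rho> \<noteq> 0}"

definition K2 :: "(complex \<Rightarrow> complex) \<Rightarrow> complex \<Rightarrow> real \<Rightarrow> complex" where
  "K2 f \<sigma> t =
     (of_int (zorder f \<sigma>) * (of_real t)\<^sup>2 / 2 +
      (\<Sum>\<^sub>\<infinity>\<rho>\<in>divisor_support f - {\<sigma>}.
         of_int (zorder f \<rho>) / (\<rho> - \<sigma>)\<^sup>2 * exp ((\<rho> - \<sigma>) * of_real t))) * indicator {0..} t"

definition newton_cramer :: "(complex \<Rightarrow> complex) \<Rightarrow> complex \<Rightarrow> distr" where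
  "newton_cramer f \<sigma> =
     distr_mult (\<lambda>t. exp (\<sigma> * of_real t))
       (distr_deriv (distr_deriv (distr_of (\<lambda>t. (K2 f \<sigma> t - K2 f \<sigma> 0) * indicator {0..} t))))"

text \<open>
  The Hadamard product is taken as an unconditional one, i.e. as the limit along the finite sets
  of zeros and poles. Here \<open>weierstrass_factor 1 z = (1 - z) * exp z\<close>.
\<close>

definition hadamard_factorization :: "(complex \<Rightarrow> complex) \<Rightarrow> complex poly \<Rightarrow> bool" where
  "hadamard_factorization f Q \<longleftrightarrow>
     (\<forall>s. \<not> is_pole f s \<longrightarrow>
       (\<exists>P. ((\<lambda>F. \<Prod>\<rho>\<in>F. weierstrass_factor 1 (s / \<rho>) powi zorder f \<rho>) \<longlongrightarrow> P)
              (finite_subsets_at_top (divisor_support f - {0})) \<and>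
            f s = s powi zorder f 0 * exp (poly Q s) * P))"

text \<open>
  \<open>Q\<close> is only determined up to an additive multiple of \<open>2 * pi * \<i>\<close>, its derivative is unique.
\<close>

definition c0 :: "(complex \<Rightarrow> complex) \<Rightarrow> complex" where
  "c0 f = (THE c. \<exists>Q. hadamard_factorization f Q \<and> - pderiv Q = [:c:])"


section \<open>The Riemann zeta function\<close>

text \<open>
  The meromorphic continuation of the Dirichlet series to the complex plane. It is unique as a
  HOL function because \<open>nicely_meromorphic_on\<close> fixes the value 0 at poles.
\<close>

definition riemann_zeta :: "complex \<Rightarrow> complex" where
  "riemann_zeta = (THE f. f nicely_meromorphic_on UNIV \<and>
     (\<forall>s. Re s > 1 \<longrightarrow> (\<lambda>n. 1 / of_nat (Suc n) powr s) sums f s))"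

end

theory Submission
  imports Defs
begin

text \<open>
  A test function is integrated against \<open>W\<^sub>0\<close> by pairing \<open>K\<^sub>2(t) - K\<^sub>2(0)\<close> with \<open>\<phi>''\<close>, so everything follows from
  the pointwise identity, for \<open>t \<ge> 0\<close>,
  \<open>K\<^sub>2(t) - K\<^sub>2(0) = - t log (2\<pi>) - \<Sum> (log p) (t - k log p)\<^sub>+\<close>
  after two integrations by parts. Its two sides have the same Laplace transform: by Hadamard's theorem for the
  entire function \<open>(s - 1) \<zeta>(s)\<close> and by the Euler product, both transforms are \<open>\<zeta>'(s) / \<zeta>(s) - \<zeta>'(0) / \<zeta>(0)\<close> resp.
  \<open>- \<Sum> (log p) p\<^bsup>-ks\<^esup> - log (2\<pi>)\<close>, divided by \<open>s\<^sup>2\<close>. In \<open>u = e\<^bsup>-t\<^esup>\<close> the Laplace transform at integers is a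
  sequence of moments on \<open>[0,1]\<close>, which determines a continuous function, so no contour integration and no
  functional equation is needed.

  Hadamard's theorem is obtained by dividing out the zeros in a large disc and bounding the logarithm of
  the quotient with Borel-Caratheodory: its second derivative tends to \<open>0\<close>. The constant
  \<open>\<zeta>'(0) / \<zeta>(0) = log (2\<pi>)\<close> comes from the trapezoidal rule and Wallis's product.
\<close>

text \<open>\<open>newton_cramer riemann_zeta 0\<close> is by itself - log (2 pi) \<delta>_0 minus
  the sum of the (log p) \<delta>_(k log p); adding the reflection only doubles the atom at 0,
  whence 2 c0. This one-sided form is possible because the divisor contains the trivial zeros and
  the pole, so that the sum over it represents the whole of zeta'/zeta and no Gamma factor remains.

  The obstacle is growth: (s - 1) zeta(s) has order 1 but exceeds every exp (C |s|), so all
  estimates use the exponent 3/2, a choice strictly between 1 and 2. Any exponent below 2 makes the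
  sum of m(\<rho>) / |\<rho>|^2 converge. This keeps the genus at 1 and lets sums and products
  converge along arbitrary finite sets, as \<open>infsum\<close> and
  \<open>hadamard_factorization\<close> require.

  Subtracting K2(0) mirrors the 1/\<rho> of the genus one logarithmic derivative. A test function
  sees only finitely many prime powers, so the passage to distributions deals with finite
  sums.\<close>

section \<open>Hadamard's theorem for entire functions of order less than two\<close>

text \<open>The map u -> u / (2A - u) takes the half plane Re u < A into the unit disc and fixes 0.
  The Schwarz lemma at |\<zeta>| \<le> 1/2 then gives |f| \<le> (2A + |f|) / 2, which is solved for
  |f|.\<close>

lemma Borel_Caratheodory_half:
  assumes f: "f holomorphic_on ball 0 R" and "R > 0" "f 0 = 0"
    and Re: "\<And>z. z \<in> ball 0 R \<Longrightarrow> Re (f z) < A" and z: "norm z \<le> R / 2"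
  shows "norm (f z) \<le> 2 * A"
proof -
  have A: "A > 0" using Re[of 0] assms by simp
  define w where "w = (\<lambda>\<zeta>. f (of_real R * \<zeta>) / (2 * of_real A - f (of_real R * \<zeta>)))"
  have in_ball: "of_real R * \<zeta> \<in> ball 0 R" if "norm \<zeta> < 1" for \<zeta> :: complex
    using that \<open>R > 0\<close> by (simp add: norm_mult)
  have nz: "2 * of_real A - f (of_real R * \<zeta>) \<noteq> 0" if "norm \<zeta> < 1" for \<zeta>
    using Re[OF in_ball[OF that]] A by (auto simp: complex_eq_iff)
  have lt: "norm (f (of_real R * \<zeta>)) < norm (2 * of_real A - f (of_real R * \<zeta>))" if "norm \<zeta> < 1" for \<zeta>
  proof -
    let ?u = "f (of_real R * \<zeta>)"
    \<comment> \<open>The right-hand side is |2A - u|^2 - |u|^2.\<close>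
    have "0 < 4 * A * (A - Re ?u)" using Re[OF in_ball[OF that]] A by simp
    hence "(norm ?u)\<^sup>2 < (norm (2 * of_real A - ?u))\<^sup>2"
      unfolding cmod_power2 by (simp add: power2_eq_square algebra_simps)
    thus ?thesis by (rule power_less_imp_less_base) simp
  qed
  have "f \<circ> (\<lambda>\<zeta>. of_real R * \<zeta>) holomorphic_on ball 0 1"
    using in_ball by (intro holomorphic_on_compose_gen[OF _ f] holomorphic_intros) auto
  hence hol: "w holomorphic_on ball 0 1"
    unfolding w_def using nz by (intro holomorphic_intros) (auto simp: o_def)
  have w1: "norm (w \<zeta>) < 1" if "norm \<zeta> < 1" for \<zeta>
    unfolding w_def norm_divide using lt[OF that] by (smt (verit) divide_less_eq_1 norm_ge_zero)
  define \<zeta> where "\<zeta> = z / of_real R"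
  have \<zeta>: "norm \<zeta> \<le> 1/2" "of_real R * \<zeta> = z" using z \<open>R > 0\<close> by (auto simp: \<zeta>_def norm_divide field_simps)
  have "norm (w \<zeta>) \<le> norm \<zeta>"
    using hol w1 \<zeta> \<open>f 0 = 0\<close> by (intro Schwarz_Lemma(1)) (auto simp: w_def)
  hence "norm (f z) \<le> norm \<zeta> * norm (2 * of_real A - f z)"
    using lt[of \<zeta>] \<zeta> by (auto simp: w_def norm_divide divide_le_eq split: if_splits)
  also have "\<dots> \<le> 1/2 * (2 * A + norm (f z))"
    using A \<zeta> norm_triangle_ineq4[of "2 * of_real A" "f z"] by (intro mult_mono) (auto simp: norm_mult)
  finally show ?thesis by simp
qed

text \<open>Cauchy's estimate on the circle of radius R/4 about z, which stays in the disc of radius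
  R/2 where |f| \<le> 2A: the constant is 2! * 2A / (R/4)^2.\<close>

lemma second_deriv_le_of_Re_less:
  assumes f: "f holomorphic_on ball 0 R" and "R > 0" "f 0 = 0"
    and Re: "\<And>z. z \<in> ball 0 R \<Longrightarrow> Re (f z) < A" and z: "norm z \<le> R / 4"
  shows "norm (deriv (deriv f) z) \<le> 64 * A / R\<^sup>2"
proof -
  have sub: "cball z (R/4) \<subseteq> cball 0 (R/2)"
    using z by (auto simp: dist_norm) (smt (verit, best) norm_minus_commute norm_triangle_sub field_sum_of_halves)
  also have "\<dots> \<subseteq> ball 0 R" using \<open>R > 0\<close> by auto
  finally have sub2: "cball z (R/4) \<subseteq> ball 0 R" .
  have "norm ((deriv ^^ 2) f z) \<le> fact 2 * (2 * A) / (R/4)^2"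
  proof (rule Cauchy_inequality)
    show "f holomorphic_on ball z (R/4)" using f sub2 by (meson ball_subset_cball holomorphic_on_subset)
    show "continuous_on (cball z (R/4)) f" using f sub2 by (meson holomorphic_on_imp_continuous_on continuous_on_subset)
    show "norm (f x) \<le> 2 * A" if "norm (z - x) = R/4" for x
      using sub that assms by (intro Borel_Caratheodory_half[of f R]) (auto simp: dist_norm subset_iff)
  qed (use \<open>R > 0\<close> in auto)
  thus ?thesis by (simp add: eval_nat_numeral field_simps)
qed

text \<open>The mean value inequality, applied twice from 0. The two normalisations at 0 remove the
  affine part, which a second derivative cannot see; this affine part is the polynomial of degree
  one in a genus one factorization.\<close>

lemma deriv_bounds_of_second_deriv_le:
  assumes Q: "Q holomorphic_on ball 0 r" and r: "r > 0" "s < r" "0 \<le> s" and Q0: "Q 0 = 0" "deriv Q 0 = 0"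
    and le: "\<And>z. norm z \<le> s \<Longrightarrow> norm (deriv (deriv Q) z) \<le> \<epsilon>" and z: "norm z \<le> s"
  shows "norm (deriv Q z) \<le> \<epsilon> * s" "norm (Q z) \<le> \<epsilon> * s\<^sup>2"
proof -
  have e: "\<epsilon> \<ge> 0" using le[of 0] r by (smt (verit) norm_ge_zero norm_zero)
  have sub: "u \<in> ball 0 r" if "norm u \<le> s" for u :: complex using that r by auto
  have d1: "(Q has_field_derivative deriv Q u) (at u within cball 0 s)" if "norm u \<le> s" for u
    using holomorphic_derivI[OF Q open_ball sub[OF that]] by (rule has_field_derivative_at_within)
  have d2: "(deriv Q has_field_derivative deriv (deriv Q) u) (at u within cball 0 s)" if "norm u \<le> s" for u
    using holomorphic_derivI[OF holomorphic_deriv[OF Q open_ball] open_ball sub[OF that]]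
    by (rule has_field_derivative_at_within)
  have *: "norm (deriv Q u) \<le> \<epsilon> * s" if u: "norm u \<le> s" for u
  proof -
    have "norm (deriv Q u - deriv Q 0) \<le> \<epsilon> * norm (u - 0)"
      using le d2 u r
      by (intro field_differentiable_bound[of "cball 0 s" "deriv Q" "deriv (deriv Q)"]) simp_all
    also have "\<dots> \<le> \<epsilon> * s" using u e by (simp add: mult_left_mono)
    finally show ?thesis using Q0 by simp
  qed
  show "norm (deriv Q z) \<le> \<epsilon> * s" using * z .
  have "norm (Q z - Q 0) \<le> (\<epsilon> * s) * norm (z - 0)"
    using * d1 z r
    by (intro field_differentiable_bound[of "cball 0 s" Q "deriv Q"]) simp_all
  also have "\<dots> \<le> (\<epsilon> * s) * s" using z e r by (intro mult_left_mono) auto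
  finally show "norm (Q z) \<le> \<epsilon> * s\<^sup>2" using Q0 by (simp add: power2_eq_square mult_ac)
qed

text \<open>\<open>f 0 \<noteq> 0\<close> keeps a power of z out of the product, and
  \<open>a < 2\<close> bounds the genus by one. The constant \<open>c\<close> below is then the
  coefficient of z in the exponential factor.\<close>

locale finite_order_entire =
  fixes f :: "complex \<Rightarrow> complex" and B a :: real
  assumes holo: "f holomorphic_on UNIV" and nz0: "f 0 \<noteq> 0"
    and growth: "\<And>z. norm (f z) \<le> exp (B * (1 + norm z) powr a)"
    and a: "0 \<le> a" "a < 2"
begin

definition S :: "complex set" where "S = {\<rho>. f \<rho> = 0}"
definition m :: "complex \<Rightarrow> nat" where "m \<rho> = nat (zorder f \<rho>)"
definition c :: complex where "c = deriv f 0 / f 0"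

lemma S_nz: "\<rho> \<in> S \<Longrightarrow> \<rho> \<noteq> 0" using nz0 by (auto simp: S_def)

lemma finite_zeros: "finite (S \<inter> cball 0 R)"
proof -
  consider "f constant_on UNIV" | "\<not> f constant_on UNIV" by blast
  thus ?thesis
  proof cases
    case 1
    hence "S = {}" using nz0 by (auto simp: constant_on_def S_def)
    thus ?thesis by simp
  next
    case 2
    have "finite {z \<in> cball 0 R. f z = 0}"
      using 2 by (intro holomorphic_compact_finite_zeros[OF holo]) auto
    thus ?thesis by (rule finite_subset[rotated]) (auto simp: S_def)
  qed
qed

text \<open>One zero is divided out at a time. The exact zero set of the quotient is carried along
  because the logarithm in \<open>approximation\<close> needs a quotient without zeros in the
  disc.\<close>

lemma factor_zeros:
  assumes "finite F" "F \<subseteq> S"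
  shows "\<exists>g. g holomorphic_on UNIV \<and> (\<forall>z. f z = g z * (\<Prod>\<rho>\<in>F. (1 - z / \<rho>) ^ m \<rho>)) \<and> (\<forall>z. g z = 0 \<longleftrightarrow> z \<in> S - F)"
  using assms
proof (induction F rule: finite_induct)
  case empty
  thus ?case using holo by (intro exI[of _ f]) (auto simp: S_def)
next
  case (insert \<rho> F)
  then obtain g where g: "g holomorphic_on UNIV" "\<And>z. f z = g z * (\<Prod>\<rho>\<in>F. (1 - z / \<rho>) ^ m \<rho>)"
    "\<And>z. g z = 0 \<longleftrightarrow> z \<in> S - F" by auto
  define P where "P = (\<lambda>z. \<Prod>\<rho>\<in>F. (1 - z / \<rho>) ^ m \<rho>)"
  have \<rho>: "\<rho> \<in> S" "\<rho> \<noteq> 0" "\<rho> \<notin> F" using insert S_nz by auto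
  have g0: "\<exists>w\<in>UNIV. g w \<noteq> 0" using nz0 g(2)[of 0] by (intro bexI[of _ 0]) auto
  have P: "P holomorphic_on UNIV" unfolding P_def using insert S_nz by (intro holomorphic_intros) auto
  \<comment> \<open>The factors already removed do not vanish at \<rho>, so g and f have the same
    order there.\<close>
  have P\<rho>: "P \<rho> \<noteq> 0" using insert S_nz by (auto simp: P_def)
  have an: "g analytic_on {\<rho>}" "P analytic_on {\<rho>}"
    using g(1) P by (auto intro: analytic_on_subset simp flip: analytic_on_open)
  define h where "h = zor_poly g \<rho>"
  have "\<exists>r>0. cball \<rho> r \<subseteq> UNIV \<and> h holomorphic_on cball \<rho> r \<and>
      (\<forall>w\<in>cball \<rho> r. g w = h w * (w - \<rho>) ^ nat (zorder g \<rho>) \<and> h w \<noteq> 0)"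
    unfolding h_def
    using conjunct2[OF zorder_exist_zero[OF g(1) open_UNIV connected_UNIV UNIV_I g0, of \<rho>]] .
  then obtain r where r: "r > 0" "h holomorphic_on cball \<rho> r"
      "\<And>w. w \<in> cball \<rho> r \<Longrightarrow> g w = h w * (w - \<rho>) ^ nat (zorder g \<rho>)"
      "\<And>w. w \<in> cball \<rho> r \<Longrightarrow> h w \<noteq> 0"
    by metis
  have "eventually (\<lambda>w. w \<in> ball \<rho> r) (at \<rho>)" using r(1) by (intro eventually_at_in_open') auto
  moreover have "eventually (\<lambda>w. P w \<noteq> 0) (at \<rho>)"
    using P\<rho> analytic_at_imp_isCont[OF an(2)] by (auto simp: isCont_def tendsto_imp_eventually_ne)
  moreover have "eventually (\<lambda>w. w \<noteq> \<rho>) (at \<rho>)" by (auto simp: eventually_at_filter)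
  ultimately have "eventually (\<lambda>w. g w * P w \<noteq> 0) (at \<rho>)"
    by eventually_elim (use r in auto)
  hence "zorder (\<lambda>w. g w * P w) \<rho> = zorder g \<rho> + zorder P \<rho>"
    by (intro zorder_times_analytic an)
  also have "zorder P \<rho> = 0" by (rule zorder_eq_0I[OF an(2) P\<rho>])
  also have "(\<lambda>w. g w * P w) = f" using g(2) by (auto simp: P_def)
  finally have n: "nat (zorder g \<rho>) = m \<rho>" by (simp add: m_def)
  \<comment> \<open>The removable singularity at \<rho> is filled by the local form of g;
    \<open>(-\<rho>) ^ m \<rho>\<close> converts the power of \<open>w - \<rho>\<close> into one of
    \<open>1 - w / \<rho>\<close>.\<close>
  define G where "G = (\<lambda>z. if z \<in> ball \<rho> r then h z * (-\<rho>) ^ m \<rho> else g z / (1 - z / \<rho>) ^ m \<rho>)"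
  have G1: "G z = h z * (-\<rho>) ^ m \<rho>" if "z \<in> ball \<rho> r" for z using that by (auto simp: G_def)
  have G2: "G z = g z / (1 - z / \<rho>) ^ m \<rho>" if "z \<noteq> \<rho>" for z
  proof (cases "z \<in> ball \<rho> r")
    case True
    have e: "z - \<rho> = (1 - z / \<rho>) * (-\<rho>)" using \<rho> by (simp add: field_simps)
    have "g z = h z * (1 - z / \<rho>) ^ m \<rho> * (-\<rho>) ^ m \<rho>"
      using r(3)[of z] True unfolding n e power_mult_distrib by simp
    thus ?thesis using that \<rho> G1[OF True] by (simp add: field_simps)
  qed (auto simp: G_def)
  have "G holomorphic_on ball \<rho> r \<union> (-{\<rho>})"
  proof (rule holomorphic_on_Un)
    have "(\<lambda>z. h z * (-\<rho>) ^ m \<rho>) holomorphic_on ball \<rho> r"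
      using r(2) by (intro holomorphic_intros) (meson ball_subset_cball holomorphic_on_subset)
    thus "G holomorphic_on ball \<rho> r" by (rule holomorphic_transform) (simp only: G1)
    have "(\<lambda>z. g z / (1 - z / \<rho>) ^ m \<rho>) holomorphic_on -{\<rho>}"
      using g(1) \<rho> by (intro holomorphic_intros) (auto intro: holomorphic_on_subset)
    thus "G holomorphic_on -{\<rho>}" by (rule holomorphic_transform) (simp add: G2)
  qed auto
  also have "ball \<rho> r \<union> (-{\<rho>}) = UNIV" using r by auto
  finally have "G holomorphic_on UNIV" .
  moreover have "f z = G z * (\<Prod>\<rho>\<in>insert \<rho> F. (1 - z / \<rho>) ^ m \<rho>)" for z
  proof (cases "z = \<rho>")
    case True
    have "m \<rho> > 0" using n r(3)[of \<rho>] r(4)[of \<rho>] r(1) g(3)[of \<rho>] \<rho> by (auto intro: gr0I)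
    moreover have "f \<rho> = 0" using \<rho> by (auto simp: S_def)
    ultimately show ?thesis using True insert \<rho> by simp
  next
    case False
    thus ?thesis using insert \<rho> by (simp add: G2 g(2))
  qed
  moreover have "G z = 0 \<longleftrightarrow> z \<in> S - insert \<rho> F" for z
  proof (cases "z = \<rho>")
    case True
    thus ?thesis using r \<rho> by (auto simp: G1)
  next
    case False
    thus ?thesis using g(3) \<rho> by (auto simp: G2)
  qed
  ultimately show ?case by blast
qed

text \<open>On the circle of radius 3r every factor with |\<rho>| \<le> r satisfies |1 - w/\<rho>|
  \<ge> 3 - 1 = 2, and the maximum principle carries the bound inside. The power of 2 is kept: at z
  = 0 it counts the zeros.\<close>

lemma quotient_bound:
  assumes F: "finite F" "F \<subseteq> S" "F \<subseteq> cball 0 r" and r: "r > 0"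
    and g: "g holomorphic_on UNIV" "\<And>z. f z = g z * (\<Prod>\<rho>\<in>F. (1 - z / \<rho>) ^ m \<rho>)" and z: "norm z \<le> 3 * r"
  shows "norm (g z) * 2 ^ (\<Sum>\<rho>\<in>F. m \<rho>) \<le> exp (B * (1 + 3 * r) powr a)"
proof -
  let ?N = "\<Sum>\<rho>\<in>F. m \<rho>"
  have "norm (g z) \<le> exp (B * (1 + 3 * r) powr a) / 2 ^ ?N"
  proof (rule maximum_modulus_frontier[of g "cball 0 (3 * r)"])
    fix w :: complex assume "w \<in> frontier (cball 0 (3 * r))"
    hence w: "norm w = 3 * r" using r by (auto simp: frontier_cball dist_norm)
    have "(2::real) \<le> norm (1 - w / \<rho>)" if "\<rho> \<in> F" for \<rho>
    proof -
      have "norm \<rho> > 0" "norm \<rho> \<le> r" using F that S_nz by auto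
      hence "3 \<le> norm (w / \<rho>)" using w by (simp add: norm_divide field_simps)
      thus ?thesis using norm_triangle_ineq2[of "w / \<rho>" 1] by (simp add: norm_minus_commute)
    qed
    hence "(\<Prod>\<rho>\<in>F. 2 ^ m \<rho>) \<le> (\<Prod>\<rho>\<in>F. norm (1 - w / \<rho>) ^ m \<rho>)"
      by (intro prod_mono) (auto intro!: power_mono)
    hence "2 ^ ?N \<le> norm (\<Prod>\<rho>\<in>F. (1 - w / \<rho>) ^ m \<rho>)"
      by (simp add: power_sum norm_power flip: prod_norm)
    hence "norm (g w) * 2 ^ ?N \<le> norm (f w)"
      by (subst g(2)[of w]) (simp add: norm_mult mult_left_mono)
    also have "\<dots> \<le> exp (B * (1 + 3 * r) powr a)" using growth[of w] w by simp
    finally show "norm (g w) \<le> exp (B * (1 + 3 * r) powr a) / 2 ^ ?N" by (simp add: field_simps)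
  qed (use z g(1) in \<open>auto intro: holomorphic_on_subset holomorphic_on_imp_continuous_on\<close>)
  thus ?thesis by (simp add: field_simps)
qed

text \<open>A positive majorant of log |g / f 0| on the disc of radius r, where g is f with its
  zeros up to r removed. The summand 1 yields the strict inequality that
  \<open>second_deriv_le_of_Re_less\<close> asks for.\<close>

definition A :: "real \<Rightarrow> real" where "A r = \<bar>B\<bar> * (1 + 3 * r) powr a + \<bar>ln (norm (f 0))\<bar> + 1"

text \<open>Evaluating \<open>quotient_bound\<close> at 0 replaces Jensen's formula; the factor 2
  comes from ln 2 \<ge> 1/2.\<close>

lemma count_zeros:
  assumes F: "finite F" "F \<subseteq> S" "F \<subseteq> cball 0 r" and r: "r > 0"
  shows "real (\<Sum>\<rho>\<in>F. m \<rho>) \<le> 2 * A r"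
proof -
  obtain g where g: "g holomorphic_on UNIV" "\<And>z. f z = g z * (\<Prod>\<rho>\<in>F. (1 - z / \<rho>) ^ m \<rho>)"
    using factor_zeros[OF F(1,2)] by blast
  let ?N = "\<Sum>\<rho>\<in>F. m \<rho>"
  have "norm (f 0) * 2 ^ ?N \<le> exp (B * (1 + 3 * r) powr a)"
    using quotient_bound[OF F r g, of 0] g(2)[of 0] r by simp
  hence "ln (norm (f 0) * 2 ^ ?N) \<le> ln (exp (B * (1 + 3 * r) powr a))"
    using nz0 by (subst ln_le_cancel_iff) auto
  hence "ln (norm (f 0)) + ?N * ln 2 \<le> B * (1 + 3 * r) powr a"
    using nz0 by (simp add: ln_mult ln_realpow)
  also have "\<dots> \<le> \<bar>B\<bar> * (1 + 3 * r) powr a" by (intro mult_right_mono) auto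
  finally have "?N * ln 2 \<le> A r" by (simp add: A_def)
  moreover have "?N * (1/2) \<le> ?N * ln (2::real)" using ln2_ge_two_thirds by (intro mult_left_mono) (auto intro: sum_nonneg)
  ultimately show ?thesis by simp
qed

text \<open>Dyadic shells: the zeros with |\<rho>| about 2^j number O(2^(ja)) and have weight of
  order 4^(-j), which is summable because a < 2.\<close>

lemma summable_zeros: "(\<lambda>\<rho>. real (m \<rho>) / (norm \<rho>)\<^sup>2) summable_on S"
proof -
  let ?h = "\<lambda>\<rho>. real (m \<rho>) / (norm \<rho>)\<^sup>2"
  \<comment> \<open>8 = 4 * 2, with 4 from |\<rho>| \<ge> 2^j / 2 and 2 from
    \<open>count_zeros\<close>.\<close>
  define b where "b = (\<lambda>j::nat. 8 * (1/4)^j * A (2^j))"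
  have sb: "summable b"
  proof (rule summable_comparison_test)
    let ?K = "\<bar>ln (norm (f 0))\<bar> + 1"
    have "2 powr a < 2 powr 2" using a by (subst powr_less_cancel_iff) auto
    hence "\<bar>2 powr a / 4\<bar> < 1" by simp
    hence "summable (\<lambda>j. 8 * \<bar>B\<bar> * 4 powr a * (2 powr a / 4) ^ j)" by (intro summable_mult summable_geometric) auto
    moreover have "summable (\<lambda>j. 8 * ?K * (1/4::real) ^ j)" by (intro summable_mult summable_geometric) auto
    ultimately show "summable (\<lambda>j. 8 * \<bar>B\<bar> * 4 powr a * (2 powr a / 4) ^ j + 8 * ?K * (1/4::real) ^ j)"
      by (rule summable_add)
    have "norm (b j) \<le> 8 * \<bar>B\<bar> * 4 powr a * (2 powr a / 4) ^ j + 8 * ?K * (1/4) ^ j" for j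
    proof -
      have "(1 + 3 * 2 ^ j) powr a \<le> (4 * 2 ^ j) powr a" using a by (intro powr_mono2) auto
      also have "\<dots> = 4 powr a * (2 powr a) ^ j"
        by (simp add: powr_mult powr_powr mult.commute flip: powr_realpow)
      finally have "A (2^j) \<le> \<bar>B\<bar> * (4 powr a * (2 powr a) ^ j) + ?K"
        unfolding A_def using mult_left_mono[of _ _ "\<bar>B\<bar>"] by fastforce
      moreover have "A (2^j) \<ge> 0" unfolding A_def by auto
      ultimately have "norm (b j) \<le> 8 * (1/4)^j * (\<bar>B\<bar> * (4 powr a * (2 powr a) ^ j) + ?K)"
        unfolding b_def by (simp add: mult_left_mono)
      thus ?thesis by (simp add: algebra_simps power_divide)
    qed
    thus "\<exists>N. \<forall>j\<ge>N. norm (b j) \<le> 8 * \<bar>B\<bar> * 4 powr a * (2 powr a / 4) ^ j + 8 * ?K * (1/4) ^ j" by blast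
  qed
  have b0: "b j \<ge> 0" for j unfolding b_def A_def by auto
  \<comment> \<open>Rounding the logarithm up gives |\<rho>| \<le> 2^j \<le> 2 |\<rho>| outside the
    unit disc.\<close>
  define j where "j = (\<lambda>\<rho>::complex. nat \<lceil>log 2 (norm \<rho>)\<rceil>)"
  have bound: "sum ?h F \<le> sum ?h (S \<inter> cball 0 1) + suminf b" if F: "F \<subseteq> S" "finite F" for F
  proof -
    let ?F = "F - cball 0 1"
    have j: "norm \<rho> \<le> 2 ^ j \<rho>" "?h \<rho> \<le> 4 * (1/4) ^ j \<rho> * m \<rho>" if "\<rho> \<in> ?F" for \<rho>
    proof -
      have n1: "norm \<rho> > 1" using that by auto
      have "log 2 (norm \<rho>) > 0" using n1 by (subst zero_less_log_cancel_iff) auto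
      hence "real (j \<rho>) \<ge> log 2 (norm \<rho>)" "real (j \<rho>) < log 2 (norm \<rho>) + 1" unfolding j_def by linarith+
      hence "2 powr real (j \<rho>) \<ge> 2 powr log 2 (norm \<rho>)" "2 powr real (j \<rho>) \<le> 2 powr (log 2 (norm \<rho>) + 1)"
        by (auto intro!: powr_mono)
      hence *: "2 ^ j \<rho> \<ge> norm \<rho>" "2 ^ j \<rho> \<le> 2 * norm \<rho>" using powr_log_cancel[of 2 "norm \<rho>"] less_trans[OF zero_less_one n1] by (simp_all add: powr_realpow powr_add)
      thus "norm \<rho> \<le> 2 ^ j \<rho>" by simp
      have "(2 ^ j \<rho>)\<^sup>2 \<le> (2 * norm \<rho>)\<^sup>2" using * by (intro power_mono) auto
      hence "4 ^ j \<rho> \<le> 4 * (norm \<rho>)\<^sup>2" by (simp add: power2_eq_square power_mult_distrib[symmetric] mult.assoc)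
      hence "1 / (norm \<rho>)\<^sup>2 \<le> 4 * (1/4) ^ j \<rho>" using less_trans[OF zero_less_one n1] by (simp add: field_simps power_divide divide_le_eq)
      from mult_right_mono[OF this, of "real (m \<rho>)"] show "?h \<rho> \<le> 4 * (1/4) ^ j \<rho> * m \<rho>" by simp
    qed
    have "sum ?h ?F \<le> (\<Sum>\<rho>\<in>?F. 4 * (1/4) ^ j \<rho> * m \<rho>)" by (intro sum_mono j)
    also have "\<dots> = (\<Sum>i\<in>j ` ?F. \<Sum>\<rho>\<in>{\<rho>\<in>?F. j \<rho> = i}. 4 * (1/4) ^ j \<rho> * m \<rho>)"
      using F by (intro sum.image_gen) auto
    also have "\<dots> \<le> (\<Sum>i\<in>j ` ?F. b i)"
    proof (rule sum_mono)
      fix i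
      have "real (\<Sum>\<rho>\<in>{\<rho>\<in>?F. j \<rho> = i}. m \<rho>) \<le> 2 * A (2^i)"
        using F j by (intro count_zeros) auto
      hence "4 * (1/4)^i * real (\<Sum>\<rho>\<in>{\<rho>\<in>?F. j \<rho> = i}. m \<rho>) \<le> b i" unfolding b_def by simp
      thus "(\<Sum>\<rho>\<in>{\<rho>\<in>?F. j \<rho> = i}. 4 * (1/4) ^ j \<rho> * m \<rho>) \<le> b i" by (simp add: sum_distrib_left)
    qed
    also have "\<dots> \<le> suminf b" using F b0 by (intro sum_le_suminf sb) auto
    finally have "sum ?h ?F \<le> suminf b" .
    moreover have "sum ?h (F \<inter> cball 0 1) \<le> sum ?h (S \<inter> cball 0 1)"
      using F finite_zeros by (intro sum_mono2) auto
    moreover have "sum ?h F = sum ?h (F \<inter> cball 0 1) + sum ?h ?F" using F by (intro sum.Int_Diff) auto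
    ultimately show ?thesis by linarith
  qed
  show ?thesis
    by (rule nonneg_bdd_above_summable_on) (use bound in \<open>auto intro!: bdd_aboveI2\<close>)
qed

definition E :: "complex set \<Rightarrow> complex \<Rightarrow> complex" where
  "E F z = (\<Prod>\<rho>\<in>F. weierstrass_factor 1 (z / \<rho>) ^ m \<rho>)"

lemma E_has_field_derivative:
  assumes "finite F" "F \<subseteq> S" "z \<notin> F"
  shows "(E F has_field_derivative E F z * (\<Sum>\<rho>\<in>F. m \<rho> * (1 / (z - \<rho>) + 1 / \<rho>))) (at z)"
  using assms
proof (induction F rule: finite_induct)
  case empty
  show ?case by (simp add: E_def [abs_def])
next
  case (insert \<rho> F)
  have \<rho>: "\<rho> \<noteq> 0" "z \<noteq> \<rho>" using insert S_nz by auto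
  let ?e = "\<lambda>z. weierstrass_factor 1 (z / \<rho>)"
  have e: "(?e has_field_derivative ?e z * (1 / (z - \<rho>) + 1 / \<rho>)) (at z)"
    unfolding weierstrass_factor_def using \<rho>
    by (auto intro!: derivative_eq_intros simp: divide_simps) (auto simp: algebra_simps)
  have "((\<lambda>z. ?e z ^ m \<rho>) has_field_derivative ?e z ^ m \<rho> * (m \<rho> * (1 / (z - \<rho>) + 1 / \<rho>))) (at z)"
  proof (cases "m \<rho>")
    case (Suc k)
    thus ?thesis using DERIV_power[OF e, of "m \<rho>"] by (simp add: mult_ac)
  qed auto
  from DERIV_mult[OF this insert.IH] insert show ?case
    by (simp add: E_def [abs_def] algebra_simps)
qed

text \<open>Q is the logarithm of what the finite product over F misses. Zeros up to r are divided
  out and the quotient is controlled by Borel-Caratheodory; the remaining factors of F have explicit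
  logarithms in the disc. F is any finite set that contains the zeros up to r, because the limits
  are taken along all finite sets.\<close>

lemma approximation:
  assumes r: "r > 0" and F: "finite F" "F \<subseteq> S" "S \<inter> cball 0 r \<subseteq> F"
  shows "\<exists>Q. Q holomorphic_on ball 0 r \<and> Q 0 = 0 \<and> deriv Q 0 = 0 \<and>
    (\<forall>z\<in>ball 0 r. f z = f 0 * exp (c * z) * E F z * exp (Q z)) \<and>
    (\<forall>z. norm z \<le> r / 4 \<longrightarrow> norm (deriv (deriv Q) z) \<le>
       64 * A r / r\<^sup>2 + 2 * (\<Sum>\<rho>\<in>F - cball 0 r. m \<rho> / (norm \<rho>)\<^sup>2))"
proof -
  define F0 where "F0 = S \<inter> cball 0 r"
  define F1 where "F1 = F - cball 0 r"
  have fin: "finite F0" "finite F1" and FU: "F = F0 \<union> F1" "F0 \<inter> F1 = {}"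
    using F finite_zeros by (auto simp: F0_def F1_def)
  have F1: "norm \<rho> > r" if "\<rho> \<in> F1" for \<rho> using that by (auto simp: F1_def)
  have F1_1: "1 - z / \<rho> \<notin> \<real>\<^sub>\<le>\<^sub>0" if "\<rho> \<in> F1" "z \<in> ball 0 r" for z \<rho>
  proof -
    have "norm (z / \<rho>) < 1" using F1[OF that(1)] that(2) r by (simp add: norm_divide divide_less_eq)
    hence "Re (z / \<rho>) < 1" using complex_Re_le_cmod[of "z / \<rho>"] by linarith
    thus ?thesis by (auto simp: complex_nonpos_Reals_iff)
  qed
  have F1_0: "1 - z / \<rho> \<noteq> 0" if "\<rho> \<in> F1" "z \<in> ball 0 r" for z \<rho> using F1_1[OF that] by auto
  have nz: "\<rho> \<noteq> 0" if "\<rho> \<in> F" for \<rho> using that F S_nz by auto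
  obtain g where g: "g holomorphic_on UNIV" "\<And>z. f z = g z * (\<Prod>\<rho>\<in>F0. (1 - z / \<rho>) ^ m \<rho>)"
      "\<And>z. g z = 0 \<longleftrightarrow> z \<in> S - F0"
    using factor_zeros[of F0] fin by (auto simp: F0_def)
  have g0: "g 0 = f 0" using g(2)[of 0] by simp
  have "(\<lambda>z. g z / f 0) holomorphic_on ball 0 r" using g(1) nz0 by (intro holomorphic_intros) (auto intro: holomorphic_on_subset)
  moreover have "g z / f 0 \<noteq> 0" if "z \<in> ball 0 r" for z using that g(3)[of z] nz0 by (auto simp: F0_def)
  ultimately obtain q0 where q0: "q0 holomorphic_on ball 0 r" "\<And>z. z \<in> ball 0 r \<Longrightarrow> exp (q0 z) = g z / f 0"
    using holomorphic_logarithm_exists[of "ball 0 r" "\<lambda>z. g z / f 0" 0] r by auto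
  \<comment> \<open>The branch of the logarithm is fixed by its value 0 at 0, as Borel-Caratheodory
    requires.\<close>
  define q where "q = (\<lambda>z. q0 z - q0 0)"
  have q: "q holomorphic_on ball 0 r" "q 0 = 0" unfolding q_def using q0 by (auto intro!: holomorphic_intros)
  have exp_q: "exp (q z) = g z / f 0" if "z \<in> ball 0 r" for z
    using q0(2)[OF that] q0(2)[of 0] r g0 nz0 by (simp add: q_def exp_diff)
  have Re_q: "Re (q z) < A r" if z: "z \<in> ball 0 r" for z
  proof -
    have "norm (g z) * 1 \<le> norm (g z) * 2 ^ (\<Sum>\<rho>\<in>F0. m \<rho>)" by (intro mult_left_mono) auto
    also have "\<dots> \<le> exp (B * (1 + 3 * r) powr a)"
      using z r fin by (intro quotient_bound[OF _ _ _ _ g(1,2)]) (auto simp: F0_def)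
    finally have "exp (Re (q z)) \<le> exp (B * (1 + 3 * r) powr a) / norm (f 0)"
      using arg_cong[OF exp_q[OF z], of norm] nz0 by (simp add: norm_divide field_simps)
    also have "\<dots> = exp (B * (1 + 3 * r) powr a - ln (norm (f 0)))" using nz0 by (simp add: exp_diff)
    finally have "Re (q z) \<le> B * (1 + 3 * r) powr a - ln (norm (f 0))" by simp
    moreover have "B * (1 + 3 * r) powr a \<le> \<bar>B\<bar> * (1 + 3 * r) powr a" by (intro mult_right_mono) auto
    ultimately show ?thesis unfolding A_def by linarith
  qed
  have q2: "norm (deriv (deriv q) z) \<le> 64 * A r / r\<^sup>2" if "norm z \<le> r / 4" for z
    using second_deriv_le_of_Re_less[OF q(1) r q(2) Re_q that] by simp
  \<comment> \<open>For the inner zeros only the exponentials exp (z/\<rho>) remain to be divided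
    out. They are linear in the exponent and, like c z, vanish from the second derivative.\<close>
  define Q where "Q = (\<lambda>z. q z - c * z - (\<Sum>\<rho>\<in>F0. m \<rho> * (z / \<rho>)) - (\<Sum>\<rho>\<in>F1. m \<rho> * (Ln (1 - z / \<rho>) + z / \<rho>)))"
  define Q1 where "Q1 = (\<lambda>z. deriv q z - c - (\<Sum>\<rho>\<in>F0. m \<rho> / \<rho>) - (\<Sum>\<rho>\<in>F1. m \<rho> * (1 / \<rho> - 1 / (\<rho> - z))))"
  define Q2 where "Q2 = (\<lambda>z. deriv (deriv q) z + (\<Sum>\<rho>\<in>F1. m \<rho> / (\<rho> - z)\<^sup>2))"
  have \<rho>z: "\<rho> \<noteq> z" if "\<rho> \<in> F1" "z \<in> ball 0 r" for \<rho> z using F1[OF that(1)] that(2) by auto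
  have DQ: "(Q has_field_derivative Q1 z) (at z)" if z: "z \<in> ball 0 r" for z
  proof -
    have "((\<lambda>z. m \<rho> * (Ln (1 - z / \<rho>) + z / \<rho>)) has_field_derivative m \<rho> * (1 / \<rho> - 1 / (\<rho> - z))) (at z)"
      if "\<rho> \<in> F1" for \<rho>
      using F1_1[OF that z] F1_0[OF that z] nz[of \<rho>] that FU \<rho>z[OF that z]
      by (auto intro!: derivative_eq_intros simp: divide_simps)
    moreover have "((\<lambda>z. m \<rho> * (z / \<rho>)) has_field_derivative m \<rho> / \<rho>) (at z)"
      if "\<rho> \<in> F0" for \<rho> :: complex using nz[of \<rho>] that FU by (auto intro!: derivative_eq_intros)
    moreover have "(q has_field_derivative deriv q z) (at z)"
      using z q(1) by (auto intro: holomorphic_derivI)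
    moreover have "((\<lambda>z. c * z) has_field_derivative c) (at z)" by (auto intro!: derivative_eq_intros)
    ultimately show ?thesis unfolding Q_def Q1_def by (intro DERIV_diff DERIV_sum)
  qed
  have DQ1: "(Q1 has_field_derivative Q2 z) (at z)" if z: "z \<in> ball 0 r" for z
  proof -
    have "((\<lambda>z. m \<rho> * (1 / \<rho> - 1 / (\<rho> - z))) has_field_derivative - (m \<rho> / (\<rho> - z)\<^sup>2)) (at z)"
      if "\<rho> \<in> F1" for \<rho> using \<rho>z[OF that z]
      by (auto intro!: derivative_eq_intros simp: power2_eq_square)
    moreover have "(deriv q has_field_derivative deriv (deriv q) z) (at z)"
      using holomorphic_derivI[OF holomorphic_deriv[OF q(1) open_ball] open_ball z] .
    ultimately have "(Q1 has_field_derivative deriv (deriv q) z - 0 - 0 - (\<Sum>\<rho>\<in>F1. - (m \<rho> / (\<rho> - z)\<^sup>2))) (at z)"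
      unfolding Q1_def by (intro DERIV_diff DERIV_sum DERIV_const)
    thus ?thesis by (simp add: Q2_def sum_negf)
  qed
  have holQ: "Q holomorphic_on ball 0 r" unfolding holomorphic_on_open[OF open_ball] using DQ by blast
  have dQ: "deriv Q z = Q1 z" if "z \<in> ball 0 r" for z using DQ[OF that] by (rule DERIV_imp_deriv)
  have ddQ: "deriv (deriv Q) z = Q2 z" if "z \<in> ball 0 r" for z
  proof -
    have "eventually (\<lambda>z. z \<in> ball 0 r) (nhds z)" using that by (intro eventually_nhds_in_open) auto
    hence "eventually (\<lambda>z. deriv Q z = Q1 z) (nhds z)" by eventually_elim (rule dQ)
    hence "deriv (deriv Q) z = deriv Q1 z" by (intro deriv_cong_ev) auto
    thus ?thesis using DQ1[OF that] by (simp add: DERIV_imp_deriv)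
  qed
  have eq: "f z = f 0 * exp (c * z) * E F z * exp (Q z)" if z: "z \<in> ball 0 r" for z
  proof -
    have e0: "E F0 z = (\<Prod>\<rho>\<in>F0. (1 - z / \<rho>) ^ m \<rho>) * (\<Prod>\<rho>\<in>F0. exp (z / \<rho>) ^ m \<rho>)"
      by (simp add: E_def weierstrass_factor_def power_mult_distrib prod.distrib)
    have e1: "E F1 z = (\<Prod>\<rho>\<in>F1. exp (Ln (1 - z / \<rho>) + z / \<rho>) ^ m \<rho>)"
      unfolding E_def using F1_0[OF _ z] by (intro prod.cong refl) (simp add: weierstrass_factor_def exp_add)
    have "exp (Q z) = g z / f 0 / exp (c * z) / (\<Prod>\<rho>\<in>F0. exp (z / \<rho>) ^ m \<rho>) / E F1 z"
      using fin by (simp add: Q_def exp_diff exp_q[OF z] exp_sum exp_of_nat_mult e1 del: times_divide_eq_right)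
    moreover have "E F z = E F0 z * E F1 z" unfolding FU(1) E_def using fin FU by (intro prod.union_disjoint) auto
    moreover have "E F1 z \<noteq> 0" "(\<Prod>\<rho>\<in>F0. exp (z / \<rho>) ^ m \<rho>) \<noteq> 0" unfolding e1 using fin by auto
    ultimately show ?thesis unfolding e0 g(2)[of z] using nz0 by simp
  qed
  have Q0: "Q 0 = 0" by (simp add: Q_def q)
  have z0: "(0::complex) \<in> ball 0 r" using r by simp
  \<comment> \<open>Each genus one factor has derivative 0 at 0, so comparing first derivatives at 0
    gives f'(0) = f(0) (c + Q'(0)); the choice of c makes Q'(0) vanish.\<close>
  have dQ0: "deriv Q 0 = 0"
  proof -
    have E0: "(E F has_field_derivative 0) (at 0)" 
      using E_has_field_derivative[OF F(1,2), of 0] nz by (force simp: sum.neutral)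
    have "((\<lambda>z. f 0 * exp (c * z) * E F z * exp (Q z)) has_field_derivative f 0 * c + f 0 * Q1 0) (at 0)"
      by (rule derivative_eq_intros E0 DQ[OF z0] refl | simp add: Q0 E_def)+
    also have "?this \<longleftrightarrow> (f has_field_derivative f 0 * c + f 0 * Q1 0) (at 0)"
    proof (rule DERIV_cong_ev)
      have "eventually (\<lambda>z. z \<in> ball 0 r) (nhds (0::complex))" using r by (intro eventually_nhds_in_open) auto
      thus "eventually (\<lambda>z. f 0 * exp (c * z) * E F z * exp (Q z) = f z) (nhds 0)"
        by eventually_elim (use eq in auto)
    qed auto
    finally have "deriv f 0 = f 0 * c + f 0 * Q1 0" by (rule DERIV_imp_deriv)
    thus ?thesis using nz0 dQ[OF z0] by (simp add: c_def)
  qed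
  have "norm (deriv (deriv Q) z) \<le> 64 * A r / r\<^sup>2 + 2 * (\<Sum>\<rho>\<in>F1. m \<rho> / (norm \<rho>)\<^sup>2)" if z: "norm z \<le> r / 4" for z
  proof -
    have "norm (m \<rho> / (\<rho> - z)\<^sup>2) \<le> 2 * (m \<rho> / (norm \<rho>)\<^sup>2)" if "\<rho> \<in> F1" for \<rho>
    proof -
      \<comment> \<open>|z| \<le> r/4 < |\<rho>|/4; the factor 2 in the claim is then a rounding of
        (4/3)^2 = 16/9.\<close>
      have "norm (\<rho> - z) \<ge> 3 / 4 * norm \<rho>" using norm_triangle_ineq2[of \<rho> z] z F1[OF that] by simp
      hence "norm (\<rho> - z) ^ 2 \<ge> (3 / 4 * norm \<rho>) ^ 2" by (intro power_mono) auto
      hence "9 / 16 * (norm \<rho>)\<^sup>2 \<le> (norm (\<rho> - z))\<^sup>2" by (simp add: power_mult_distrib power_divide)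
      hence *: "norm (\<rho> - z) ^ 2 \<ge> (norm \<rho>)\<^sup>2 / 2"
        using zero_le_power2[of "norm (\<rho> - z)"] by linarith
      have "(norm \<rho>)\<^sup>2 > 0" using F1[OF that] r by (intro zero_less_power) linarith
      hence "m \<rho> / norm (\<rho> - z) ^ 2 \<le> m \<rho> / ((norm \<rho>)\<^sup>2 / 2)" using * less_le_trans[OF half_gt_zero *]
        by (intro divide_left_mono mult_pos_pos) simp_all
      thus ?thesis by (simp add: norm_divide norm_power mult.commute)
    qed
    hence "norm (\<Sum>\<rho>\<in>F1. m \<rho> / (\<rho> - z)\<^sup>2) \<le> 2 * (\<Sum>\<rho>\<in>F1. m \<rho> / (norm \<rho>)\<^sup>2)"
      unfolding sum_distrib_left by (rule sum_norm_le)
    moreover have "z \<in> ball 0 r" using z r by auto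
    ultimately show ?thesis
      using q2[OF z] norm_triangle_ineq[of "deriv (deriv q) z" "\<Sum>\<rho>\<in>F1. m \<rho> / (\<rho> - z)\<^sup>2"]
      by (simp add: ddQ Q2_def)
  qed
  thus ?thesis using holQ Q0 dQ0 eq unfolding F1_def by blast
qed

lemma A_over_square: "((\<lambda>r. A r / r\<^sup>2) \<longlongrightarrow> 0) at_top"
proof (rule tendsto_sandwich)
  let ?K = "\<bar>ln (norm (f 0))\<bar> + 1"
  show "eventually (\<lambda>r. 0 \<le> A r / r\<^sup>2) at_top"
    by (intro always_eventually allI divide_nonneg_nonneg) (auto simp: A_def)
  show "eventually (\<lambda>r. A r / r\<^sup>2 \<le> \<bar>B\<bar> * 4 powr a * r powr (a - 2) + ?K * r powr (-2)) at_top"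
    using eventually_ge_at_top[of 1]
  proof eventually_elim
    case (elim r)
    have "(1 + 3 * r) powr a \<le> (4 * r) powr a" using elim a by (intro powr_mono2) auto
    also have "\<dots> = 4 powr a * (r powr (a - 2) * r\<^sup>2)"
      using elim by (simp add: powr_mult powr_diff)
    finally have "\<bar>B\<bar> * (1 + 3 * r) powr a \<le> \<bar>B\<bar> * (4 powr a * (r powr (a - 2) * r\<^sup>2))"
      by (intro mult_left_mono) auto
    hence "A r \<le> \<bar>B\<bar> * (4 powr a * (r powr (a - 2) * r\<^sup>2)) + ?K" unfolding A_def by linarith
    also have "\<dots> = (\<bar>B\<bar> * 4 powr a * r powr (a - 2) + ?K * r powr (-2)) * r\<^sup>2"
      using elim by (simp add: distrib_right powr_minus)
    finally show ?case using elim by (simp add: divide_le_eq)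
  qed
  have "((\<lambda>r. \<bar>B\<bar> * 4 powr a * r powr (a - 2) + ?K * r powr (-2)) \<longlongrightarrow> \<bar>B\<bar> * 4 powr a * 0 + ?K * 0) at_top"
    using a by (intro tendsto_intros tendsto_neg_powr filterlim_ident) auto
  thus "((\<lambda>r. \<bar>B\<bar> * 4 powr a * r powr (a - 2) + ?K * r powr (-2)) \<longlongrightarrow> 0) at_top" by simp
qed auto

text \<open>The second derivative of Q has two bounds to beat: A(r)/r^2 tends to 0, and the zeros of
  F beyond r form a tail of a convergent series. Taking r large enough for both makes every finite F
  that contains the zeros up to r admissible.\<close>

lemma eventually_approximation:
  assumes s: "s \<ge> 0" and \<epsilon>: "\<epsilon> > 0"
  shows "eventually (\<lambda>F. finite F \<and> F \<subseteq> S \<and> (\<exists>Q. Q holomorphic_on ball 0 (s + 1) \<and>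
    (\<forall>z\<in>ball 0 (s + 1). f z = f 0 * exp (c * z) * E F z * exp (Q z)) \<and>
    (\<forall>z. norm z \<le> s \<longrightarrow> norm (Q z) < \<epsilon> \<and> norm (deriv Q z) < \<epsilon>))) (finite_subsets_at_top S)"
proof -
  let ?h = "\<lambda>\<rho>. real (m \<rho>) / (norm \<rho>)\<^sup>2"
  \<comment> \<open>The second derivative will be at most 3 \<delta>, so Q' and Q are at most 3
    \<delta> s and 3 \<delta> s^2; (1 + s)^2 dominates both s and s^2, and the outcome is
    3\<epsilon>/4.\<close>
  define \<delta> where "\<delta> = \<epsilon> / (4 * (1 + s)\<^sup>2)"
  have \<delta>: "\<delta> > 0" unfolding \<delta>_def using s \<epsilon> by (intro divide_pos_pos mult_pos_pos) auto
  have "(sum ?h \<longlongrightarrow> infsum ?h S) (finite_subsets_at_top S)"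
    using summable_zeros has_sum_infsum has_sum_def by blast
  hence "eventually (\<lambda>F. sum ?h F > infsum ?h S - \<delta>) (finite_subsets_at_top S)"
    using \<delta> by (intro order_tendstoD) auto
  then obtain F0 where F0: "finite F0" "F0 \<subseteq> S" "sum ?h F0 > infsum ?h S - \<delta>"
    by (auto simp: eventually_finite_subsets_at_top)
  have tail: "sum ?h F < \<delta>" if F: "finite F" "F \<subseteq> S - F0" for F
  proof -
    have "sum ?h F + sum ?h F0 = sum ?h (F \<union> F0)" using F F0 by (subst sum.union_disjoint) auto
    also have "\<dots> \<le> infsum ?h S" using F F0 by (intro finite_sum_le_infsum summable_zeros) auto
    finally show ?thesis using F0 by linarith
  qed
  obtain R where R: "F0 \<subseteq> cball 0 R"
    using finite_imp_bounded[OF F0(1)] by (auto simp: bounded_iff subset_iff)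
  have "eventually (\<lambda>r. 64 * (A r / r\<^sup>2) < \<delta>) at_top"
    using \<delta> tendsto_mult_right_zero[OF A_over_square, of 64] by (intro order_tendstoD) auto
  hence "eventually (\<lambda>r. 64 * (A r / r\<^sup>2) < \<delta> \<and> r \<ge> R \<and> r \<ge> 4 * s + 4) at_top"
    by (intro eventually_conj eventually_ge_at_top)
  \<comment> \<open>\<open>r \<ge> 4 * s + 4\<close> puts |z| \<le> s into the disc of radius r/4
    and the ball of radius s + 1 into the ball of radius r.\<close>
  then obtain r where r: "64 * (A r / r\<^sup>2) < \<delta>" "r \<ge> R" "r \<ge> 4 * s + 4"
    by (auto simp: eventually_at_top_linorder)
  have "r > 0" using r s by linarith
  show ?thesis unfolding eventually_finite_subsets_at_top
  proof (intro exI[of _ "S \<inter> cball 0 r"] conjI allI impI; (elim conjE)?)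
    fix F assume F: "finite F" "S \<inter> cball 0 r \<subseteq> F" "F \<subseteq> S"
    show "finite F" "F \<subseteq> S" by fact+
    obtain Q where Q: "Q holomorphic_on ball 0 r" "Q 0 = 0" "deriv Q 0 = 0"
      "\<And>z. z \<in> ball 0 r \<Longrightarrow> f z = f 0 * exp (c * z) * E F z * exp (Q z)"
      "\<And>z. norm z \<le> r / 4 \<Longrightarrow> norm (deriv (deriv Q) z) \<le> 64 * A r / r\<^sup>2 + 2 * (\<Sum>\<rho>\<in>F - cball 0 r. ?h \<rho>)"
      using approximation[OF \<open>r > 0\<close> F(1,3,2)] by blast
    have "(\<Sum>\<rho>\<in>F - cball 0 r. ?h \<rho>) < \<delta>" using F R r F0 by (intro tail) auto
    hence le: "norm (deriv (deriv Q) z) \<le> 3 * \<delta>" if "norm z \<le> s" for z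
      using Q(5)[of z] that r s by auto
    have "3 * \<delta> * s < \<epsilon>" "3 * \<delta> * s\<^sup>2 < \<epsilon>"
    proof -
      have "3 * \<delta> * s \<le> 3 * \<delta> * (1 + s)\<^sup>2" "3 * \<delta> * s\<^sup>2 \<le> 3 * \<delta> * (1 + s)\<^sup>2"
        using \<delta> s by (auto intro!: mult_left_mono simp: power2_eq_square algebra_simps)
      moreover have "3 * \<delta> * (1 + s)\<^sup>2 = 3 / 4 * \<epsilon>" using s by (simp add: \<delta>_def)
      ultimately show "3 * \<delta> * s < \<epsilon>" "3 * \<delta> * s\<^sup>2 < \<epsilon>" using \<epsilon> by linarith+
    qed
    hence "norm (Q z) < \<epsilon>" "norm (deriv Q z) < \<epsilon>" if "norm z \<le> s" for z
      using deriv_bounds_of_second_deriv_le[OF Q(1) \<open>r > 0\<close> _ s Q(2,3) le that] r s by force+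
    moreover have "ball 0 (s + 1) \<subseteq> ball (0::complex) r" using r s by auto
    ultimately show "\<exists>Q. Q holomorphic_on ball 0 (s + 1) \<and>
      (\<forall>z\<in>ball 0 (s + 1). f z = f 0 * exp (c * z) * E F z * exp (Q z)) \<and>
      (\<forall>z. norm z \<le> s \<longrightarrow> norm (Q z) < \<epsilon> \<and> norm (deriv Q z) < \<epsilon>)"
      using Q(1,4) by (meson holomorphic_on_subset subset_iff)
  qed (auto simp: finite_zeros)
qed

text \<open>Differentiating the approximate factorization shows that the error of the partial sum
  over F is exactly - Q'(z).\<close>

theorem log_deriv_has_sum:
  assumes z: "f z \<noteq> 0"
  shows "((\<lambda>\<rho>. m \<rho> * (1 / (z - \<rho>) + 1 / \<rho>)) has_sum (deriv f z / f z - c)) S"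
  unfolding has_sum_def
proof (rule tendstoI)
  fix \<epsilon> :: real assume "\<epsilon> > 0"
  from eventually_approximation[OF norm_ge_zero[of z] this]
  show "eventually (\<lambda>F. dist (\<Sum>\<rho>\<in>F. m \<rho> * (1 / (z - \<rho>) + 1 / \<rho>)) (deriv f z / f z - c) < \<epsilon>) (finite_subsets_at_top S)"
  proof eventually_elim
    case (elim F)
    then obtain Q where F: "finite F" "F \<subseteq> S" and Q: "Q holomorphic_on ball 0 (norm z + 1)"
      "\<And>w. w \<in> ball 0 (norm z + 1) \<Longrightarrow> f w = f 0 * exp (c * w) * E F w * exp (Q w)"
      "norm (deriv Q z) < \<epsilon>" by auto
    let ?s = "\<Sum>\<rho>\<in>F. m \<rho> * (1 / (z - \<rho>) + 1 / \<rho>)"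
    have zF: "z \<notin> F" using F z by (auto simp: S_def)
    have zb: "z \<in> ball 0 (norm z + 1)" by simp
    note [derivative_intros] = E_has_field_derivative[OF F zF] holomorphic_derivI[OF Q(1) open_ball zb]
    have "((\<lambda>w. f 0 * exp (c * w) * E F w * exp (Q w)) has_field_derivative f z * (c + ?s + deriv Q z)) (at z)"
      by (rule derivative_eq_intros refl)+ (simp add: Q(2)[OF zb] algebra_simps)
    also have "?this \<longleftrightarrow> (f has_field_derivative f z * (c + ?s + deriv Q z)) (at z)"
    proof (rule DERIV_cong_ev)
      have "eventually (\<lambda>w. w \<in> ball 0 (norm z + 1)) (nhds z)" using zb by (intro eventually_nhds_in_open) auto
      thus "eventually (\<lambda>z. f 0 * exp (c * z) * E F z * exp (Q z) = f z) (nhds z)"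
        by eventually_elim (use Q(2) in auto)
    qed auto
    finally have "deriv f z = f z * (c + ?s + deriv Q z)" by (rule DERIV_imp_deriv)
    hence "?s - (deriv f z / f z - c) = - deriv Q z" using z by simp
    thus ?case using Q(3) by (simp add: dist_norm)
  qed
qed

text \<open>The relative error of the finite product is exp (- Q(z)) - 1. Zeros of f are covered
  too, since no logarithm of f is taken here.\<close>

theorem product_tendsto:
  "((\<lambda>F. E F z) \<longlongrightarrow> f z / (f 0 * exp (c * z))) (finite_subsets_at_top S)"
proof (rule tendstoI)
  fix \<epsilon> :: real assume \<epsilon>: "\<epsilon> > 0"
  let ?L = "f z / (f 0 * exp (c * z))"
  \<comment> \<open>The cap 1/2 is for \<open>norm_exp_bounds\<close>, the added 1 is for the case
    \<open>?L = 0\<close>.\<close>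
  define \<delta> where "\<delta> = min (1/2) (\<epsilon> / (2 * (norm ?L + 1)))"
  have \<delta>: "\<delta> > 0" unfolding \<delta>_def using \<epsilon> by (auto intro!: divide_pos_pos add_nonneg_pos mult_pos_pos)
  from eventually_approximation[OF norm_ge_zero[of z] this]
  show "eventually (\<lambda>F. dist (E F z) ?L < \<epsilon>) (finite_subsets_at_top S)"
  proof eventually_elim
    case (elim F)
    then obtain Q where Q: "\<And>w. w \<in> ball 0 (norm z + 1) \<Longrightarrow> f w = f 0 * exp (c * w) * E F w * exp (Q w)"
      "norm (Q z) < \<delta>" by blast
    have "E F z - ?L = ?L * (exp (- Q z) - 1)"
      using Q(1)[of z] nz0 by (simp add: field_simps exp_minus)
    moreover have "norm (exp (- Q z) - 1) \<le> 3 / 2 * norm (- Q z)"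
      using Q(2) by (intro norm_exp_bounds) (auto simp: \<delta>_def)
    ultimately have "dist (E F z) ?L \<le> norm ?L * (3 / 2 * norm (Q z))"
      unfolding dist_norm by (simp only: norm_mult norm_minus_cancel) (intro mult_left_mono, simp_all)
    also have "\<dots> \<le> norm ?L * (3 / 2 * (\<epsilon> / (2 * (norm ?L + 1))))"
      using Q(2) by (intro mult_left_mono) (auto simp: \<delta>_def)
    also have "\<dots> = (3 / 4 * \<epsilon>) * (norm ?L / (norm ?L + 1))" by simp
    also have "\<dots> \<le> (3 / 4 * \<epsilon>) * 1" using \<epsilon> by (intro mult_left_mono) (auto simp: divide_le_eq_1 add_nonneg_pos)
    finally show ?case using \<epsilon> by simp
  qed
qed

end

section \<open>The function \<open>(s - 1) \<zeta>(s)\<close> as an entire function of finite order\<close>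

text \<open>A Weierstrass test with a majorant near each point. Termwise derivatives are included
  because they are what yields zeta' as a Dirichlet series and the value of zeta' at 0.\<close>

lemma holomorphic_series:
  fixes f :: "nat \<Rightarrow> complex \<Rightarrow> complex"
  assumes "open S" and hol: "\<And>n. f n holomorphic_on S"
    and bound: "\<And>x. x \<in> S \<Longrightarrow> \<exists>d>0. \<exists>h. summable h \<and> (\<forall>n. \<forall>y\<in>ball x d \<inter> S. norm (f n y) \<le> h n)"
  defines "g \<equiv> (\<lambda>x. \<Sum>n. f n x)"
  shows "g holomorphic_on S" "\<And>x. x \<in> S \<Longrightarrow> (\<lambda>n. f n x) sums g x"
    "\<And>x. x \<in> S \<Longrightarrow> (\<lambda>n. deriv (f n) x) sums deriv g x"
proof -
  have d: "(f n has_field_derivative deriv (f n) x) (at x)" if "x \<in> S" for n x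
    using holomorphic_derivI[OF hol \<open>open S\<close> that] .
  have "\<exists>g g'. \<forall>x\<in>S. ((\<lambda>n. f n x) sums g x) \<and> ((\<lambda>n. deriv (f n) x) sums g' x) \<and> (g has_field_derivative g' x) (at x)"
  proof (rule series_and_derivative_comparison_complex[OF \<open>open S\<close> d])
    fix x assume "x \<in> S"
    then obtain d h where h: "d > 0" "summable h" "\<And>n y. y \<in> ball x d \<inter> S \<Longrightarrow> norm (f n y) \<le> h n"
      using bound by blast
    have "h n \<ge> 0" for n using h(3)[of x n] \<open>x \<in> S\<close> h(1) by (auto intro: order_trans[OF norm_ge_zero])
    thus "\<exists>d h. 0 < d \<and> summable h \<and> range h \<subseteq> \<real>\<^sub>\<ge>\<^sub>0 \<and>
        (\<forall>\<^sub>F n in sequentially. \<forall>y\<in>ball x d \<inter> S. cmod (f n y) \<le> cmod (h n))"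
      using h by (intro exI[of _ d] exI[of _ "\<lambda>n. complex_of_real (h n)"]) (auto simp: summable_of_real)
  qed
  then obtain G G' where G: "\<And>x. x \<in> S \<Longrightarrow> (\<lambda>n. f n x) sums G x"
    "\<And>x. x \<in> S \<Longrightarrow> (\<lambda>n. deriv (f n) x) sums G' x" "\<And>x. x \<in> S \<Longrightarrow> (G has_field_derivative G' x) (at x)" by blast
  have gG: "g x = G x" if "x \<in> S" for x using G(1)[OF that] by (simp add: g_def sums_iff)
  have "(g has_field_derivative G' x) (at x)" if "x \<in> S" for x
  proof -
    have "eventually (\<lambda>x. g x = G x) (nhds x)"
      using eventually_nhds_in_open[OF \<open>open S\<close> that] by eventually_elim (rule gG)
    thus ?thesis using G(3)[OF that] by (subst DERIV_cong_ev) auto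
  qed
  note this[THEN DERIV_imp_deriv] this
  thus "g holomorphic_on S" "\<And>x. x \<in> S \<Longrightarrow> (\<lambda>n. f n x) sums g x"
    "\<And>x. x \<in> S \<Longrightarrow> (\<lambda>n. deriv (f n) x) sums deriv g x"
    using G gG unfolding holomorphic_on_open[OF \<open>open S\<close>] by auto
qed

section \<open>Growth of exponent 3/2, and its verification for the reciprocal Gamma
  function\<close>

definition order_bound :: "(complex \<Rightarrow> complex) \<Rightarrow> bool" where
  "order_bound f \<longleftrightarrow> (\<exists>B\<ge>0. \<forall>z. norm (f z) \<le> exp (B * (1 + norm z) powr (3/2)))"

lemma order_boundI:
  assumes "\<And>z. norm (f z) \<le> C * exp (B * (1 + norm z) powr (3/2))" "B \<ge> 0"
  shows "order_bound f"
  unfolding order_bound_def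
proof (intro exI[of _ "B + \<bar>C\<bar>"] conjI allI)
  fix z :: complex
  have 1: "1 \<le> (1 + norm z) powr (3/2)" by (intro ge_one_powr_ge_zero) auto
  have "C \<le> exp \<bar>C\<bar>" using exp_ge_add_one_self[of "\<bar>C\<bar>"] by linarith
  also have "\<dots> \<le> exp (\<bar>C\<bar> * (1 + norm z) powr (3/2))" using mult_left_mono[OF 1, of "\<bar>C\<bar>"] by simp
  finally have "C * exp (B * (1 + norm z) powr (3/2)) \<le> exp (\<bar>C\<bar> * (1 + norm z) powr (3/2)) * exp (B * (1 + norm z) powr (3/2))"
    by (intro mult_right_mono) auto
  also have "\<dots> = exp ((B + \<bar>C\<bar>) * (1 + norm z) powr (3/2))" by (simp add: distrib_right exp_add mult.commute)
  finally show "norm (f z) \<le> exp ((B + \<bar>C\<bar>) * (1 + norm z) powr (3/2))"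
    using assms(1)[of z] by linarith
qed (use assms in auto)

lemma order_bound_mult:
  assumes "order_bound f" "order_bound g"
  shows "order_bound (\<lambda>z. f z * g z)"
proof -
  obtain B C where B: "B \<ge> 0" "\<And>z. norm (f z) \<le> exp (B * (1 + norm z) powr (3/2))"
    and C: "C \<ge> 0" "\<And>z. norm (g z) \<le> exp (C * (1 + norm z) powr (3/2))"
    using assms unfolding order_bound_def by blast
  show ?thesis
  proof (rule order_boundI)
    show "norm (f z * g z) \<le> 1 * exp ((B + C) * (1 + norm z) powr (3/2))" for z
      using mult_mono[OF B(2) C(2)] by (simp add: norm_mult distrib_right exp_add)
  qed (use B C in auto)
qed

lemma order_bound_add:
  assumes "order_bound f" "order_bound g"
  shows "order_bound (\<lambda>z. f z + g z)"
proof -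
  obtain B C where B: "B \<ge> 0" "\<And>z. norm (f z) \<le> exp (B * (1 + norm z) powr (3/2))"
    and C: "C \<ge> 0" "\<And>z. norm (g z) \<le> exp (C * (1 + norm z) powr (3/2))"
    using assms unfolding order_bound_def by blast
  show ?thesis
  proof (rule order_boundI)
    fix z :: complex
    let ?x = "(1 + norm z) powr (3/2)"
    have "exp (B * ?x) \<le> exp ((B + C) * ?x)" "exp (C * ?x) \<le> exp ((B + C) * ?x)"
      using B C by (auto intro!: mult_right_mono)
    thus "norm (f z + g z) \<le> 2 * exp ((B + C) * ?x)"
      using norm_triangle_ineq[of "f z" "g z"] B(2)[of z] C(2)[of z] by linarith
  qed (use B C in auto)
qed

lemma one_plus_norm_le_powr: "1 + norm z \<le> (1 + norm z) powr (3/2)"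
  using powr_mono[of 1 "3/2" "1 + norm z"] by simp

text \<open>The factor is 1 + O(w^2) near 0 and at most exp (2 |w|) everywhere, so an exponent
  between 1 and 2 serves both ranges. For |w| > 1/2 the point is sqrt |w| \<ge> 2/3, because 1/2 >
  4/9.\<close>

lemma norm_weierstrass_factor_1_le: "norm (weierstrass_factor 1 w) \<le> exp (3 * norm w powr (3/2))"
proof (cases "norm w \<le> 1/2")
  case True
  have "norm w ^ 2 \<le> norm w powr (3/2)"
  proof (cases "w = 0")
    case False
    have "norm w powr 2 \<le> norm w powr (3/2)" using True False by (intro powr_mono') auto
    thus ?thesis using False by simp
  qed auto
  moreover have "norm (weierstrass_factor 1 w - 1) \<le> 3 * norm w ^ 2"
    using weierstrass_factor_bound[OF True, of 1] by (simp add: numeral_2_eq_2)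
  moreover have "norm (weierstrass_factor 1 w) \<le> 1 + norm (weierstrass_factor 1 w - 1)"
    using norm_triangle_sub[of "weierstrass_factor 1 w" 1] by simp
  ultimately have "norm (weierstrass_factor 1 w) \<le> 1 + 3 * norm w powr (3/2)" by linarith
  also have "\<dots> \<le> exp (3 * norm w powr (3/2))" by (rule exp_ge_add_one_self)
  finally show ?thesis .
next
  case False
  have "norm (1 - w) \<le> exp (norm w)"
    using norm_triangle_ineq4[of 1 w] exp_ge_add_one_self[of "norm w"] unfolding norm_one by linarith
  moreover have "norm (exp w) \<le> exp (norm w)" by (rule norm_exp)
  ultimately have "norm (weierstrass_factor 1 w) \<le> exp (norm w) * exp (norm w)"
    unfolding weierstrass_factor_def by (simp add: norm_mult mult_mono)
  also have "\<dots> = exp (2 * norm w)" by (simp flip: exp_add)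
  also have "2 * norm w \<le> 3 * norm w powr (3/2)"
  proof -
    have "sqrt (4/9) \<le> sqrt (norm w)" using False by (intro real_sqrt_le_mono) simp
    moreover have "sqrt (4/9) = (2/3::real)" by (rule real_sqrt_unique) (auto simp: power2_eq_square)
    ultimately have "2 * norm w \<le> 3 * (norm w * sqrt (norm w))"
      using mult_left_mono[of "2/3" "sqrt (norm w)" "norm w"] by simp
    also have "norm w * sqrt (norm w) = norm w powr 1 * norm w powr (1/2)"
      by (simp add: powr_half_sqrt)
    also have "\<dots> = norm w powr (3/2)" by (subst powr_add [symmetric]) simp
    finally show ?thesis .
  qed
  finally show ?thesis by simp
qed

text \<open>In the Weierstrass product of 1/\<Gamma> the k-th factor costs 3 |z|^(3/2) k^(-3/2) in
  the exponent. These costs are summable, and the bound is uniform over the partial products, so it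
  survives the limit.\<close>

lemma order_bound_rGamma: "order_bound rGamma"
proof (rule order_boundI)
  define K where "K = (\<Sum>k. (real (Suc k)) powr (-(3/2)))"
  have sK: "summable (\<lambda>k. (real (Suc k)) powr (-(3/2)))"
    by (subst summable_Suc_iff) (subst summable_real_powr_iff, simp)
  have K: "K \<ge> 0" unfolding K_def by (intro suminf_nonneg sK) auto
  let ?\<gamma> = "\<bar>euler_mascheroni :: real\<bar>"
  show "1 + ?\<gamma> + 3 * K \<ge> 0" using K by simp
  fix z :: complex
  let ?x = "(1 + norm z) powr (3/2)"
  have le: "norm (rGamma_series_Weierstrass z n) \<le> exp ((1 + ?\<gamma> + 3 * K) * ?x)" for n
  proof -
    have "norm (\<Prod>k=1..n. (1 + z / of_nat k) * exp (- z / of_nat k))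
        = (\<Prod>k=1..n. norm (weierstrass_factor 1 (- z / of_nat k)))"
      by (simp add: weierstrass_factor_def prod_norm)
    also have "\<dots> \<le> (\<Prod>k=1..n. exp (3 * (norm z powr (3/2) * real k powr (-(3/2)))))"
    proof (intro prod_mono conjI)
      fix k assume k: "k \<in> {1..n}"
      have "norm (weierstrass_factor 1 (- z / of_nat k)) \<le> exp (3 * norm (- z / of_nat k) powr (3/2))"
        by (rule norm_weierstrass_factor_1_le)
      also have "norm (- z / of_nat k) powr (3/2) = norm z powr (3/2) * real k powr (-(3/2))"
        unfolding powr_minus_divide by (simp add: norm_divide powr_divide)
      finally show "norm (weierstrass_factor 1 (- z / of_nat k)) \<le> exp (3 * (norm z powr (3/2) * real k powr (-(3/2))))" .
    qed auto
    also have "\<dots> = exp (3 * norm z powr (3/2) * (\<Sum>k=1..n. real k powr (-(3/2))))"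
      by (simp add: exp_sum sum_distrib_left mult_ac)
    also have "(\<Sum>k=1..n. real k powr (-(3/2))) = (\<Sum>k<n. real (Suc k) powr (-(3/2)))"
      by (rule sum.reindex_bij_witness[of _ Suc "\<lambda>k. k - 1"]) auto
    also have "\<dots> \<le> K" unfolding K_def by (intro sum_le_suminf sK) auto
    also have "3 * norm z powr (3/2) * K \<le> 3 * ?x * K" using K by (intro mult_mono powr_mono2) auto
    finally have 1: "norm (\<Prod>k=1..n. (1 + z / of_nat k) * exp (- z / of_nat k)) \<le> exp (3 * ?x * K)"
      by (simp add: mult_left_mono)
    have n: "norm z \<le> ?x" using one_plus_norm_le_powr[of z] by linarith
    have 2: "norm z \<le> exp (1 * ?x)" using n exp_ge_add_one_self[of ?x] unfolding mult_1 by linarith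
    have "norm (exp (euler_mascheroni * z)) \<le> exp (norm (euler_mascheroni * z))" by (rule norm_exp)
    also have "\<dots> \<le> exp (?\<gamma> * ?x)" using n norm_of_real[of euler_mascheroni, where ?'a = complex]
      by (simp add: norm_mult mult_left_mono of_real_euler_mascheroni)
    finally have 3: "norm (exp (euler_mascheroni * z)) \<le> exp (?\<gamma> * ?x)" .
    have "norm (rGamma_series_Weierstrass z n) \<le> exp (?\<gamma> * ?x) * exp (1 * ?x) * exp (3 * ?x * K)"
      unfolding rGamma_series_Weierstrass_def norm_mult mult.commute[of z]
      by (intro mult_mono[OF mult_mono[OF 3 2] 1]) auto
    also have "\<dots> = exp ((1 + ?\<gamma> + 3 * K) * ?x)" by (simp add: algebra_simps flip: exp_add)
    finally show ?thesis .
  qed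
  have "norm (rGamma z) \<le> exp ((1 + ?\<gamma> + 3 * K) * ?x)"
    by (rule Lim_norm_ubound[OF _ rGamma_Weierstrass_complex]) (use le in auto)
  thus "norm (rGamma z) \<le> 1 * exp ((1 + ?\<gamma> + 3 * K) * ?x)" by simp
qed

text \<open>
  The continuation comes from \<open>\<Gamma>(s) \<zeta>(s) = \<integral> x\<^bsup>s-1\<^esup> / (e\<^sup>x - 1) dx\<close> over the positive half line, cut
  at \<open>1\<close>. On \<open>[0,1]\<close> the Taylor series of \<open>x / (e\<^sup>x - 1)\<close> gives the terms
  \<open>b\<^sub>n / (s - 1 + n)\<close>, whose poles are cancelled by the zeros of \<open>(s - 1) / \<Gamma>(s)\<close>.
\<close>

definition bernoulli_gf :: "complex \<Rightarrow> complex" where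
  "bernoulli_gf z = (if z = 0 then 1 else z / (exp z - 1))"

definition bernoulli_coeff :: "nat \<Rightarrow> complex" where
  "bernoulli_coeff n = (deriv ^^ n) bernoulli_gf 0 / fact n"

text \<open>The nearest nonzero solutions of exp z = 1 are \<plusminus> 2 pi i, and 6 < 2 pi. A
  radius above 1 is what makes the Taylor coefficients absolutely summable.\<close>

lemma bernoulli_gf_holomorphic: "bernoulli_gf holomorphic_on ball 0 6"
proof -
  let ?e = "\<lambda>z. if z = 0 then deriv exp 0 else (exp z - exp 0) / (z - 0) :: complex"
  have hol: "?e holomorphic_on ball 0 6" by (intro pole_lemma holomorphic_intros) auto
  have ne: "?e z \<noteq> 0" if "z \<in> ball 0 6" for z
  proof (cases "z = 0")
    case False
    have "exp z \<noteq> 1"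
    proof
      assume "exp z = 1"
      then obtain n :: int where n: "Re z = 0" "Im z = of_int (2 * n) * pi" by (auto simp: exp_eq_1)
      hence "n \<noteq> 0" using False by (auto simp: complex_eq_iff)
      hence "\<bar>real_of_int n\<bar> \<ge> 1" by linarith
      hence "6 \<le> 2 * (\<bar>real_of_int n\<bar> * pi)" using mult_mono[of 1 "\<bar>real_of_int n\<bar>" 3 pi] pi_gt3 by (simp add: mult.commute)
      also have "\<dots> = \<bar>Im z\<bar>" using n by (simp add: abs_mult)
      also have "\<dots> \<le> norm z" by (rule abs_Im_le_cmod)
      finally show False using that by simp
    qed
    thus ?thesis using False by simp
  qed (simp add: DERIV_imp_deriv[OF DERIV_exp])
  have "(\<lambda>z. 1 / ?e z) holomorphic_on ball 0 6" using hol ne by (intro holomorphic_on_divide holomorphic_on_const) blast+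
  moreover have "1 / ?e z = bernoulli_gf z" for z by (simp add: bernoulli_gf_def DERIV_imp_deriv[OF DERIV_exp])
  ultimately show ?thesis by simp
qed

lemma bernoulli_gf_sums: "norm z < 6 \<Longrightarrow> (\<lambda>n. bernoulli_coeff n * z ^ n) sums bernoulli_gf z"
  using holomorphic_power_series[OF bernoulli_gf_holomorphic, of z] by (simp add: bernoulli_coeff_def)

lemma bernoulli_coeff_summable: "summable (\<lambda>n. norm (bernoulli_coeff n))"
  using powser_insidea[of bernoulli_coeff 2 1] bernoulli_gf_sums[of 2] by (simp add: sums_iff)

section \<open>The integral over [0,1], with its poles cancelled\<close>

definition gamma_factor :: "complex \<Rightarrow> complex" where "gamma_factor s = (s - 1) * rGamma s"

lemma gamma_factor_holomorphic: "gamma_factor holomorphic_on A" unfolding gamma_factor_def by (intro holomorphic_intros)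

lemma gamma_factor_zero: "gamma_factor (1 - of_nat n) = 0"
proof (cases n)
  case (Suc m)
  have "(1 - of_nat n :: complex) = - of_nat m" using Suc by simp
  also have "\<dots> \<in> \<int>\<^sub>\<le>\<^sub>0" by (rule minus_of_nat_in_nonpos_Ints)
  finally show ?thesis by (simp add: gamma_factor_def rGamma_eq_zero_iff)
qed (simp add: gamma_factor_def)

text \<open>The entire function \<open>gamma_factor s / (s - 1 + n)\<close>. The vanishing value
  \<open>gamma_factor (1 - of_nat n)\<close> is left in the numerator so that
  \<open>pole_lemma\<close> applies to the expression as written.\<close>

definition gamma_quotient :: "nat \<Rightarrow> complex \<Rightarrow> complex" where
  "gamma_quotient n s = (if s = 1 - of_nat n then deriv gamma_factor (1 - of_nat n) else (gamma_factor s - gamma_factor (1 - of_nat n)) / (s - (1 - of_nat n)))"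

lemma gamma_quotient_holomorphic: "gamma_quotient n holomorphic_on A"
proof -
  have "gamma_quotient n holomorphic_on UNIV" unfolding gamma_quotient_def [abs_def] by (intro pole_lemma gamma_factor_holomorphic) auto
  thus ?thesis by (rule holomorphic_on_subset) auto
qed

lemma gamma_quotient_eq: "s \<noteq> 1 - of_nat n \<Longrightarrow> gamma_quotient n s = gamma_factor s / (s - (1 - of_nat n))"
  by (simp add: gamma_quotient_def gamma_factor_zero)

text \<open>The exceptional points 1 - n are integers, hence at distance at least 1/2 from a circle
  of half-integral radius. The maximum principle then gives a bound uniform in n, which the
  summation over n needs.\<close>

lemma gamma_quotient_bound:
  assumes M: "\<And>w. norm w = real N + 1/2 \<Longrightarrow> norm (gamma_factor w) \<le> M" and s: "norm s \<le> real N + 1/2"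
  shows "norm (gamma_quotient n s) \<le> 2 * M"
proof (rule maximum_modulus_frontier[of "gamma_quotient n" "cball 0 (real N + 1/2)"])
  fix w :: complex assume "w \<in> frontier (cball 0 (real N + 1/2))"
  hence w: "norm w = real N + 1/2" by (auto simp: frontier_cball dist_norm)
  have "norm (1 - of_nat n :: complex) = norm (1 - real n)" by (metis norm_of_real of_real_1 of_real_diff of_real_of_nat_eq)
  hence "norm (1 - of_nat n :: complex) = of_int \<bar>1 - int n\<bar>" by simp
  moreover have "\<bar>real N + 1/2 - of_int i\<bar> \<ge> 1/2" for i by (cases "i \<le> int N") linarith+
  from this[of "\<bar>1 - int n\<bar>"] have "\<bar>real N + 1/2 - of_int \<bar>1 - int n\<bar>\<bar> \<ge> 1/2" .
  ultimately have ge: "norm (w - (1 - of_nat n)) \<ge> 1/2"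
    using norm_triangle_ineq3[of w "1 - of_nat n"] w by simp
  hence "w \<noteq> 1 - of_nat n" by auto
  hence "norm (gamma_quotient n w) = norm (gamma_factor w) / norm (w - (1 - of_nat n))" by (simp add: gamma_quotient_eq norm_divide)
  also have "\<dots> \<le> M / (1/2)" using M[OF w] ge by (intro frac_le) (auto intro: order_trans[OF norm_ge_zero])
  finally show "norm (gamma_quotient n w) \<le> 2 * M" by simp
qed (use s in \<open>auto intro: gamma_quotient_holomorphic holomorphic_on_imp_continuous_on\<close>)

lemma order_bound_gamma_factor: "order_bound gamma_factor"
proof -
  have "order_bound (\<lambda>s. s - 1)"
  proof (rule order_boundI)
    show "norm (s - 1) \<le> 1 * exp (1 * (1 + norm s) powr (3/2))" for s :: complex
      using norm_triangle_ineq4[of s 1] one_plus_norm_le_powr[of s] exp_ge_add_one_self[of "(1 + norm s) powr (3/2)"]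
      unfolding norm_one mult_1 by linarith
  qed auto
  from order_bound_mult[OF this order_bound_rGamma] show ?thesis unfolding gamma_factor_def [abs_def] .
qed

lemma gamma_quotient_order_bound: "\<exists>B\<ge>0. \<forall>n s. norm (gamma_quotient n s) \<le> 2 * exp (B * (1 + norm s) powr (3/2))"
proof -
  obtain B where B: "B \<ge> 0" "\<And>z. norm (gamma_factor z) \<le> exp (B * (1 + norm z) powr (3/2))"
    using order_bound_gamma_factor unfolding order_bound_def by blast
  have "norm (gamma_quotient n s) \<le> 2 * exp (B * 3 powr (3/2) * (1 + norm s) powr (3/2))" for n s
  proof -
    \<comment> \<open>With this N the circle satisfies 1 + |w| \<le> |s| + 5/2 \<le> 3 (1 + |s|),
      the source of the factor 3.\<close>
    obtain N :: nat where N: "norm s \<le> real N" "real N \<le> norm s + 1"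
      using norm_ge_zero[of s] by (intro that[of "nat \<lceil>norm s\<rceil>"]) linarith+
    show ?thesis
    proof (rule gamma_quotient_bound)
      show "norm s \<le> real N + 1/2" using N by linarith
      fix w :: complex assume w: "norm w = real N + 1/2"
      have "1 + norm w \<le> 3 * (1 + norm s)" using w N norm_ge_zero[of s] by argo
      hence "(1 + norm w) powr (3/2) \<le> (3 * (1 + norm s)) powr (3/2)" by (intro powr_mono2) auto
      hence "B * (1 + norm w) powr (3/2) \<le> B * (3 * (1 + norm s)) powr (3/2)" using B(1) by (intro mult_left_mono)
      also have "\<dots> = B * 3 powr (3/2) * (1 + norm s) powr (3/2)" by (subst powr_mult) auto
      finally have "exp (B * (1 + norm w) powr (3/2)) \<le> exp (B * 3 powr (3/2) * (1 + norm s) powr (3/2))" by simp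
      with B(2)[of w] show "norm (gamma_factor w) \<le> exp (B * 3 powr (3/2) * (1 + norm s) powr (3/2))" by linarith
    qed
  qed
  thus ?thesis using B(1) by (intro exI[of _ "B * 3 powr (3/2)"]) auto
qed

definition mellin_head :: "complex \<Rightarrow> complex" where "mellin_head s = (\<Sum>n. bernoulli_coeff n * gamma_quotient n s)"

lemma mellin_head: "mellin_head holomorphic_on UNIV" "(\<lambda>n. bernoulli_coeff n * gamma_quotient n s) sums mellin_head s" "order_bound mellin_head"
proof -
  obtain B where B: "B \<ge> 0" "\<And>n s. norm (gamma_quotient n s) \<le> 2 * exp (B * (1 + norm s) powr (3/2))"
    using gamma_quotient_order_bound by blast
  have bnd: "norm (bernoulli_coeff n * gamma_quotient n s) \<le> norm (bernoulli_coeff n) * (2 * exp (B * (1 + norm s) powr (3/2)))" for n s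
    unfolding norm_mult by (intro mult_left_mono B) auto
  have *: "\<exists>d>0. \<exists>u. summable u \<and> (\<forall>n. \<forall>y\<in>ball x d \<inter> UNIV. norm (bernoulli_coeff n * gamma_quotient n y) \<le> u n)" for x
  proof (intro exI[of _ 1] conjI allI ballI exI[of _ "\<lambda>n. norm (bernoulli_coeff n) * (2 * exp (B * (2 + norm x) powr (3/2)))"])
    fix n y assume "y \<in> ball x 1 \<inter> UNIV"
    hence "norm y \<le> norm x + 1" using norm_triangle_sub[of y x] by (auto simp: dist_norm norm_minus_commute)
    hence "B * (1 + norm y) powr (3/2) \<le> B * (2 + norm x) powr (3/2)"
      using B(1) by (intro mult_left_mono powr_mono2) auto
    hence "norm (bernoulli_coeff n) * (2 * exp (B * (1 + norm y) powr (3/2))) \<le> norm (bernoulli_coeff n) * (2 * exp (B * (2 + norm x) powr (3/2)))"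
      by (intro mult_left_mono) auto
    with bnd[of n y] show "norm (bernoulli_coeff n * gamma_quotient n y) \<le> norm (bernoulli_coeff n) * (2 * exp (B * (2 + norm x) powr (3/2)))" by linarith
  qed (auto intro!: summable_mult2 bernoulli_coeff_summable)
  have hol: "(\<lambda>s. bernoulli_coeff n * gamma_quotient n s) holomorphic_on UNIV" for n by (intro holomorphic_intros gamma_quotient_holomorphic)
  show "mellin_head holomorphic_on UNIV" unfolding mellin_head_def [abs_def] by (rule holomorphic_series(1)[OF open_UNIV hol *])
  show "(\<lambda>n. bernoulli_coeff n * gamma_quotient n s) sums mellin_head s" for s unfolding mellin_head_def by (rule holomorphic_series(2)[OF open_UNIV hol * UNIV_I])
  show "order_bound mellin_head"
  proof (rule order_boundI)
    fix s :: complex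
    have "norm (mellin_head s) \<le> (\<Sum>n. norm (bernoulli_coeff n) * (2 * exp (B * (1 + norm s) powr (3/2))))"
      unfolding mellin_head_def by (intro norm_suminf_le bnd summable_mult2 bernoulli_coeff_summable)
    also have "\<dots> = (\<Sum>n. norm (bernoulli_coeff n)) * (2 * exp (B * (1 + norm s) powr (3/2)))"
      by (rule suminf_mult2 [symmetric, OF bernoulli_coeff_summable])
    finally show "norm (mellin_head s) \<le> (2 * (\<Sum>n. norm (bernoulli_coeff n))) * exp (B * (1 + norm s) powr (3/2))"
      by (simp add: mult_ac)
  qed (use B in auto)
qed

section \<open>The integral from 1 to infinity\<close>

definition mellin_kernel :: "complex \<Rightarrow> real \<Rightarrow> complex" where
  "mellin_kernel s x = exp ((s - 1) * of_real (ln x)) / of_real (exp x - 1)"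

text \<open>Unit intervals reduce holomorphy to differentiation under the integral over compact
  intervals; the improper integral becomes a series to which \<open>holomorphic_series\<close>
  applies.\<close>

definition mellin_piece :: "nat \<Rightarrow> complex \<Rightarrow> complex" where
  "mellin_piece k s = integral {real k + 1..real k + 2} (mellin_kernel s)"

lemma exp_minus_one_ge: "x \<ge> (1::real) \<Longrightarrow> exp x - 1 \<ge> exp x / 2"
  using exp_ge_add_one_self[of x] by linarith

lemma mellin_kernel_continuous: "continuous_on {real k + 1..real k + 2} (mellin_kernel s)"
proof -
  have ne: "complex_of_real (exp x - 1) \<noteq> 0" "x \<noteq> 0" if "x \<in> {real k + 1..real k + 2}" for x
  proof -
    have "exp x - 1 \<noteq> 0" using that by auto
    thus "complex_of_real (exp x - 1) \<noteq> 0" by (simp only: of_real_eq_0_iff not_False_eq_True)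
  qed (use that in auto)
  show ?thesis unfolding mellin_kernel_def by (intro continuous_intros ballI ne)
qed

lemma mellin_piece_holomorphic: "mellin_piece k holomorphic_on A"
proof -
  let ?I = "cbox (real k + 1) (real k + 2)"
  have "(\<lambda>s. integral ?I (mellin_kernel s)) holomorphic_on UNIV"
  proof (rule leibniz_rule_holomorphic[where fx = "\<lambda>s x. mellin_kernel s x * of_real (ln x)"])
    show "((\<lambda>s. mellin_kernel s x) has_field_derivative mellin_kernel s x * of_real (ln x)) (at s within UNIV)" for s x
    proof -
      have "((\<lambda>s. exp ((s - 1) * of_real (ln x))) has_field_derivative exp ((s - 1) * of_real (ln x)) * of_real (ln x)) (at s)"
        by (auto intro!: derivative_eq_intros)
      from DERIV_cdivide[OF this, of "of_real (exp x - 1)"] show ?thesis by (simp add: mellin_kernel_def [abs_def])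
    qed
    show "mellin_kernel s integrable_on ?I" for s
      using mellin_kernel_continuous by (intro integrable_continuous) auto
    show "continuous_on (UNIV \<times> ?I) (\<lambda>(s, x). mellin_kernel s x * of_real (ln x))"
      unfolding mellin_kernel_def split_def by (intro continuous_intros) auto
  qed auto
  thus ?thesis unfolding mellin_piece_def [abs_def] by (auto intro: holomorphic_on_subset)
qed

lemma power_le_fact_exp: "x \<ge> 0 \<Longrightarrow> x ^ n \<le> fact n * exp (x::real)"
proof -
  assume x: "x \<ge> 0"
  have "(\<Sum>k\<in>{n}. x ^ k /\<^sub>R fact k) \<le> (\<Sum>k. x ^ k /\<^sub>R fact k)"
    using x by (intro sum_le_suminf summable_exp_generic) auto
  thus ?thesis by (simp add: exp_def field_simps)
qed

text \<open>The decay exp (-x) is split in two: one half absorbs the power, through y^M \<le> M! exp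
  y at y = (k + 2)/2, and the other half remains as exp (-k/2) for the sum over k.\<close>

lemma mellin_kernel_bound:
  assumes "norm s + 1 \<le> real M" "real k + 1 \<le> x" "x \<le> real k + 2"
  shows "norm (mellin_kernel s x) \<le> 2 * fact M * 2 ^ M * exp (-1/2) ^ k"
proof -
  have x1: "x \<ge> 1" using assms by linarith
  have "(Re s - 1) * ln x \<le> real M * ln (real k + 2)"
    using assms x1 complex_Re_le_cmod[of s] by (intro mult_mono ln_mono) auto
  hence "norm (exp ((s - 1) * of_real (ln x))) \<le> exp (real M * ln (real k + 2))" by simp
  also have "\<dots> = (real k + 2) ^ M" by (simp add: exp_of_nat_mult)
  also have "\<dots> = 2 ^ M * ((real k + 2) / 2) ^ M" unfolding power_mult_distrib [symmetric] by (intro arg_cong[where f = "\<lambda>x. x ^ M"]) simp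
  also have "\<dots> \<le> 2 ^ M * (fact M * exp ((real k + 2) / 2))" by (intro mult_left_mono power_le_fact_exp) auto
  finally have 1: "norm (exp ((s - 1) * of_real (ln x))) \<le> 2 ^ M * (fact M * exp ((real k + 2) / 2))" .
  have 2: "norm (of_real (exp x - 1) :: complex) \<ge> exp (real k + 1) / 2"
  proof -
    have "exp (real k + 1) / 2 \<le> exp x / 2" using assms by simp
    also have "\<dots> \<le> exp x - 1" by (rule exp_minus_one_ge[OF x1])
    also have "\<dots> \<le> norm (of_real (exp x - 1) :: complex)" unfolding norm_of_real by linarith
    finally show ?thesis .
  qed
  have "norm (mellin_kernel s x) \<le> 2 ^ M * (fact M * exp ((real k + 2) / 2)) / (exp (real k + 1) / 2)"
    unfolding mellin_kernel_def norm_divide by (intro frac_le 1 2) auto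
  also have "\<dots> = 2 * fact M * 2 ^ M * (exp ((real k + 2) / 2) / exp (real k + 1))" by simp
  also have "exp ((real k + 2) / 2) / exp (real k + 1) = exp (real k * (-1/2))"
    by (subst exp_diff [symmetric]) (simp add: field_simps)
  also have "\<dots> = exp (-1/2) ^ k" by (rule exp_of_nat_mult)
  finally show ?thesis .
qed

lemma mellin_piece_bound:
  assumes "norm s + 1 \<le> real M"
  shows "norm (mellin_piece k s) \<le> 2 * fact M * 2 ^ M * exp (-1/2) ^ k"
  using integral_bound[of "real k + 1" "real k + 2" "mellin_kernel s" "2 * fact M * 2 ^ M * exp (-1/2) ^ k"]
    mellin_kernel_continuous mellin_kernel_bound[OF assms] by (simp add: mellin_piece_def)

definition mellin_tail :: "complex \<Rightarrow> complex" where "mellin_tail s = (\<Sum>k. mellin_piece k s)"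

lemma mellin_tail: "mellin_tail holomorphic_on UNIV" "(\<lambda>k. mellin_piece k s) sums mellin_tail s" "order_bound mellin_tail"
proof -
  have sm: "summable (\<lambda>k. C * exp (-1/2) ^ k)" for C :: real by (intro summable_mult summable_geometric) simp
  have *: "\<exists>d>0. \<exists>u. summable u \<and> (\<forall>n. \<forall>y\<in>ball x d \<inter> UNIV. norm (mellin_piece n y) \<le> u n)" for x
  proof -
    define M where "M = nat \<lceil>norm x\<rceil> + 2"
    have "norm (mellin_piece n y) \<le> 2 * fact M * 2 ^ M * exp (-1/2) ^ n" if "y \<in> ball x 1 \<inter> UNIV" for n y
    proof (rule mellin_piece_bound)
      have "norm y \<le> norm x + 1" using that norm_triangle_sub[of y x] by (auto simp: dist_norm norm_minus_commute)
      thus "norm y + 1 \<le> real M" unfolding M_def by linarith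
    qed
    thus ?thesis using sm by (intro exI[of _ 1] conjI exI[of _ "\<lambda>n. 2 * fact M * 2 ^ M * exp (-1/2) ^ n"]) auto
  qed
  show "mellin_tail holomorphic_on UNIV" unfolding mellin_tail_def [abs_def] by (rule holomorphic_series(1)[OF open_UNIV mellin_piece_holomorphic *])
  show sums: "(\<lambda>k. mellin_piece k s) sums mellin_tail s" for s unfolding mellin_tail_def by (rule holomorphic_series(2)[OF open_UNIV mellin_piece_holomorphic * UNIV_I])
  define K where "K = (\<Sum>k. exp (-1/2) ^ k :: real)"
  have K: "K \<ge> 0" unfolding K_def using sm[of 1] by (intro suminf_nonneg) auto
  show "order_bound mellin_tail"
  proof (rule order_boundI)
    fix s :: complex
    obtain M :: nat where M: "norm s + 1 \<le> real M" "real M \<le> norm s + 2"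
      using norm_ge_zero[of s] by (intro that[of "nat \<lceil>norm s\<rceil> + 1"]) linarith+
    define X where "X = 1 + norm s"
    have X: "X \<ge> 1" by (simp add: X_def)
    have M: "norm s + 1 \<le> real M" "real M \<le> 2 * X" "real M \<ge> 1" using M norm_ge_zero[of s] unfolding X_def by argo+
    have "norm (mellin_tail s) \<le> (\<Sum>k. 2 * fact M * 2 ^ M * exp (-1/2) ^ k)"
      unfolding mellin_tail_def by (intro norm_suminf_le mellin_piece_bound M sm)
    also have "\<dots> = 2 * (fact M * 2 ^ M) * K" using sm[of 1] by (simp add: K_def suminf_mult mult_ac)
    finally have Is: "norm (mellin_tail s) \<le> 2 * (fact M * 2 ^ M) * K" .
    have "fact M * 2 ^ M \<le> real M ^ M * 2 ^ M" using fact_le_power[of M, where ?'a = real] by (intro mult_right_mono) auto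
    also have "\<dots> = (2 * real M) ^ M" by (simp add: power_mult_distrib mult.commute)
    also have "\<dots> = exp (real M * ln (2 * real M))" using M(3) by (subst exp_of_nat_mult) simp
    also have "\<dots> \<le> exp (2 * X * (4 * X powr (1/2)))"
    proof -
      \<comment> \<open>The logarithm in M! \<le> exp (M ln M) is traded for a square root of X;
        together with the factor M this gives the exponent 3/2.\<close>
      have "ln (2 * real M) \<le> ln (4 * X)" using M X by (intro ln_mono) auto
      also have "4 * X = (2 * X powr (1/2)) ^ 2" using X by (simp add: power_mult_distrib powr_half_sqrt)
      also have "ln \<dots> = 2 * ln (2 * X powr (1/2))" using X by (subst ln_realpow) auto
      also have "\<dots> \<le> 2 * (2 * X powr (1/2))" using X ln_le_minus_one[of "2 * X powr (1/2)"] by fastforce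
      finally have "ln (2 * real M) \<le> 4 * X powr (1/2)" by simp
      moreover have "ln (2 * real M) \<ge> 0" using M X by (intro ln_ge_zero) linarith
      ultimately show ?thesis using M X by (simp only: exp_le_cancel_iff) (intro mult_mono, auto)
    qed
    also have "2 * X * (4 * X powr (1/2)) = 8 * (X powr 1 * X powr (1/2))" using X by simp
    also have "X powr 1 * X powr (1/2) = X powr (3/2)" by (subst powr_add [symmetric]) simp
    finally have "fact M * 2 ^ M \<le> exp (8 * X powr (3/2))" .
    hence "2 * (fact M * 2 ^ M) * K \<le> 2 * exp (8 * X powr (3/2)) * K" using K by (intro mult_right_mono) auto
    with Is show "norm (mellin_tail s) \<le> 2 * K * exp (8 * (1 + norm s) powr (3/2))" by (simp add: X_def mult_ac)
  qed simp
qed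

definition zeta_reg :: "complex \<Rightarrow> complex" where "zeta_reg s = mellin_head s + gamma_factor s * mellin_tail s"

lemma zeta_reg_holomorphic: "zeta_reg holomorphic_on UNIV"
  unfolding zeta_reg_def by (intro holomorphic_intros mellin_head mellin_tail gamma_factor_holomorphic)

lemma zeta_reg_order_bound: "order_bound zeta_reg"
  unfolding zeta_reg_def [abs_def] by (intro order_bound_add order_bound_mult mellin_head mellin_tail order_bound_gamma_factor)

section \<open>Agreement with the Dirichlet series\<close>

definition zeta_series :: "complex \<Rightarrow> complex" where "zeta_series s = (\<Sum>n. 1 / of_nat (Suc n) powr s)"

lemma summable_Suc_powr: "a > 1 \<Longrightarrow> summable (\<lambda>n. real (Suc n) powr (-a))"
  by (subst summable_Suc_iff) (simp add: summable_real_powr_iff)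

lemma zeta_series:
  shows "zeta_series holomorphic_on {s. Re s > 1}"
    and "Re s > 1 \<Longrightarrow> (\<lambda>n. 1 / of_nat (Suc n) powr s) sums zeta_series s"
    and "Re s > 1 \<Longrightarrow> (\<lambda>n. - of_real (ln (real (Suc n))) / of_nat (Suc n) powr s) sums deriv zeta_series s"
proof -
  let ?S = "{s. Re s > 1}"
  have op: "open ?S" by (rule open_halfspace_Re_gt)
  have hol: "(\<lambda>s. 1 / of_nat (Suc n) powr s) holomorphic_on ?S" for n
    by (intro holomorphic_intros) auto
  have *: "\<exists>d>0. \<exists>h. summable h \<and> (\<forall>n. \<forall>y\<in>ball x d \<inter> ?S. norm (1 / of_nat (Suc n) powr y :: complex) \<le> h n)"
    if x: "x \<in> ?S" for x
  proof -
    define d where "d = (Re x - 1) / 2"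
    have d: "d > 0" using x by (simp add: d_def)
    have "norm (1 / of_nat (Suc n) powr y :: complex) \<le> real (Suc n) powr (-(1 + d))" if "y \<in> ball x d" for n y
    proof -
      have "\<bar>Re x - Re y\<bar> < d" using that abs_Re_le_cmod[of "x - y"] by (simp add: dist_norm)
      hence "1 + d \<le> Re y" unfolding d_def by argo
      hence "real (Suc n) powr (- Re y) \<le> real (Suc n) powr (-(1 + d))" by (intro powr_mono) auto
      thus ?thesis by (simp add: norm_divide norm_powr_real_powr powr_minus_divide)
    qed
    thus ?thesis using d summable_Suc_powr[of "1 + d"]
      by (intro exI[of _ d] conjI exI[of _ "\<lambda>n. real (Suc n) powr (-(1 + d))"]) auto
  qed
  have zs: "zeta_series = (\<lambda>s. \<Sum>n. 1 / of_nat (Suc n) powr s)" by (simp add: zeta_series_def fun_eq_iff)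
  show "zeta_series holomorphic_on {s. Re s > 1}" unfolding zs by (rule holomorphic_series(1)[OF op hol *])
  show "(\<lambda>n. 1 / of_nat (Suc n) powr s) sums zeta_series s" if "Re s > 1" unfolding zs
    by (rule holomorphic_series(2)[OF op hol *]) (use that in auto)
  have d: "deriv (\<lambda>s. 1 / of_nat (Suc n) powr s) s = - of_real (ln (real (Suc n))) / of_nat (Suc n) powr s" for n and s :: complex
  proof (rule DERIV_imp_deriv)
    have "((\<lambda>s. exp (- s * Ln (of_nat (Suc n)))) has_field_derivative exp (- s * Ln (of_nat (Suc n))) * - Ln (of_nat (Suc n))) (at s)"
      by (auto intro!: derivative_eq_intros)
    moreover have "exp (- s * Ln (of_nat (Suc n))) = 1 / of_nat (Suc n) powr s" for s :: complex
      by (simp add: powr_def exp_minus divide_inverse del: of_nat_Suc)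
    moreover have "Ln (of_nat (Suc n)) = of_real (ln (real (Suc n)))"
      by (metis Ln_of_real of_nat_0_less_iff of_real_of_nat_eq zero_less_Suc)
    ultimately show "((\<lambda>s. 1 / of_nat (Suc n) powr s) has_field_derivative
      - of_real (ln (real (Suc n))) / of_nat (Suc n) powr s) (at s)" by (simp del: of_nat_Suc)
  qed
  show "(\<lambda>n. - of_real (ln (real (Suc n))) / of_nat (Suc n) powr s) sums deriv zeta_series s" if "Re s > 1"
    using holomorphic_series(3)[OF op hol *, of s] that unfolding zs d by auto
qed

section \<open>The Mellin integral at real arguments above 2\<close>

lemma nn_integral_Gamma_scaled:
  fixes \<sigma> c :: real
  assumes "\<sigma> > 0" "c > 0"
  shows "(\<integral>\<^sup>+x. ennreal (indicator {0..} x * (x powr (\<sigma> - 1) * exp (- c * x))) \<partial>lborel) = ennreal (Gamma \<sigma> * c powr (-\<sigma>))"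
    (is "?X = _")
proof -
  have "ennreal (Gamma \<sigma>) = (\<integral>\<^sup>+t. ennreal (indicator {0..} t * t powr (\<sigma> - 1) / exp t) \<partial>lborel)"
    by (rule Gamma_conv_nn_integral_real[OF assms(1)])
  also have "\<dots> = ennreal \<bar>c\<bar> * (\<integral>\<^sup>+x. ennreal (indicator {0..} (0 + c * x) * (0 + c * x) powr (\<sigma> - 1) / exp (0 + c * x)) \<partial>lborel)"
    using assms by (intro nn_integral_real_affine) auto
  also have "(\<lambda>x. ennreal (indicator {0..} (0 + c * x) * (0 + c * x) powr (\<sigma> - 1) / exp (0 + c * x)))
      = (\<lambda>x. ennreal (c powr (\<sigma> - 1)) * ennreal (indicator {0..} x * (x powr (\<sigma> - 1) * exp (- c * x))))"
  proof
    fix x :: real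
    show "ennreal (indicator {0..} (0 + c * x) * (0 + c * x) powr (\<sigma> - 1) / exp (0 + c * x)) =
      ennreal (c powr (\<sigma> - 1)) * ennreal (indicator {0..} x * (x powr (\<sigma> - 1) * exp (- c * x)))"
      using assms by (cases "x \<ge> 0")
        (auto simp: powr_mult exp_minus divide_inverse zero_le_mult_iff simp flip: ennreal_mult')
  qed
  also have "(\<integral>\<^sup>+x. ennreal (c powr (\<sigma> - 1)) * ennreal (indicator {0..} x * (x powr (\<sigma> - 1) * exp (- c * x))) \<partial>lborel)
     = ennreal (c powr (\<sigma> - 1)) * ?X" by (rule nn_integral_cmult) auto
  finally have "ennreal (c powr (-\<sigma>)) * ennreal (Gamma \<sigma>) = ennreal (c powr (-\<sigma>)) * (ennreal \<bar>c\<bar> * ennreal (c powr (\<sigma> - 1))) * ?X"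
    by (simp add: mult.assoc)
  also have "ennreal (c powr (-\<sigma>)) * (ennreal \<bar>c\<bar> * ennreal (c powr (\<sigma> - 1))) = ennreal (c powr (-\<sigma>) * (c * c powr (\<sigma> - 1)))"
    using assms by (simp add: ennreal_mult)
  also have "c powr (-\<sigma>) * (c * c powr (\<sigma> - 1)) = 1"
    using assms by (simp add: powr_diff powr_minus)
  finally show ?thesis using assms by (simp add: mult.commute flip: ennreal_mult')
qed

lemma geometric_exp_suminf:
  assumes "x > (0::real)"
  shows "(\<lambda>n. exp (- real (Suc n) * x)) sums (1 / (exp x - 1))"
proof -
  have "(\<lambda>n. exp (-x) ^ n) sums (1 / (1 - exp (-x)))" using assms by (intro geometric_sums) auto
  hence "(\<lambda>n. exp (-x) * exp (-x) ^ n) sums (exp (-x) * (1 / (1 - exp (-x))))" by (rule sums_mult)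
  also have "(\<lambda>n. exp (-x) * exp (-x) ^ n) = (\<lambda>n. exp (- real (Suc n) * x))"
    by (simp add: algebra_simps flip: exp_of_nat_mult exp_add)
  also have "exp (-x) * (1 / (1 - exp (-x))) = 1 / (exp x - 1)"
    using assms by (simp add: exp_minus field_simps)
  finally show ?thesis .
qed

context
  fixes \<sigma> :: real assumes \<sigma>: "\<sigma> > 2"
begin

definition mellin_integrand :: "real \<Rightarrow> real" where "mellin_integrand x = x powr (\<sigma> - 1) / (exp x - 1)"

lemma mellin_integrand_nonneg: "x \<ge> 0 \<Longrightarrow> mellin_integrand x \<ge> 0" by (simp add: mellin_integrand_def)

text \<open>All terms are nonnegative, so sum and integral are exchanged in \<open>ennreal\<close>
  before any integrability is known.\<close>

lemma mellin_integrand_nn_integral: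
  "(\<integral>\<^sup>+x. ennreal (indicator {0..} x * mellin_integrand x) \<partial>lborel) = (\<Sum>n. ennreal (Gamma \<sigma> * real (Suc n) powr (-\<sigma>)))"
proof -
  have "ennreal (indicator {0..} x * mellin_integrand x) = (\<Sum>n. ennreal (indicator {0..} x * (x powr (\<sigma> - 1) * exp (- real (Suc n) * x))))" for x
  proof (cases "x > 0")
    case True
    have "(\<lambda>n. x powr (\<sigma> - 1) * exp (- real (Suc n) * x)) sums (x powr (\<sigma> - 1) * (1 / (exp x - 1)))"
      by (intro sums_mult geometric_exp_suminf True)
    hence "(\<Sum>n. ennreal (x powr (\<sigma> - 1) * exp (- real (Suc n) * x))) = ennreal (x powr (\<sigma> - 1) * (1 / (exp x - 1)))"
      by (intro suminf_ennreal_eq) auto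
    thus ?thesis using True by (simp add: mellin_integrand_def)
  qed (auto simp: mellin_integrand_def indicator_def)
  hence "(\<integral>\<^sup>+x. ennreal (indicator {0..} x * mellin_integrand x) \<partial>lborel)
      = (\<integral>\<^sup>+x. (\<Sum>n. ennreal (indicator {0..} x * (x powr (\<sigma> - 1) * exp (- real (Suc n) * x)))) \<partial>lborel)" by simp
  also have "\<dots> = (\<Sum>n. \<integral>\<^sup>+x. ennreal (indicator {0..} x * (x powr (\<sigma> - 1) * exp (- real (Suc n) * x))) \<partial>lborel)"
    by (rule nn_integral_suminf) auto
  also have "\<dots> = (\<Sum>n. ennreal (Gamma \<sigma> * real (Suc n) powr (-\<sigma>)))"
    using \<sigma> by (intro suminf_cong nn_integral_Gamma_scaled) auto
  finally show ?thesis .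
qed

text \<open>For \<sigma> > 2 already the first term x^(\<sigma> - 2) is continuous and at most 1 on
  [0,1], so the norms of the Taylor coefficients dominate uniformly. At x = 0 both sides are 0
  because \<open>0 powr _ = 0\<close>.\<close>

lemma mellin_integrand_has_integral_0: "((\<lambda>x. complex_of_real (mellin_integrand x)) has_integral (\<Sum>n. bernoulli_coeff n / of_real (\<sigma> - 1 + real n))) {0..1}"
proof -
  let ?f = "\<lambda>n x. bernoulli_coeff n * complex_of_real (x powr (\<sigma> - 2 + real n))"
  have int: "(?f n has_integral bernoulli_coeff n / of_real (\<sigma> - 1 + real n)) {0..1}" for n
    using has_integral_mult_right[OF has_integral_of_real[OF has_integral_powr_from_0[of "\<sigma> - 2 + real n" 1]], of "bernoulli_coeff n"] \<sigma>
    by (simp add: algebra_simps)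
  have lim: "uniform_limit {0..1} (\<lambda>N x. \<Sum>n<N. ?f n x) (\<lambda>x. \<Sum>n. ?f n x) sequentially"
  proof (rule Weierstrass_m_test[OF _ bernoulli_coeff_summable])
    fix n x assume "x \<in> {0..1::real}"
    hence "x powr (\<sigma> - 2 + real n) \<le> 1" using \<sigma> by (intro powr_le1) auto
    thus "norm (?f n x) \<le> norm (bernoulli_coeff n)" by (simp add: norm_mult mult_left_le)
  qed
  have sum_eq: "(\<Sum>n. ?f n x) = complex_of_real (mellin_integrand x)" if x: "x \<in> {0..1}" for x
  proof (cases "x = 0")
    case False
    hence x0: "x > 0" using x by auto
    have "(\<lambda>n. of_real (x powr (\<sigma> - 2)) * (bernoulli_coeff n * of_real x ^ n)) sums (of_real (x powr (\<sigma> - 2)) * bernoulli_gf (of_real x))"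
      using x by (intro sums_mult bernoulli_gf_sums) auto
    moreover have "of_real (x powr (\<sigma> - 2)) * (bernoulli_coeff n * of_real x ^ n) = ?f n x" for n
      using x0 by (simp add: powr_add powr_realpow)
    ultimately have "(\<Sum>n. ?f n x) = of_real (x powr (\<sigma> - 2)) * bernoulli_gf (of_real x)" by (simp add: sums_iff)
    also have "bernoulli_gf (of_real x) = of_real (x / (exp x - 1))" using x0 by (simp add: bernoulli_gf_def exp_of_real)
    also have "of_real (x powr (\<sigma> - 2)) * complex_of_real (x / (exp x - 1)) = of_real (x powr (\<sigma> - 2) * x / (exp x - 1))" by simp
    also have "x powr (\<sigma> - 2) * x = x powr (\<sigma> - 2) * x powr 1" using x0 by simp
    also have "\<dots> = x powr (\<sigma> - 1)" by (subst powr_add [symmetric]) simp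
    finally show ?thesis by (simp add: mellin_integrand_def)
  qed (use \<sigma> in \<open>auto simp: mellin_integrand_def\<close>)
  obtain I' J' where IJ: "\<And>N. ((\<lambda>x. \<Sum>n<N. ?f n x) has_integral I' N) {0..1}"
    "((\<lambda>x. \<Sum>n. ?f n x) has_integral J') {0..1}" "I' \<longlonglongrightarrow> J'"
  proof (rule uniform_limit_integral[OF lim])
    show "continuous_on {0..1} (\<lambda>x. \<Sum>n<N. ?f n x)" for N
      using \<sigma> by (intro continuous_intros continuous_on_powr') auto
  qed auto
  have "I' N = (\<Sum>n<N. bernoulli_coeff n / of_real (\<sigma> - 1 + real n))" for N
    by (rule has_integral_unique[OF IJ(1)]) (intro has_integral_sum int, auto)
  hence "I' = (\<lambda>N. \<Sum>n<N. bernoulli_coeff n / of_real (\<sigma> - 1 + real n))" by (rule ext)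
  hence "(\<lambda>n. bernoulli_coeff n / of_real (\<sigma> - 1 + real n)) sums J'" using IJ(3) unfolding sums_def by (simp only:)
  hence "J' = (\<Sum>n. bernoulli_coeff n / of_real (\<sigma> - 1 + real n))" by (simp add: sums_iff)
  moreover have "((\<lambda>x. complex_of_real (mellin_integrand x)) has_integral J') {0..1}"
    using IJ(2) by (rule has_integral_eq[rotated]) (rule sum_eq)
  ultimately show ?thesis by simp
qed

lemma mellin_kernel_of_real: "x > 0 \<Longrightarrow> mellin_kernel (of_real \<sigma>) x = of_real (mellin_integrand x)"
  by (simp add: mellin_kernel_def mellin_integrand_def powr_def flip: exp_of_real)

text \<open>The same integral is computed twice in \<open>ennreal\<close>: termwise as a Dirichlet
  series and by unit intervals. Finiteness of the first result provides the summability of the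
  second.\<close>

lemma zeta_series_Gamma: "of_real (Gamma \<sigma>) * zeta_series (of_real \<sigma>) = (\<Sum>n. bernoulli_coeff n / of_real (\<sigma> - 1 + real n)) + mellin_tail (of_real \<sigma>)"
proof -
  define C where "C = (\<Sum>n. bernoulli_coeff n / of_real (\<sigma> - 1 + real n))"
  \<comment> \<open>\<open>i k\<close> is the integral over [k, k + 1]. Real parts are taken because
    head and pieces are complex by definition; \<open>C_real\<close> and
    \<open>mellin_piece_real\<close> show that nothing is lost.\<close>
  define i where "i = (\<lambda>k. if k = 0 then Re C else Re (mellin_piece (k - 1) (of_real \<sigma>)))"
  have ik: "(mellin_integrand has_integral i k) {real k..real k + 1}" for k
  proof (cases k)
    case 0
    thus ?thesis using has_integral_linear[OF mellin_integrand_has_integral_0 bounded_linear_Re] by (simp add: i_def C_def o_def)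
  next
    case (Suc j)
    have "(mellin_kernel (of_real \<sigma>) has_integral mellin_piece j (of_real \<sigma>)) {real k..real k + 1}"
      unfolding mellin_piece_def using integrable_integral[OF integrable_continuous_interval[OF mellin_kernel_continuous[of j "of_real \<sigma>"]]] Suc
      by (simp add: add_ac)
    hence "((\<lambda>x. complex_of_real (mellin_integrand x)) has_integral mellin_piece j (of_real \<sigma>)) {real k..real k + 1}"
      by (rule has_integral_eq[rotated]) (use Suc in \<open>simp add: mellin_kernel_of_real\<close>)
    from has_integral_linear[OF this bounded_linear_Re] show ?thesis using Suc by (simp add: i_def o_def)
  qed
  have C_real: "C = of_real (i 0)"
  proof (rule has_integral_unique)
    show "((\<lambda>x. complex_of_real (mellin_integrand x)) has_integral C) {0..1}" unfolding C_def by (rule mellin_integrand_has_integral_0)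
    show "((\<lambda>x. complex_of_real (mellin_integrand x)) has_integral of_real (i 0)) {0..1}"
      using has_integral_of_real[OF ik[of 0]] by simp
  qed
  have mellin_piece_real: "mellin_piece j (of_real \<sigma>) = of_real (i (Suc j))" for j
  proof (rule has_integral_unique)
    show "(mellin_kernel (of_real \<sigma>) has_integral mellin_piece j (of_real \<sigma>)) {real (Suc j)..real (Suc j) + 1}"
      unfolding mellin_piece_def using integrable_integral[OF integrable_continuous_interval[OF mellin_kernel_continuous[of j "of_real \<sigma>"]]]
      by (simp add: add_ac)
    show "(mellin_kernel (of_real \<sigma>) has_integral of_real (i (Suc j))) {real (Suc j)..real (Suc j) + 1}"
      using has_integral_of_real[OF ik[of "Suc j"]] by (rule has_integral_eq[rotated]) (simp add: mellin_kernel_of_real)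
  qed
  have i0: "i k \<ge> 0" for k
    by (rule has_integral_nonneg[OF ik]) (auto intro: mellin_integrand_nonneg)
  have "(\<integral>\<^sup>+x. ennreal (indicator {real k..<real k + 1} x * mellin_integrand x) \<partial>lborel) = ennreal (i k)" for k
  proof -
    \<comment> \<open>Half-open intervals tile the half line, so that the indicators add up to 1 at
      every point; the removed endpoint is negligible.\<close>
    have "(mellin_integrand has_integral i k) {real k..real k + 1} \<longleftrightarrow> (mellin_integrand has_integral i k) {real k..<real k + 1}"
      by (rule has_integral_spike_set_eq) (rule negligible_subset[of "{real k + 1}"], auto)+
    hence "(mellin_integrand has_integral i k) {real k..<real k + 1}" using ik by simp
    moreover have "0 \<le> mellin_integrand x" if "x \<in> {real k..<real k + 1}" for x using that by (intro mellin_integrand_nonneg) auto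
    ultimately show ?thesis by (intro nn_integral_has_integral_lebesgue)
  qed
  hence "(\<Sum>k. ennreal (i k)) = (\<Sum>k. \<integral>\<^sup>+x. ennreal (indicator {real k..<real k + 1} x * mellin_integrand x) \<partial>lborel)" by simp
  also have "\<dots> = (\<integral>\<^sup>+x. (\<Sum>k. ennreal (indicator {real k..<real k + 1} x * mellin_integrand x)) \<partial>lborel)"
    by (rule nn_integral_suminf [symmetric]) (auto simp: mellin_integrand_def)
  also have "(\<lambda>x. \<Sum>k. ennreal (indicator {real k..<real k + 1} x * mellin_integrand x)) = (\<lambda>x. ennreal (indicator {0..} x * mellin_integrand x))"
  proof
    fix x :: real
    show "(\<Sum>k. ennreal (indicator {real k..<real k + 1} x * mellin_integrand x)) = ennreal (indicator {0..} x * mellin_integrand x)"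
    proof (cases "x \<ge> 0")
      case True
      have "indicator {real k..<real k + 1} x = (if k = nat \<lfloor>x\<rfloor> then 1 else 0 :: real)" for k
        using True by (auto simp: indicator_def) linarith+
      hence "(\<Sum>k. ennreal (indicator {real k..<real k + 1} x * mellin_integrand x)) = (\<Sum>k. if k = nat \<lfloor>x\<rfloor> then ennreal (mellin_integrand x) else 0)"
        by (intro suminf_cong) auto
      also have "\<dots> = ennreal (mellin_integrand x)" using sums_If_finite_set[of "{nat \<lfloor>x\<rfloor>}" "\<lambda>_. ennreal (mellin_integrand x)"] by (simp add: sums_iff)
      finally show ?thesis using True by simp
    next
      case False
      hence "indicator {real k..<real k + 1} x = (0 :: real)" for k by (auto simp: indicator_def)
      thus ?thesis using False by simp
    qed
  qed
  also have "(\<integral>\<^sup>+x. ennreal (indicator {0..} x * mellin_integrand x) \<partial>lborel) = (\<Sum>n. ennreal (Gamma \<sigma> * real (Suc n) powr (-\<sigma>)))"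
    by (rule mellin_integrand_nn_integral)
  also have "\<dots> = ennreal (\<Sum>n. Gamma \<sigma> * real (Suc n) powr (-\<sigma>))"
    using \<sigma> Gamma_real_pos[of \<sigma>] by (intro suminf_ennreal2 summable_mult summable_Suc_powr) auto
  finally have eq: "(\<Sum>k. ennreal (i k)) = ennreal (\<Sum>n. Gamma \<sigma> * real (Suc n) powr (-\<sigma>))" .
  have sum_i: "summable i" using eq i0 by (intro summable_suminf_not_top) auto
  have "(\<Sum>k. ennreal (i k)) = ennreal (suminf i)" by (intro suminf_ennreal2 i0 sum_i)
  moreover have "0 \<le> suminf i" by (intro suminf_nonneg i0 sum_i)
  moreover have "0 \<le> (\<Sum>n. Gamma \<sigma> * real (Suc n) powr (-\<sigma>))"
    using \<sigma> Gamma_real_pos[of \<sigma>] by (intro suminf_nonneg summable_mult summable_Suc_powr) auto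
  ultimately have eq2: "suminf i = (\<Sum>n. Gamma \<sigma> * real (Suc n) powr (-\<sigma>))"
    using eq by simp
  have "of_real (Gamma \<sigma>) * zeta_series (of_real \<sigma>) = complex_of_real (Gamma \<sigma> * (\<Sum>n. real (Suc n) powr (-\<sigma>)))"
  proof -
    have "(\<lambda>n. complex_of_real (real (Suc n) powr (-\<sigma>))) sums of_real (\<Sum>n. real (Suc n) powr (-\<sigma>))"
      using \<sigma> by (intro sums_of_real summable_sums summable_Suc_powr) auto
    moreover have "complex_of_real (real (Suc n) powr (-\<sigma>)) = 1 / of_nat (Suc n) powr (of_real \<sigma>)" for n
    proof -
      have "of_nat (Suc n) powr complex_of_real \<sigma> = of_real (real (Suc n) powr \<sigma>)"
        using powr_of_real[of "real (Suc n)" \<sigma>] by simp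
      thus ?thesis unfolding powr_minus_divide by (simp del: of_nat_Suc)
    qed
    ultimately show ?thesis by (simp add: zeta_series_def sums_iff)
  qed
  also have "\<dots> = of_real (suminf i)" unfolding eq2 using \<sigma> by (subst suminf_mult) (use \<sigma> summable_Suc_powr[of \<sigma>] in auto)
  also have "suminf i = i 0 + (\<Sum>k. i (Suc k))" using suminf_split_head[OF sum_i] by simp
  also have "complex_of_real (i 0 + (\<Sum>k. i (Suc k))) = C + mellin_tail (of_real \<sigma>)"
    using sum_i by (simp add: C_real mellin_tail_def mellin_piece_real suminf_of_real summable_Suc_iff)
  finally show ?thesis by (simp add: C_def)
qed

lemma zeta_reg_eq_of_real: "zeta_reg (of_real \<sigma>) = (of_real \<sigma> - 1) * zeta_series (of_real \<sigma>)"
proof -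
  have quot: "gamma_quotient n (of_real \<sigma>) = gamma_factor (of_real \<sigma>) / of_real (\<sigma> - 1 + real n)" for n
  proof -
    have "Re (of_real \<sigma>) \<noteq> Re (1 - of_nat n)" using \<sigma> by simp
    hence "of_real \<sigma> \<noteq> (1 - of_nat n :: complex)" by metis
    thus ?thesis by (simp add: gamma_quotient_eq algebra_simps)
  qed
  have hG: "gamma_factor (of_real \<sigma>) * of_real (Gamma \<sigma>) = of_real \<sigma> - 1"
  proof -
    have "Gamma \<sigma> > 0" using \<sigma> by (intro Gamma_real_pos) auto
    hence "Gamma (complex_of_real \<sigma>) \<noteq> 0" by (simp add: Gamma_complex_of_real)
    thus ?thesis by (simp add: gamma_factor_def rGamma_inverse_Gamma Gamma_complex_of_real)
  qed
  hence h0: "gamma_factor (of_real \<sigma>) \<noteq> 0" using \<sigma> by (auto simp: complex_eq_iff)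
  have "mellin_head (of_real \<sigma>) = (\<Sum>n. gamma_factor (of_real \<sigma>) * (bernoulli_coeff n / of_real (\<sigma> - 1 + real n)))"
    unfolding mellin_head_def quot by (simp add: mult_ac)
  also have "\<dots> = gamma_factor (of_real \<sigma>) * (\<Sum>n. bernoulli_coeff n / of_real (\<sigma> - 1 + real n))"
  proof (rule suminf_mult)
    have "summable (\<lambda>n. bernoulli_coeff n * gamma_quotient n (of_real \<sigma>) / gamma_factor (of_real \<sigma>))" using mellin_head(2)[of "of_real \<sigma>"] by (intro summable_divide) (auto simp: sums_iff)
    thus "summable (\<lambda>n. bernoulli_coeff n / of_real (\<sigma> - 1 + real n))" using h0 by (simp add: quot)
  qed
  finally have "zeta_reg (of_real \<sigma>) = gamma_factor (of_real \<sigma>) * (of_real (Gamma \<sigma>) * zeta_series (of_real \<sigma>))"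
    by (simp add: zeta_reg_def zeta_series_Gamma distrib_left)
  thus ?thesis by (simp add: hG flip: mult.assoc)
qed

end

text \<open>The identity theorem in the half plane Re s > 1: the real ray beyond 2 accumulates at
  the interior point 3.\<close>

lemma zeta_reg_eq_zeta_series:
  assumes "Re s > 1"
  shows "zeta_reg s = (s - 1) * zeta_series s"
proof -
  let ?S = "{s. Re s > 1}" and ?U = "complex_of_real ` {2<..}"
  have "zeta_reg s - (s - 1) * zeta_series s = 0"
  proof (rule analytic_continuation[of "\<lambda>s. zeta_reg s - (s - 1) * zeta_series s" ?S ?U 3])
    show "(\<lambda>s. zeta_reg s - (s - 1) * zeta_series s) holomorphic_on ?S"
      by (intro holomorphic_intros zeta_series(1)) (rule holomorphic_on_subset[OF zeta_reg_holomorphic], auto)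
    show "connected ?S" by (intro convex_connected convex_halfspace_Re_gt)
    show "3 islimpt ?U" unfolding islimpt_approachable
    proof (intro allI impI)
      fix e :: real assume "e > 0"
      thus "\<exists>x'\<in>?U. x' \<noteq> 3 \<and> dist x' 3 < e"
        by (intro bexI[of _ "of_real (3 + e / 2)"] imageI) (auto simp: dist_norm norm_divide)
    qed
  qed (use assms zeta_reg_eq_of_real in \<open>auto simp: open_halfspace_Re_gt\<close>)
  thus ?thesis by simp
qed

section \<open>The values \<open>\<zeta>(0)\<close> and \<open>\<zeta>'(0)\<close>\<close>

text \<open>
  \<open>1 - s\<close> times the error of the trapezoidal rule for \<open>x\<^bsup>-s\<^esup>\<close> on \<open>[n + 1, n + 2]\<close>. It is of order
  \<open>n\<^bsup>-Re s - 2\<^esup>\<close>, so its sum converges beyond \<open>s = 0\<close>.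
\<close>

definition trapezoid_defect :: "nat \<Rightarrow> complex \<Rightarrow> complex" where
  "trapezoid_defect n s = of_nat (Suc (Suc n)) powr (1 - s) - of_nat (Suc n) powr (1 - s)
     - (1 - s) / 2 * (of_nat (Suc n) powr (-s) + of_nat (Suc (Suc n)) powr (-s))"

text \<open>As a function g of the right endpoint t, the error vanishes at t = N together with g',
  and g'' is of size N^(-Re s - 2). The mean value inequality on the segment is applied
  twice.\<close>

lemma trapezoid_defect_bound:
  assumes s: "Re s > -1"
  shows "norm (trapezoid_defect n s) \<le> norm ((1 - s) * s * (1 + s)) * real (Suc n) powr (- Re s - 2)"
proof -
  define N :: real where "N = real (Suc n)"
  define p where "p = 1 - s"
  define S where "S = closed_segment (complex_of_real N) (of_real (N + 1))"
  have N: "N \<ge> 1" by (simp add: N_def)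
  have S: "\<exists>x. t = of_real x \<and> N \<le> x \<and> x \<le> N + 1" if "t \<in> S" for t
    using that unfolding S_def closed_segment_of_real by (auto simp: closed_segment_eq_real_ivl)
  define M where "M = norm ((1 - s) * s * (1 + s)) * N powr (- Re s - 2)"
  define g where "g = (\<lambda>t. t powr p - of_real N powr p - p * (t - of_real N) / 2 * (of_real N powr (p - 1) + t powr (p - 1)))"
  define g1 where "g1 = (\<lambda>t. p * t powr (p - 1) - p / 2 * (of_real N powr (p - 1) + t powr (p - 1))
      - p * (t - of_real N) / 2 * ((p - 1) * t powr (p - 1 - 1)))"
  define g2 where "g2 = (\<lambda>t. - (p * (p - 1) * (p - 1 - 1) / 2 * (t - of_real N) * t powr (p - 1 - 1 - 1)))"
  have nonpos: "t \<notin> \<real>\<^sub>\<le>\<^sub>0" if "t \<in> S" for t using S[OF that] N by auto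
  have pd: "((\<lambda>t. t powr q) has_field_derivative q * t powr (q - 1)) (at t within S)" if "t \<in> S" for q t
    by (rule has_field_derivative_at_within[OF has_field_derivative_powr[OF nonpos[OF that]]])
  have lin: "((\<lambda>t. p * (t - of_real N) / 2) has_field_derivative p / 2) (at t within S)" for t
    by (auto intro!: derivative_eq_intros)
  have d: "(g has_field_derivative g1 t) (at t within S)" if "t \<in> S" for t
  proof -
    have "(g has_field_derivative p * t powr (p - 1) - 0 - (p / 2 * (of_real N powr (p - 1) + t powr (p - 1))
        + (0 + (p - 1) * t powr (p - 1 - 1)) * (p * (t - of_real N) / 2))) (at t within S)"
      unfolding g_def by (rule lin pd[OF that] DERIV_diff DERIV_cmult DERIV_mult DERIV_add DERIV_const)+
    thus ?thesis by (simp add: g1_def algebra_simps)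
  qed
  have d1: "(g1 has_field_derivative g2 t) (at t within S)" if "t \<in> S" for t
  proof -
    have "(g1 has_field_derivative p * ((p - 1) * t powr (p - 1 - 1)) - p / 2 * (0 + (p - 1) * t powr (p - 1 - 1))
       - (p / 2 * ((p - 1) * t powr (p - 1 - 1))
          + ((p - 1) * ((p - 1 - 1) * t powr (p - 1 - 1 - 1))) * (p * (t - of_real N) / 2))) (at t within S)"
      unfolding g1_def by (rule lin pd[OF that] DERIV_diff DERIV_cmult DERIV_mult DERIV_add DERIV_const)+
    moreover have "p * ((p - 1) * X) - p / 2 * (0 + (p - 1) * X) - (p / 2 * ((p - 1) * X) + ((p - 1) * ((p - 1 - 1) * Y)) * (p * (t - n) / 2))
       = - (p * (p - 1) * (p - 1 - 1) / 2 * (t - n) * Y)" for X Y n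
      by (simp add: field_simps)
    ultimately show ?thesis by (simp only: g2_def)
  qed
  have g2_le: "norm (g2 t) \<le> M" if "t \<in> S" for t
  proof -
    obtain x where x: "t = of_real x" "N \<le> x" "x \<le> N + 1" using S[OF \<open>t \<in> S\<close>] by blast
    have "norm (t powr (p - 1 - 1 - 1)) = x powr (- Re s - 2)"
      using x N by (simp add: norm_powr_real_powr p_def algebra_simps)
    also have "\<dots> \<le> N powr (- Re s - 2)" using x N s by (intro powr_mono2') auto
    finally have 1: "norm (t powr (p - 1 - 1 - 1)) \<le> N powr (- Re s - 2)" .
    have 2: "norm ((t - of_real N) / 2) \<le> 1" using x by (simp add: norm_divide flip: of_real_diff)
    have 3: "norm (p * (p - 1) * (p - 1 - 1)) = norm ((1 - s) * s * (1 + s))"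
      by (rule arg_cong[where f = norm]) (simp add: p_def algebra_simps)
    have "norm (g2 t) = norm (p * (p - 1) * (p - 1 - 1)) * norm ((t - of_real N) / 2) * norm (t powr (p - 1 - 1 - 1))"
      unfolding g2_def by (simp only: norm_minus_cancel flip: norm_mult) simp
    also have "\<dots> \<le> norm ((1 - s) * s * (1 + s)) * 1 * N powr (- Re s - 2)"
      unfolding 3 by (intro mult_mono 1 2) auto
    finally show ?thesis by (simp add: M_def)
  qed
  have cv: "convex S" unfolding S_def by (rule convex_closed_segment)
  have NS: "of_real N \<in> S" unfolding S_def by simp
  have g1_le: "norm (g1 t) \<le> M" if "t \<in> S" for t
  proof -
    have "norm (g1 t - g1 (of_real N)) \<le> M * norm (t - of_real N)"
      by (rule field_differentiable_bound[OF cv d1 g2_le that NS])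
    also have "norm (t - of_real N) \<le> 1" using S[OF that] by (auto simp flip: of_real_diff)
    finally show ?thesis by (simp add: g1_def M_def mult_left_mono)
  qed
  have "norm (g (of_real (N + 1)) - g (of_real N)) \<le> M * norm (of_real (N + 1) - of_real N :: complex)"
    by (rule field_differentiable_bound[OF cv d g1_le _ NS]) (auto simp: S_def)
  moreover have "g (of_real (N + 1)) - g (of_real N) = trapezoid_defect n s"
    by (simp add: g_def trapezoid_defect_def N_def p_def add_ac)
  ultimately show ?thesis by (simp add: M_def N_def)
qed

lemma trapezoid_defect_series:
  shows "(\<lambda>s. \<Sum>n. trapezoid_defect n s) holomorphic_on {s. Re s > -1}"
    and "Re s > -1 \<Longrightarrow> (\<lambda>n. trapezoid_defect n s) sums (\<Sum>n. trapezoid_defect n s)"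
    and "Re s > -1 \<Longrightarrow> (\<lambda>n. deriv (trapezoid_defect n) s) sums deriv (\<lambda>s. \<Sum>n. trapezoid_defect n s) s"
proof -
  let ?S = "{s. Re s > -1}"
  have op: "open ?S" by (rule open_halfspace_Re_gt)
  have hol: "trapezoid_defect n holomorphic_on ?S" for n
    unfolding trapezoid_defect_def by (intro holomorphic_intros) auto
  have *: "\<exists>d>0. \<exists>h. summable h \<and> (\<forall>n. \<forall>y\<in>ball x d \<inter> ?S. norm (trapezoid_defect n y) \<le> h n)"
    if x: "x \<in> ?S" for x
  proof -
    \<comment> \<open>Half the distance to the boundary line: every y in the ball then has - Re y -
      2 \<le> -(1 + d), a summable exponent.\<close>
    define d where "d = (Re x + 1) / 2"
    have d: "d > 0" using x by (simp add: d_def)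
    define K where "K = (1 + norm x + d)"
    have "norm (trapezoid_defect n y) \<le> K * K * K * real (Suc n) powr (-(1 + d))" if y: "y \<in> ball x d \<inter> ?S" for n y
    proof -
      have "\<bar>Re x - Re y\<bar> < d" using y abs_Re_le_cmod[of "x - y"] by (simp add: dist_norm)
      hence "- Re y - 2 \<le> -(1 + d)" unfolding d_def by argo
      hence 1: "real (Suc n) powr (- Re y - 2) \<le> real (Suc n) powr (-(1 + d))" by (intro powr_mono) auto
      have "norm y \<le> norm x + d" using y norm_triangle_sub[of y x] by (auto simp: dist_norm norm_minus_commute)
      hence "norm (1 - y) \<le> K" "norm y \<le> K" "norm (1 + y) \<le> K"
        using norm_triangle_ineq4[of 1 y] norm_triangle_ineq[of 1 y] by (auto simp: K_def)
      hence "norm ((1 - y) * y * (1 + y)) \<le> K * K * K" unfolding norm_mult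
        by (intro mult_mono) (use d in \<open>auto simp: K_def\<close>)
      moreover have "norm (trapezoid_defect n y) \<le> norm ((1 - y) * y * (1 + y)) * real (Suc n) powr (- Re y - 2)"
        using y by (intro trapezoid_defect_bound) auto
      moreover have "norm ((1 - y) * y * (1 + y)) * real (Suc n) powr (- Re y - 2) \<le> K * K * K * real (Suc n) powr (-(1 + d))"
        by (intro mult_mono calculation 1) (use d in \<open>auto simp: K_def\<close>)
      ultimately show ?thesis by linarith
    qed
    thus ?thesis using d summable_mult[OF summable_Suc_powr[of "1 + d"], of "K * K * K"]
      by (intro exI[of _ d] conjI exI[of _ "\<lambda>n. K * K * K * real (Suc n) powr (-(1 + d))"]) auto
  qed
  show "(\<lambda>s. \<Sum>n. trapezoid_defect n s) holomorphic_on ?S" by (rule holomorphic_series(1)[OF op hol *])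
  show "(\<lambda>n. trapezoid_defect n s) sums (\<Sum>n. trapezoid_defect n s)" if "Re s > -1"
    by (rule holomorphic_series(2)[OF op hol *]) (use that in auto)
  show "(\<lambda>n. deriv (trapezoid_defect n) s) sums deriv (\<lambda>s. \<Sum>n. trapezoid_defect n s) s" if "Re s > -1"
    by (rule holomorphic_series(3)[OF op hol *]) (use that in auto)
qed

lemma sum_trapezoid_telescope:
  fixes x u :: "nat \<Rightarrow> 'a :: comm_ring_1"
  shows "(\<Sum>n<M. x (Suc n) - x n - c * (u n + u (Suc n))) = x M - x 0 - c * (2 * (\<Sum>n<M. u n) - u 0 + u M)"
  by (induction M) (simp_all add: algebra_simps)

lemma sum_trapezoid_defect:
  "(\<Sum>n<M. trapezoid_defect n s) = of_nat (Suc M) powr (1 - s) - 1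
     - (1 - s) / 2 * (2 * (\<Sum>n<M. of_nat (Suc n) powr (-s)) - 1 + of_nat (Suc M) powr (-s))"
  using sum_trapezoid_telescope[of "\<lambda>n. of_nat (Suc n) powr (1 - s)" "(1 - s) / 2" "\<lambda>n. of_nat (Suc n) powr (-s)" M]
  by (simp add: trapezoid_defect_def)

lemma tendsto_Suc_powr_0:
  assumes "Re s > 0"
  shows "(\<lambda>n. of_nat (Suc n) powr (-s) :: complex) \<longlonglongrightarrow> 0"
proof (rule tendsto_norm_zero_cancel)
  have "(\<lambda>n. real (Suc n) powr (- Re s)) \<longlonglongrightarrow> 0"
    using assms by (intro tendsto_neg_powr filterlim_compose[OF filterlim_real_sequentially filterlim_Suc]) auto
  thus "(\<lambda>n. norm (of_nat (Suc n) powr (-s) :: complex)) \<longlonglongrightarrow> 0"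
    by (simp add: norm_powr_real_powr)
qed

text \<open>Euler-Maclaurin summation. For Re s > 1 the boundary terms at M tend to 0, and the
  right-hand side continues past s = 0.\<close>

lemma zeta_reg_eq_trapezoid:
  assumes "Re s > -1"
  shows "zeta_reg s = 1 + (s - 1) / 2 + (\<Sum>n. trapezoid_defect n s)"
proof (rule analytic_continuation_open[of "{s. Re s > 1}" "{s. Re s > -1}" zeta_reg "\<lambda>s. 1 + (s - 1) / 2 + (\<Sum>n. trapezoid_defect n s)"])
  show "zeta_reg s = 1 + (s - 1) / 2 + (\<Sum>n. trapezoid_defect n s)" if "s \<in> {s. Re s > 1}" for s
  proof -
    have s: "Re s > 1" using that by simp
    have "(\<lambda>n. of_nat (Suc n) powr (-s)) sums zeta_series s"
      using zeta_series(2)[OF s] by (simp add: powr_minus divide_inverse)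
    hence 1: "(\<lambda>M. \<Sum>n<M. of_nat (Suc n) powr (-s)) \<longlonglongrightarrow> zeta_series s" unfolding sums_def .
    have 2: "(\<lambda>M. of_nat (Suc M) powr (1 - s)) \<longlonglongrightarrow> 0" using tendsto_Suc_powr_0[of "s - 1"] s by simp
    have 3: "(\<lambda>M. of_nat (Suc M) powr (-s)) \<longlonglongrightarrow> 0" using tendsto_Suc_powr_0[of s] s by simp
    have "(\<lambda>M. \<Sum>n<M. trapezoid_defect n s) \<longlonglongrightarrow> 0 - 1 - (1 - s) / 2 * (2 * zeta_series s - 1 + 0)"
      unfolding sum_trapezoid_defect by (intro tendsto_intros 1 2 3)
    moreover have "(\<lambda>M. \<Sum>n<M. trapezoid_defect n s) \<longlonglongrightarrow> (\<Sum>n. trapezoid_defect n s)"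
      using trapezoid_defect_series(2)[of s] s by (simp add: sums_def)
    ultimately have "(\<Sum>n. trapezoid_defect n s) = 0 - 1 - (1 - s) / 2 * (2 * zeta_series s - 1 + 0)"
      by (rule LIMSEQ_unique[rotated])
    thus ?thesis unfolding zeta_reg_eq_zeta_series[OF s] by (simp add: field_simps)
  qed
  show "connected {s. Re s > -1}" by (intro convex_connected convex_halfspace_Re_gt)
  show "{s. 1 < Re s} \<noteq> {}" proof -
    have "2 \<in> {s. 1 < Re s}" by simp
    thus ?thesis by blast
  qed
  show "(\<lambda>s. 1 + (s - 1) / 2 + (\<Sum>n. trapezoid_defect n s)) holomorphic_on {s. Re s > -1}"
    by (intro holomorphic_intros trapezoid_defect_series) auto
qed (use assms zeta_reg_holomorphic in \<open>auto simp: open_halfspace_Re_gt intro: holomorphic_on_subset\<close>)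

text \<open>At s = 0 the integrand is constant and the trapezoidal rule exact; at s = 1 the factor 1
  - s kills the defect.\<close>

lemma trapezoid_defect_0: "trapezoid_defect n 0 = 0" and trapezoid_defect_1: "trapezoid_defect n 1 = 0"
proof -
  have "(of_nat (Suc k) :: complex) powr 0 = 1" "(of_nat (Suc k) :: complex) powr 1 = of_nat (Suc k)" for k
    by (simp_all del: of_nat_Suc)
  thus "trapezoid_defect n 0 = 0" "trapezoid_defect n 1 = 0" by (simp_all add: trapezoid_defect_def del: of_nat_Suc) simp
qed

lemma zeta_reg_1: "zeta_reg 1 = 1" and zeta_reg_0: "zeta_reg 0 = 1 / 2"
  by (simp_all add: zeta_reg_eq_trapezoid trapezoid_defect_0 trapezoid_defect_1)

text \<open>
  The derivatives of the trapezoidal defects at \<open>0\<close> are the increments of this sequence, hence its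
  limit, Stirling's constant, determines \<open>\<zeta>'(0)\<close>.
\<close>

definition stirling_defect :: "nat \<Rightarrow> real" where "stirling_defect n = ln (fact n) - (real n + 1/2) * ln (real n) + real n"

section \<open>Wallis's product, Stirling's constant and the derivative at 0\<close>

lemma wallis_prod: "(\<Prod>k=1..n. (4 * real k^2) / (4 * real k^2 - 1)) = 16 ^ n * fact n ^ 4 / (fact (2 * n) ^ 2 * (2 * real n + 1))"
proof (induction n)
  case (Suc n)
  define N where "N = real n"
  have pos: "N \<ge> 0" by (simp add: N_def)
  have f2: "fact (2 * Suc n) = 2 * (N + 1) * (2 * N + 1) * (fact (2 * n) :: real)" by (simp add: N_def algebra_simps)
  have f1: "fact (Suc n) = (N + 1) * (fact n :: real)" by (simp add: N_def algebra_simps)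
  have e: "4 * real (Suc n)^2 - 1 = (2 * N + 1) * (2 * N + 3)" by (simp add: N_def power2_eq_square algebra_simps)
  have ne: "2 * N + 1 \<noteq> 0" "2 * N + 3 \<noteq> 0" "N + 1 \<noteq> 0" "fact (2 * n) \<noteq> (0::real)" using pos by auto
  have "(\<Prod>k=1..Suc n. (4 * real k^2) / (4 * real k^2 - 1)) =
     16 ^ n * fact n ^ 4 / (fact (2 * n) ^ 2 * (2 * N + 1)) * (4 * (N + 1)^2 / ((2 * N + 1) * (2 * N + 3)))"
    using Suc e by (simp add: N_def add_ac)
  also have "\<dots> = 16 ^ Suc n * fact (Suc n) ^ 4 / (fact (2 * Suc n) ^ 2 * (2 * real (Suc n) + 1))"
  proof -
    have "2 * real (Suc n) + 1 = 2 * N + 3" by (simp add: N_def)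
    thus ?thesis unfolding f1 f2 using ne by (simp add: divide_simps power2_eq_square) (simp add: power4_eq_xxxx algebra_simps)
  qed
  finally show ?case .
qed auto

text \<open>In \<open>2 * stirling_defect n - stirling_defect (2 * n)\<close> the terms n and n ln n
  cancel, which leaves half the logarithm of a Wallis product plus convergent terms. Its limit is 2L
  - L = L.\<close>

lemma stirling_defect_limit:
  assumes "stirling_defect \<longlonglongrightarrow> L"
  shows "L = ln (2 * pi) / 2"
proof -
  let ?w = "\<lambda>n. \<Prod>k=1..n. (4 * real k^2) / (4 * real k^2 - 1)"
  have sub: "filterlim (\<lambda>n::nat. 2 * n) sequentially sequentially"
    by (rule filterlim_subseq) (auto simp: strict_mono_def)
  have "(\<lambda>n. 2 * stirling_defect n - stirling_defect (2 * n)) \<longlonglongrightarrow> 2 * L - L"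
    by (intro tendsto_intros assms filterlim_compose[OF assms sub])
  moreover have lim: "(\<lambda>n. ln (?w n) / 2 + ln 2 / 2 + ln (2 + 1 / real n) / 2) \<longlonglongrightarrow> ln (pi / 2) / 2 + ln 2 / 2 + ln (2 + 0) / 2"
    by (intro tendsto_intros wallis lim_1_over_n) auto
  have ev: "eventually (\<lambda>n. ln (?w n) / 2 + ln 2 / 2 + ln (2 + 1 / real n) / 2 = 2 * stirling_defect n - stirling_defect (2 * n)) sequentially"
    using eventually_gt_at_top[of 0]
  proof eventually_elim
    case (elim n)
    have e: "2 + 1 / real n = (2 * real n + 1) / real n" using elim by (simp add: field_simps)
    have "ln (16::real) = ln (2 ^ 4)" by simp
    also have "\<dots> = 4 * ln 2" by (subst ln_realpow) auto
    finally have 16: "ln (16::real) = 4 * ln 2" .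
    have "ln (?w n) = n * ln 16 + 4 * ln (fact n) - (2 * ln (fact (2 * n)) + ln (2 * real n + 1))"
      unfolding wallis_prod by (simp add: ln_div ln_mult ln_realpow)
    moreover have "ln (2 + 1 / real n) = ln (2 * real n + 1) - ln (real n)"
      unfolding e using elim by (subst ln_div) auto
    ultimately show ?case using elim by (simp add: stirling_defect_def ln_mult 16 field_simps)
  qed
  ultimately have "2 * L - L = ln (pi / 2) / 2 + ln 2 / 2 + ln (2 + 0) / 2"
    using Lim_transform_eventually[OF lim ev] by (intro LIMSEQ_unique)
  thus ?thesis by (simp add: ln_div ln_mult field_simps)
qed

lemma deriv_trapezoid_defect_0:
  "deriv (trapezoid_defect n) 0 = of_real (stirling_defect (Suc (Suc n)) - stirling_defect (Suc n))"
proof (rule DERIV_imp_deriv)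
  define N where "N = real (Suc n)"
  have N: "N > 0" by (simp add: N_def)
  define a where "a = ln N"
  define c where "c = ln (N + 1)"
  have pw: "of_nat (Suc n) powr s = exp (s * of_real a)" "of_nat (Suc (Suc n)) powr s = exp (s * of_real c)" for s :: complex
  proof -
    have "complex_of_nat (Suc n) = of_real N" "complex_of_nat (Suc (Suc n)) = of_real (N + 1)" by (simp_all add: N_def)
    thus "of_nat (Suc n) powr s = exp (s * of_real a)" "of_nat (Suc (Suc n)) powr s = exp (s * of_real c)"
      using N by (simp_all add: powr_def a_def c_def Ln_of_real del: of_nat_Suc of_real_add)
  qed
  have ex: "exp (complex_of_real a) = of_real N" "exp (complex_of_real c) = of_real (N + 1)"
    using N by (simp_all add: a_def c_def exp_of_real)
  have "(trapezoid_defect n has_field_derivative - of_real c * exp (of_real c) + of_real a * exp (of_real a) + 1 + (of_real a + of_real c) / 2) (at 0)"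
    unfolding trapezoid_defect_def [abs_def] pw by (auto intro!: derivative_eq_intros simp: field_simps)
  also have "- of_real c * exp (of_real c) + of_real a * exp (of_real a) + 1 + (of_real a + of_real c) / 2
     = complex_of_real (- c * (N + 1) + a * N + 1 + (a + c) / 2)" by (simp add: ex)
  also have "- c * (N + 1) + a * N + 1 + (a + c) / 2 = stirling_defect (Suc (Suc n)) - stirling_defect (Suc n)"
  proof -
    have "ln (fact (Suc (Suc n)) :: real) = ln ((N + 1) * fact (Suc n))"
      by (simp only: fact_Suc[of "Suc n"]) (simp add: N_def add_ac)
    also have "\<dots> = c + ln (fact (Suc n))" using N by (simp add: ln_mult c_def)
    finally have f: "ln (fact (Suc (Suc n)) :: real) = c + ln (fact (Suc n))" .
    have r: "real (Suc (Suc n)) = N + 1" "real (Suc n) = N" by (simp_all add: N_def)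
    show ?thesis unfolding stirling_defect_def f r by (simp add: a_def c_def algebra_simps)
  qed
  finally show "(trapezoid_defect n has_field_derivative of_real (stirling_defect (Suc (Suc n)) - stirling_defect (Suc n))) (at 0)" .
qed

text \<open>Convergence of the differentiated series provides the limit of
  \<open>stirling_defect\<close>. The telescoping sum starts at
  \<open>stirling_defect 1 = 1\<close>, so the series contributes L - 1, and (s - 1)/2 contributes
  1/2.\<close>

lemma deriv_zeta_reg_0: "deriv zeta_reg 0 = of_real (ln (2 * pi) / 2 - 1 / 2)"
proof -
  let ?D = "deriv (\<lambda>s. \<Sum>n. trapezoid_defect n s) 0"
  have "(\<lambda>M. \<Sum>n<M. deriv (trapezoid_defect n) 0) \<longlonglongrightarrow> ?D" using trapezoid_defect_series(3)[of 0] by (simp add: sums_def)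
  moreover have "(\<Sum>n<M. deriv (trapezoid_defect n) 0) = of_real (stirling_defect (Suc M) - 1)" for M
  proof -
    have "(\<Sum>n<M. stirling_defect (Suc (Suc n)) - stirling_defect (Suc n)) = stirling_defect (Suc M) - stirling_defect (Suc 0)" by (rule sum_lessThan_telescope)
    thus ?thesis unfolding deriv_trapezoid_defect_0 of_real_sum [symmetric] by (simp add: stirling_defect_def)
  qed
  ultimately have lim: "(\<lambda>M. complex_of_real (stirling_defect (Suc M) - 1)) \<longlonglongrightarrow> ?D" by simp
  from tendsto_Re[OF this] have "(\<lambda>M. stirling_defect (Suc M) - 1 + 1) \<longlonglongrightarrow> Re ?D + 1" by (intro tendsto_add tendsto_const) simp
  hence "stirling_defect \<longlonglongrightarrow> Re ?D + 1" by (simp add: filterlim_sequentially_Suc)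
  from stirling_defect_limit[OF this] have Re: "Re ?D + 1 = ln (2 * pi) / 2" .
  from tendsto_Im[OF lim] have Im: "Im ?D = 0" by (simp add: LIMSEQ_const_iff)
  have D: "?D = of_real (ln (2 * pi) / 2 - 1)" using Re Im by (simp add: complex_eq_iff)
  have "((\<lambda>s. 1 + (s - 1) / 2 + (\<Sum>n. trapezoid_defect n s)) has_field_derivative 1 / 2 + ?D) (at 0)"
    using holomorphic_derivI[OF trapezoid_defect_series(1) open_halfspace_Re_gt, of 0]
    by (auto intro!: derivative_eq_intros)
  also have "?this \<longleftrightarrow> (zeta_reg has_field_derivative 1 / 2 + ?D) (at 0)"
  proof (rule DERIV_cong_ev)
    have "eventually (\<lambda>s. s \<in> {s. Re s > -1}) (nhds 0)" by (intro eventually_nhds_in_open open_halfspace_Re_gt) auto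
    thus "eventually (\<lambda>s. 1 + (s - 1) / 2 + (\<Sum>n. trapezoid_defect n s) = zeta_reg s) (nhds 0)"
      by eventually_elim (auto simp: zeta_reg_eq_trapezoid)
  qed auto
  finally have "deriv zeta_reg 0 = 1 / 2 + ?D" by (rule DERIV_imp_deriv)
  thus ?thesis by (simp add: D complex_eq_iff)
qed

section \<open>The logarithmic derivative in the half plane of convergence\<close>

definition prime_exps :: "(nat \<times> nat) set" where "prime_exps = {(p, k). prime p \<and> k \<ge> 1}"

lemma prime_exps_pos: "(p, k) \<in> prime_exps \<Longrightarrow> p ^ k > 0" "(p, k) \<in> prime_exps \<Longrightarrow> p ^ k \<ge> 2" "(p, k) \<in> prime_exps \<Longrightarrow> ln (real p) \<ge> 0"
proof -
  assume "(p, k) \<in> prime_exps"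
  hence p: "p \<ge> 2" "k \<ge> 1" by (auto simp: prime_exps_def prime_ge_2_nat)
  have "p \<le> p ^ k" using p by (intro self_le_power) auto
  thus "p ^ k \<ge> 2" "p ^ k > 0" "ln (real p) \<ge> 0" using p by auto
qed

text \<open>The convolution identity log = \<Lambda> * 1, with the von Mangoldt function spread over
  pairs: p occurs once for each exponent up to its multiplicity in m.\<close>

lemma ln_eq_sum_prime_powers:
  assumes "m > 0"
  shows "finite {(p, k) \<in> prime_exps. p ^ k dvd m}" "(\<Sum>(p, k)\<in>{(p, k) \<in> prime_exps. p ^ k dvd m}. ln (real p)) = ln (real m)"
proof -
  have eq: "{(p, k) \<in> prime_exps. p ^ k dvd m} = Sigma (prime_factors m) (\<lambda>p. {1..multiplicity p m})"
  proof (intro set_eqI, clarify)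
    fix p k
    show "(p, k) \<in> {(p, k) \<in> prime_exps. p ^ k dvd m} \<longleftrightarrow> (p, k) \<in> Sigma (prime_factors m) (\<lambda>p. {1..multiplicity p m})"
    proof (cases "prime p")
      case True
      have "p ^ k dvd m \<longleftrightarrow> k \<le> multiplicity p m"
        using True assms by (intro power_dvd_iff_le_multiplicity) auto
      moreover have "k \<ge> 1 \<Longrightarrow> k \<le> multiplicity p m \<Longrightarrow> p \<in> prime_factors m"
        using True assms by (subst prime_factors_multiplicity) auto
      ultimately show ?thesis using True by (auto simp: prime_exps_def)
    qed (auto simp: prime_exps_def)
  qed
  show "finite {(p, k) \<in> prime_exps. p ^ k dvd m}" unfolding eq by auto
  have "(\<Sum>(p, k)\<in>{(p, k) \<in> prime_exps. p ^ k dvd m}. ln (real p)) = (\<Sum>p\<in>prime_factors m. \<Sum>k\<in>{1..multiplicity p m}. ln (real p))"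
    unfolding eq by (subst sum.Sigma) auto
  also have "\<dots> = (\<Sum>p\<in>prime_factors m. ln (real p ^ multiplicity p m))"
    by (intro sum.cong refl) (auto simp: ln_realpow prime_gt_0_nat in_prime_factors_iff)
  also have "\<dots> = ln (\<Prod>p\<in>prime_factors m. real p ^ multiplicity p m)"
    by (subst ln_prod) (auto simp: prime_gt_0_nat in_prime_factors_iff)
  also have "(\<Prod>p\<in>prime_factors m. real p ^ multiplicity p m) = real (\<Prod>p\<in>prime_factors m. p ^ multiplicity p m)" by simp
  also have "(\<Prod>p\<in>prime_factors m. p ^ multiplicity p m) = m" using assms by (intro prime_factorization_nat [symmetric])
  finally show "(\<Sum>(p, k)\<in>{(p, k) \<in> prime_exps. p ^ k dvd m}. ln (real p)) = ln (real m)" .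
qed

lemma powr_nat_mult:
  fixes a b :: nat and s :: complex
  assumes "a > 0" "b > 0"
  shows "of_nat (a * b) powr s = of_nat a powr s * of_nat b powr s"
  using powr_times_real[of "of_nat a" "of_nat b" s] by simp

lemma norm_nat_powr: "n > 0 \<Longrightarrow> norm (of_nat n powr s :: complex) = real n powr Re s"
  by (simp add: norm_powr_real_powr)

lemma has_sum_Suc_iff: "(f has_sum S) {0<..} \<longleftrightarrow> ((\<lambda>n. f (Suc n)) has_sum S) (UNIV :: nat set)"
proof -
  have "bij_betw Suc UNIV {0<..}" by (rule bij_betwI[of _ _ _ "\<lambda>n. n - 1"]) auto
  from has_sum_reindex_bij_betw[OF this, of f S] show ?thesis by simp
qed

lemma zeta_series_has_sum: "Re s > 1 \<Longrightarrow> ((\<lambda>n. of_nat n powr (-s)) has_sum zeta_series s) {0<..}"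
  unfolding has_sum_Suc_iff
proof (rule norm_summable_imp_has_sum)
  assume s: "Re s > 1"
  show "summable (\<lambda>n. norm (of_nat (Suc n) powr (-s) :: complex))"
    using summable_Suc_powr[OF s] by (simp add: norm_nat_powr del: of_nat_Suc)
  show "(\<lambda>n. of_nat (Suc n) powr - s) sums zeta_series s"
    using zeta_series(2)[OF s] by (simp add: powr_minus divide_inverse)
qed

lemma summable_ln_powr:
  assumes "a > 1"
  shows "summable (\<lambda>n. ln (real (Suc n)) * real (Suc n) powr (-a))"
proof -
  define d where "d = (a - 1) / 2"
  have d: "d > 0" using assms by (simp add: d_def)
  have "summable (\<lambda>n. 1 / d * real (Suc n) powr (-(1 + d)))" using d by (intro summable_mult summable_Suc_powr) auto
  moreover have "norm (ln (real (Suc n)) * real (Suc n) powr (-a)) \<le> 1 / d * real (Suc n) powr (-(1 + d))" for n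
  proof -
    have "d * ln (real (Suc n)) = ln (real (Suc n) powr d)" by (simp add: ln_powr)
    also have "\<dots> \<le> real (Suc n) powr d" using ln_le_minus_one[of "real (Suc n) powr d"] by fastforce
    finally have "ln (real (Suc n)) \<le> 1 / d * real (Suc n) powr d" using d by (simp add: field_simps)
    hence "ln (real (Suc n)) * real (Suc n) powr (-a) \<le> 1 / d * real (Suc n) powr d * real (Suc n) powr (-a)"
      by (intro mult_right_mono) auto
    also have "\<dots> = 1 / d * (real (Suc n) powr d * real (Suc n) powr (-a))" by simp
    also have "real (Suc n) powr d * real (Suc n) powr (-a) = real (Suc n) powr (d + (-a))" by (rule powr_add [symmetric])
    also have "d + (-a) = -(1 + d)" by (simp add: d_def field_simps)
    finally show ?thesis by (simp add: abs_mult del: of_nat_Suc)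
  qed
  ultimately show ?thesis by (rule summable_comparison_test'[where N = 0])
qed

lemma deriv_zeta_series_has_sum:
  assumes s: "Re s > 1"
  shows "((\<lambda>n. of_real (ln (real n)) * of_nat n powr (-s)) has_sum - deriv zeta_series s) {0<..}"
  unfolding has_sum_Suc_iff
proof (rule norm_summable_imp_has_sum)
  show "summable (\<lambda>n. norm (of_real (ln (real (Suc n))) * of_nat (Suc n) powr (-s) :: complex))"
    using summable_ln_powr[OF s] by (simp add: norm_nat_powr norm_mult del: of_nat_Suc)
  show "(\<lambda>n. of_real (ln (real (Suc n))) * of_nat (Suc n) powr - s) sums - deriv zeta_series s"
    using sums_minus[OF zeta_series(3)[OF s]] by (simp add: powr_minus divide_inverse)
qed

text \<open>The double sum over m and the pairs with p^k dividing m is rearranged through m = p^k j.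
  The factor zeta stays inside the summand because summability over the pairs alone is only derived
  from this lemma, by dividing by zeta where it is known not to vanish.\<close>

lemma prime_exps_has_sum_mult:
  assumes s: "Re s > 1"
  shows "((\<lambda>(p, k). of_real (ln (real p)) * of_nat (p ^ k) powr (-s) * zeta_series s) has_sum - deriv zeta_series s) prime_exps"
proof -
  let ?N = "{0<..} :: nat set"
  define D where "D = (\<lambda>m. {(p, k) \<in> prime_exps. p ^ k dvd m})"
  define g :: "nat \<times> nat \<times> nat \<Rightarrow> complex" where "g = (\<lambda>(m, p, k). of_real (ln (real p)) * of_nat m powr (-s))"
  have finD: "finite (D m)" and sumD: "(\<Sum>(p, k)\<in>D m. ln (real p)) = ln (real m)" if "m > 0" for m
    using ln_eq_sum_prime_powers[OF that] unfolding D_def by auto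
  have sg: "((\<lambda>y. g (m, y)) has_sum of_real (ln (real m)) * of_nat m powr (-s)) (D m)" if "m \<in> ?N" for m
  proof -
    have "((\<lambda>y. g (m, y)) has_sum (\<Sum>y\<in>D m. g (m, y))) (D m)" using finD that by (intro has_sum_finite) auto
    also have "(\<Sum>y\<in>D m. g (m, y)) = of_real (\<Sum>(p, k)\<in>D m. ln (real p)) * of_nat m powr (-s)"
      by (simp add: g_def split_def sum_distrib_right)
    also have "(\<Sum>(p, k)\<in>D m. ln (real p)) = ln (real m)" using sumD that by simp
    finally show ?thesis .
  qed
  have sn: "((\<lambda>y. norm (g (m, y))) has_sum ln (real m) * real m powr (- Re s)) (D m)" if "m \<in> ?N" for m
  proof -
    have "((\<lambda>y. norm (g (m, y))) has_sum (\<Sum>y\<in>D m. norm (g (m, y)))) (D m)" using finD that by (intro has_sum_finite) auto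
    also have "(\<Sum>y\<in>D m. norm (g (m, y))) = (\<Sum>(p, k)\<in>D m. ln (real p) * real m powr (- Re s))"
      by (intro sum.cong refl) (use that in \<open>auto simp: g_def norm_mult norm_nat_powr D_def prime_exps_pos\<close>)
    also have "\<dots> = (\<Sum>(p, k)\<in>D m. ln (real p)) * real m powr (- Re s)" by (simp add: split_def sum_distrib_right)
    finally show ?thesis using sumD that by simp
  qed
  have abs: "(\<lambda>x. norm (g x)) summable_on Sigma ?N D"
    unfolding Infinite_Sum.abs_summable_on_Sigma_iff
  proof (intro conjI ballI)
    show "(\<lambda>y. norm (g (m, y))) summable_on D m" if "m \<in> ?N" for m using sn[OF that] by (auto simp: summable_on_def)
    have "((\<lambda>m. ln (real m) * real m powr (- Re s)) has_sum (\<Sum>n. ln (real (Suc n)) * real (Suc n) powr (- Re s))) ?N"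
      unfolding has_sum_Suc_iff
      by (rule sums_nonneg_imp_has_sum[OF summable_sums[OF summable_ln_powr[OF s]]]) auto
    hence "(\<lambda>m. ln (real m) * real m powr (- Re s)) summable_on ?N" by (auto simp: summable_on_def)
    moreover have "norm (infsum (\<lambda>y. norm (g (m, y))) (D m)) = ln (real m) * real m powr (- Re s)" if "m \<in> ?N" for m
      using infsumI[OF sn[OF that]] that by simp
    ultimately show "(\<lambda>m. norm (infsum (\<lambda>y. norm (g (m, y))) (D m))) summable_on ?N"
      by (subst summable_on_cong) auto
  qed
  have "(g has_sum - deriv zeta_series s) (Sigma ?N D)"
    using sg deriv_zeta_series_has_sum[OF s] abs_summable_summable[OF abs] by (rule has_sum_SigmaI)
  also have "(g has_sum - deriv zeta_series s) (Sigma ?N D) \<longleftrightarrow>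
    ((\<lambda>((p, k), j). g (p ^ k * j, p, k)) has_sum - deriv zeta_series s) (prime_exps \<times> ?N)"
    by (rule has_sum_reindex_bij_witness[of _ "\<lambda>((p, k), j). (p ^ k * j, p, k)" "\<lambda>(m, p, k). ((p, k), m div p ^ k)"])
       (auto simp: D_def prime_exps_pos dest: prime_exps_pos(1) dvd_imp_le elim!: dvdE intro!: div_greater_zero_iff[THEN iffD2])
  finally have sum1: "((\<lambda>((p, k), j). g (p ^ k * j, p, k)) has_sum - deriv zeta_series s) (prime_exps \<times> ?N)" .
  have inner: "((\<lambda>j. g (p ^ k * j, p, k)) has_sum of_real (ln (real p)) * of_nat (p ^ k) powr (-s) * zeta_series s) ?N"
    if pk: "(p, k) \<in> prime_exps" for p k
  proof -
    have "((\<lambda>j. of_real (ln (real p)) * of_nat (p ^ k) powr (-s) * of_nat j powr (-s)) has_sum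
           of_real (ln (real p)) * of_nat (p ^ k) powr (-s) * zeta_series s) ?N"
      by (intro has_sum_cmult_right zeta_series_has_sum s)
    also have "?this \<longleftrightarrow> ?thesis"
      using prime_exps_pos(1)[OF pk] by (intro has_sum_cong) (auto simp: g_def powr_nat_mult simp del: of_nat_mult of_nat_power)
    finally show ?thesis .
  qed
  show ?thesis
    by (rule has_sum_SigmaD[OF sum1]) (use inner in auto)
qed

lemma zeta_series_of_real_nonzero:
  assumes "\<sigma> > 1"
  shows "Re (zeta_series (of_real \<sigma>)) \<ge> 1"
proof -
  have "((\<lambda>n. of_nat n powr (- complex_of_real \<sigma>)) has_sum zeta_series (of_real \<sigma>)) {0<..}"
    using assms by (intro zeta_series_has_sum) auto
  from has_sum_Re[OF this] have "((\<lambda>n. real n powr (-\<sigma>)) has_sum Re (zeta_series (of_real \<sigma>))) {0<..}"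
  proof (rule has_sum_cong[THEN iffD1, rotated])
    fix n :: nat assume "n \<in> {0<..}"
    have "of_nat n powr (- complex_of_real \<sigma>) = complex_of_real (real n powr (-\<sigma>))"
      using powr_of_real[of "real n" "-\<sigma>"] by simp
    thus "Re (of_nat n powr (- complex_of_real \<sigma>)) = real n powr (-\<sigma>)" by simp
  qed
  from finite_sum_le_has_sum[OF this, of "{1}"] show ?thesis by auto
qed

text \<open>For real \<sigma> the term n = 1 keeps zeta away from 0, so
  \<open>prime_exps_has_sum_mult\<close> can be divided by it. The terms are nonnegative and
  dominate those at all s with Re s \<ge> \<sigma>.\<close>

lemma prime_exps_summable:
  assumes "\<sigma> > 1"
  shows "(\<lambda>(p, k). ln (real p) * real (p ^ k) powr (-\<sigma>)) summable_on prime_exps"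
proof -
  define w where "w = zeta_series (of_real \<sigma>)"
  have w: "w \<noteq> 0" using zeta_series_of_real_nonzero[OF assms] by (auto simp: w_def)
  have "(\<lambda>(p, k). of_real (ln (real p)) * of_nat (p ^ k) powr (- of_real \<sigma>) * w) summable_on prime_exps"
    using prime_exps_has_sum_mult[of "of_real \<sigma>"] assms unfolding w_def by (auto simp: summable_on_def)
  hence "(\<lambda>x. (case x of (p, k) \<Rightarrow> of_real (ln (real p)) * of_nat (p ^ k) powr (- of_real \<sigma>) * w) * inverse w) summable_on prime_exps"
    by (rule summable_on_cmult_left)
  hence "(\<lambda>x. complex_of_real (case x of (p, k) \<Rightarrow> ln (real p) * real (p ^ k) powr (-\<sigma>))) summable_on prime_exps"
  proof (rule summable_on_cong[THEN iffD1, rotated])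
    fix x assume "x \<in> prime_exps"
    obtain p k where x: "x = (p, k)" by (cases x)
    have "of_nat (p ^ k) powr (- complex_of_real \<sigma>) = complex_of_real (real (p ^ k) powr (-\<sigma>))"
      using powr_of_real[of "real (p ^ k)" "-\<sigma>"] by simp
    thus "(case x of (p, k) \<Rightarrow> of_real (ln (real p)) * of_nat (p ^ k) powr (- complex_of_real \<sigma>) * w) * inverse w
      = complex_of_real (case x of (p, k) \<Rightarrow> ln (real p) * real (p ^ k) powr (-\<sigma>))"
      using w by (simp add: x)
  qed
  from summable_on_Re[OF this] show ?thesis by simp
qed

definition mangoldt_series :: "complex \<Rightarrow> complex" where
  "mangoldt_series s = (\<Sum>\<^sub>\<infinity>(p, k)\<in>prime_exps. of_real (ln (real p)) * of_nat (p ^ k) powr (-s))"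

lemma mangoldt_series_norm_le: "x \<in> prime_exps \<Longrightarrow> \<sigma> \<le> Re s \<Longrightarrow>
    norm (case x of (p, k) \<Rightarrow> complex_of_real (ln (real p)) * of_nat (p ^ k) powr (-s)) \<le>
    (case x of (p, k) \<Rightarrow> ln (real p) * real (p ^ k) powr (-\<sigma>))"
proof -
  assume x: "x \<in> prime_exps" and s: "\<sigma> \<le> Re s"
  obtain p k where pk: "x = (p, k)" by (cases x)
  note P = prime_exps_pos[OF x[unfolded pk]]
  have "real (p ^ k) powr (- Re s) \<le> real (p ^ k) powr (-\<sigma>)" using P s by (intro powr_mono) auto
  thus ?thesis using P norm_nat_powr[of "p ^ k" "-s"] by (simp add: pk norm_mult mult_left_mono del: of_nat_power)
qed

lemma mangoldt_series:
  assumes s: "Re s > 1"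
  shows "((\<lambda>(p, k). of_real (ln (real p)) * of_nat (p ^ k) powr (-s)) has_sum mangoldt_series s) prime_exps"
    and "mangoldt_series s * zeta_series s = - deriv zeta_series s"
proof -
  have "(\<lambda>x. norm (case x of (p, k) \<Rightarrow> complex_of_real (ln (real p)) * of_nat (p ^ k) powr (-s))) summable_on prime_exps"
    by (rule summable_on_comparison_test[OF prime_exps_summable[OF s]]) (auto dest: mangoldt_series_norm_le[of _ "Re s" s])
  from abs_summable_summable[OF this]
  show sum: "((\<lambda>(p, k). of_real (ln (real p)) * of_nat (p ^ k) powr (-s)) has_sum mangoldt_series s) prime_exps"
    unfolding mangoldt_series_def by (rule has_sum_infsum)
  from has_sum_cmult_left[OF this, of "zeta_series s"]
  have "((\<lambda>(p, k). of_real (ln (real p)) * of_nat (p ^ k) powr (-s) * zeta_series s) has_sum mangoldt_series s * zeta_series s) prime_exps"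
    by (simp add: split_def)
  thus "mangoldt_series s * zeta_series s = - deriv zeta_series s" using prime_exps_has_sum_mult[OF s] by (rule has_sum_unique)
qed

lemma mangoldt_series_bounded:
  assumes "\<sigma> > 1" "\<sigma> \<le> Re s"
  shows "norm (mangoldt_series s) \<le> (\<Sum>\<^sub>\<infinity>(p, k)\<in>prime_exps. ln (real p) * real (p ^ k) powr (-\<sigma>))"
  unfolding mangoldt_series_def by (rule norm_infsum_le[OF mangoldt_series(1)[unfolded mangoldt_series_def] has_sum_infsum[OF prime_exps_summable] mangoldt_series_norm_le])
    (use assms in auto)

text \<open>A zero would make \<open>\<zeta>' / \<zeta>\<close> unbounded, whereas the Mangoldt series is bounded near it.\<close>

lemma zeta_series_nonzero:
  assumes s0: "Re s0 > 1"
  shows "zeta_series s0 \<noteq> 0"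
proof
  assume z0: "zeta_series s0 = 0"
  let ?S = "{s. Re s > 1}"
  have S: "open ?S" "connected ?S" "s0 \<in> ?S"
    using s0 by (auto intro: convex_connected convex_halfspace_Re_gt open_halfspace_Re_gt)
  have "zeta_series (of_real 2) \<noteq> 0" using zeta_series_of_real_nonzero[of 2] by auto
  hence nc: "\<exists>w\<in>?S. zeta_series w \<noteq> 0" by (intro bexI[of _ "of_real 2"]) auto
  define n where "n = nat (zorder zeta_series s0)"
  define g where "g = zor_poly zeta_series s0"
  have "zorder zeta_series s0 > 0 \<and> (\<exists>r>0. cball s0 r \<subseteq> ?S \<and> g holomorphic_on cball s0 r \<and>
      (\<forall>w\<in>cball s0 r. zeta_series w = g w * (w - s0) ^ n \<and> g w \<noteq> 0))"
    using zorder_exist_zero[OF zeta_series(1) S nc] z0 unfolding n_def g_def by simp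
  then obtain r where r: "r > 0" "cball s0 r \<subseteq> ?S" "g holomorphic_on cball s0 r" "n > 0"
      "\<And>w. w \<in> cball s0 r \<Longrightarrow> zeta_series w = g w * (w - s0) ^ n" "\<And>w. w \<in> cball s0 r \<Longrightarrow> g w \<noteq> 0"
    unfolding n_def by force
  have gh: "g holomorphic_on ball s0 r" using r(3) by (rule holomorphic_on_subset) auto
  \<comment> \<open>Strictly between 1 and Re s0, so that the bound K holds in a whole neighbourhood
    of s0.\<close>
  define \<sigma> where "\<sigma> = (1 + Re s0) / 2"
  have \<sigma>: "\<sigma> > 1" "\<sigma> < Re s0" using s0 by (auto simp: \<sigma>_def)
  define K where "K = (\<Sum>\<^sub>\<infinity>(p, k)\<in>prime_exps. ln (real p) * real (p ^ k) powr (-\<sigma>))"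
  \<comment> \<open>zeta = g (w - s0)^n is inserted into \<open>mangoldt_series(2)\<close> and
    \<open>(w - s0) ^ k\<close> cancelled, with n = k + 1. As w tends to s0 the right-hand side
    tends to 0, but the left-hand side to n g(s0).\<close>
  have eq: "of_nat n * g w = - ((w - s0) * (deriv g w + mangoldt_series w * g w))" if w: "w \<in> ball s0 r" "w \<noteq> s0" for w
  proof -
    obtain k where k: "n = Suc k" using r(4) by (cases n) auto
    have w': "w \<in> cball s0 r" "Re w > 1" using w subsetD[OF r(2), of w] by auto
    have "((\<lambda>w. (w - s0) ^ n) has_field_derivative of_nat n * (w - s0) ^ k) (at w)"
      using DERIV_power[OF DERIV_diff[OF DERIV_ident DERIV_const[of s0]], where n = n] by (simp add: k)
    from DERIV_mult[OF holomorphic_derivI[OF gh open_ball w(1)] this]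
    have "((\<lambda>w. g w * (w - s0) ^ n) has_field_derivative deriv g w * (w - s0) ^ n + g w * (of_nat n * (w - s0) ^ k)) (at w)"
      by (simp add: mult_ac)
    also have "?this \<longleftrightarrow> (zeta_series has_field_derivative deriv g w * (w - s0) ^ n + g w * (of_nat n * (w - s0) ^ k)) (at w)"
    proof (rule DERIV_cong_ev)
      have "eventually (\<lambda>w. w \<in> ball s0 r) (nhds w)" using w by (intro eventually_nhds_in_open) auto
      thus "eventually (\<lambda>w. g w * (w - s0) ^ n = zeta_series w) (nhds w)" by eventually_elim (simp add: r)
    qed auto
    finally have "deriv zeta_series w = deriv g w * (w - s0) ^ n + g w * (of_nat n * (w - s0) ^ k)" by (rule DERIV_imp_deriv)
    hence "mangoldt_series w * (g w * ((w - s0) * (w - s0) ^ k)) = - (deriv g w * ((w - s0) * (w - s0) ^ k) + g w * (of_nat n * (w - s0) ^ k))"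
      using mangoldt_series(2)[OF w'(2)] unfolding r(5)[OF w'(1)] k power_Suc by simp
    hence "g w * (of_nat n * (w - s0) ^ k) = - (mangoldt_series w * (g w * ((w - s0) * (w - s0) ^ k))) - deriv g w * ((w - s0) * (w - s0) ^ k)"
      by simp
    hence "(w - s0) ^ k * (of_nat n * g w) = (w - s0) ^ k * (- ((w - s0) * (deriv g w + mangoldt_series w * g w)))"
      by (simp add: algebra_simps)
    moreover have "(w - s0) ^ k \<noteq> 0" using w by simp
    ultimately show ?thesis by (simp only: mult_left_cancel not_False_eq_True)
  qed
  have lim: "(g \<longlongrightarrow> g s0) (at s0)" "(deriv g \<longlongrightarrow> deriv g s0) (at s0)"
    using r(1) holomorphic_on_imp_continuous_on[OF gh] holomorphic_on_imp_continuous_on[OF holomorphic_deriv[OF gh open_ball]]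
    by (auto simp: continuous_on_eq_continuous_at isCont_def)
  have "norm (of_nat n * g s0) \<le> norm (s0 - s0) * (norm (deriv g s0) + K * norm (g s0))"
  proof (rule tendsto_le)
    show "((\<lambda>w. norm (of_nat n * g w)) \<longlongrightarrow> norm (of_nat n * g s0)) (at s0)" by (intro tendsto_intros lim)
    show "((\<lambda>w. norm (w - s0) * (norm (deriv g w) + K * norm (g w))) \<longlongrightarrow>
      norm (s0 - s0) * (norm (deriv g s0) + K * norm (g s0))) (at s0)" by (intro tendsto_intros lim)
    have "eventually (\<lambda>w. w \<in> ball s0 r - {s0}) (at s0)" using r(1) by (intro eventually_at_in_open) auto
    moreover have "eventually (\<lambda>w. w \<in> {w. Re w > \<sigma>}) (at s0)"
      using \<sigma> by (intro eventually_at_in_open' open_halfspace_Re_gt) auto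
    ultimately show "eventually (\<lambda>w. norm (of_nat n * g w) \<le> norm (w - s0) * (norm (deriv g w) + K * norm (g w))) (at s0)"
    proof eventually_elim
      case (elim w)
      have "norm (mangoldt_series w) \<le> K" unfolding K_def using elim \<sigma> by (intro mangoldt_series_bounded) auto
      hence "norm (deriv g w + mangoldt_series w * g w) \<le> norm (deriv g w) + K * norm (g w)"
        using norm_triangle_ineq[of "deriv g w" "mangoldt_series w * g w"] mult_right_mono[of "norm (mangoldt_series w)" K "norm (g w)"]
        by (simp add: norm_mult)
      thus ?case using eq[of w] elim by (simp add: norm_mult mult_left_mono del: of_nat_mult)
    qed
  qed auto
  moreover have "norm (of_nat n * g s0) > 0" using r(1,4) r(6)[of s0] by simp
  ultimately show False by simp
qed

section \<open>Divisor and Hadamard factorization\<close>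

definition zeta_mero :: "complex \<Rightarrow> complex" where "zeta_mero s = (if s = 1 then 0 else zeta_reg s / (s - 1))"

lemma zeta_mero_ev: "s \<noteq> 1 \<Longrightarrow> eventually (\<lambda>w. zeta_mero w = zeta_reg w / (w - 1)) (nhds s)"
  using eventually_nhds_in_open[of "-{1}" s] by (auto elim!: eventually_mono simp: zeta_mero_def)

lemma zeta_mero_pole: "is_pole zeta_mero 1"
proof -
  have "is_pole (\<lambda>w. zeta_reg w / (w - 1) ^ 1) 1"
    by (rule is_pole_basic[OF zeta_reg_holomorphic open_UNIV]) (auto simp: zeta_reg_1)
  also have "?this \<longleftrightarrow> is_pole zeta_mero 1"
    by (rule is_pole_cong) (auto simp: eventually_at_filter zeta_mero_def)
  finally show ?thesis .
qed

lemma zeta_mero_analytic: "zeta_mero analytic_on UNIV - {1}"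
proof -
  have "(\<lambda>w. zeta_reg w / (w - 1)) holomorphic_on UNIV - {1}"
    by (intro holomorphic_intros holomorphic_on_subset[OF zeta_reg_holomorphic]) auto
  hence "zeta_mero holomorphic_on UNIV - {1}" by (rule holomorphic_transform) (auto simp: zeta_mero_def)
  thus ?thesis by (simp add: analytic_on_open open_delete)
qed

lemma zeta_mero_nicely_meromorphic: "zeta_mero nicely_meromorphic_on UNIV"
proof (rule nicely_meromorphic_onI_open[of _ _ "{1}"])
  show "isolated_singularity_at zeta_mero s" for s
  proof (cases "s = 1")
    case True
    have "zeta_mero holomorphic_on UNIV - {1}" by (rule analytic_imp_holomorphic[OF zeta_mero_analytic])
    thus ?thesis unfolding True by (rule isolated_singularity_at_holomorphic) auto
  next
    case False
    hence "zeta_mero analytic_on {s}" using zeta_mero_analytic by (auto intro: analytic_on_subset)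
    thus ?thesis by (rule isolated_singularity_at_analytic)
  qed
  show "is_pole zeta_mero x \<and> zeta_mero x = 0" if "x \<in> {1}" for x using zeta_mero_pole that by (simp add: zeta_mero_def)
qed (auto simp: zeta_mero_analytic)

lemma zeta_mero_eq_zeta_series: "Re s > 1 \<Longrightarrow> zeta_mero s = zeta_series s"
  by (auto simp: zeta_mero_def zeta_reg_eq_zeta_series)

text \<open>Two candidates agree on Re s > 1, so their difference, with singularities removed, is
  constantly 0. This gives agreement on punctured neighbourhoods;
  \<open>nicely_meromorphic_on\<close> then fixes the value at the point itself, as 0 at a pole and
  as the limit elsewhere.\<close>

lemma riemann_zeta_eq: "riemann_zeta = zeta_mero"
  unfolding riemann_zeta_def
proof (rule the_equality)
  show "zeta_mero nicely_meromorphic_on UNIV \<and> (\<forall>s. 1 < Re s \<longrightarrow> (\<lambda>n. 1 / of_nat (Suc n) powr s) sums zeta_mero s)"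
    using zeta_mero_nicely_meromorphic zeta_series(2) by (auto simp: zeta_mero_eq_zeta_series)
next
  fix f assume f: "f nicely_meromorphic_on UNIV \<and> (\<forall>s. 1 < Re s \<longrightarrow> (\<lambda>n. 1 / of_nat (Suc n) powr s) sums f s)"
  have f_zeta_series: "f s = zeta_mero s" if "Re s > 1" for s
    using f zeta_series(2)[OF that] that by (metis sums_unique2 zeta_mero_eq_zeta_series)
  let ?d = "\<lambda>s. f s - zeta_mero s"
  have mer: "?d meromorphic_on UNIV"
    using f zeta_mero_nicely_meromorphic by (intro meromorphic_on_diff) (auto simp: nicely_meromorphic_on_def)
  define r where "r = remove_sings ?d"
  have r0: "r s = 0" if "Re s > 1" for s
    unfolding r_def
  proof (rule remove_sings_eqI)
    have "eventually (\<lambda>w. w \<in> {w. Re w > 1}) (at s)"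
      using that by (intro eventually_at_in_open' open_halfspace_Re_gt) auto
    hence "eventually (\<lambda>w. ?d w = 0) (at s)" by eventually_elim (simp add: f_zeta_series)
    thus "?d \<midarrow>s\<rightarrow> 0" by (rule tendsto_eventually)
  qed
  have "r constant_on UNIV"
  proof (rule constant_on_extend_nicely_meromorphic_on)
    show "r nicely_meromorphic_on UNIV" unfolding r_def using mer by (rule remove_sings_nicely_meromorphic)
    show "r constant_on {s. Re s > 1}" unfolding constant_on_def using r0 by auto
    have "2 \<in> {s. Re s > 1}" by simp
    thus "{s. Re s > 1} \<noteq> {}" by blast
  qed (auto simp: open_halfspace_Re_gt)
  hence r: "r s = 0" for s using r0[of 2] unfolding constant_on_def by auto
  show "f = zeta_mero"
  proof
    fix s
    have "isolated_singularity_at ?d s"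
      using mer by (intro meromorphic_on_isolated_singularity) (rule meromorphic_on_subset, auto)
    hence "eventually (\<lambda>w. r w = ?d w) (at s)" unfolding r_def by (rule eventually_remove_sings_eq_at)
    hence ev: "eventually (\<lambda>w. f w = zeta_mero w) (at s)" by eventually_elim (simp add: r)
    have pole: "is_pole f s \<longleftrightarrow> is_pole zeta_mero s" using ev by (rule is_pole_cong) simp
    have lim: "(f \<midarrow>s\<rightarrow> c) \<longleftrightarrow> (zeta_mero \<midarrow>s\<rightarrow> c)" for c using ev by (rule tendsto_cong)
    have "(is_pole f s \<and> f s = 0) \<or> f \<midarrow>s\<rightarrow> f s" "(is_pole zeta_mero s \<and> zeta_mero s = 0) \<or> zeta_mero \<midarrow>s\<rightarrow> zeta_mero s"
      using f zeta_mero_nicely_meromorphic by (auto simp: nicely_meromorphic_on_def)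
    moreover have "\<not> (is_pole zeta_mero s \<and> zeta_mero \<midarrow>s\<rightarrow> c)" for c
      using not_tendsto_and_filterlim_at_infinity[of "at s" zeta_mero c] by (auto simp: is_pole_def)
    ultimately show "f s = zeta_mero s" unfolding pole lim by (metis LIM_unique)
  qed
qed

text \<open>The locale has the growth constant as a parameter, while \<open>order_bound\<close> only
  asserts that one exists; hence \<open>SOME\<close>.\<close>

interpretation zeta_hadamard: finite_order_entire zeta_reg "SOME B. \<forall>z. norm (zeta_reg z) \<le> exp (B * (1 + norm z) powr (3/2))" "3/2"
proof
  have "\<exists>B. \<forall>z. norm (zeta_reg z) \<le> exp (B * (1 + norm z) powr (3/2))"
    using zeta_reg_order_bound unfolding order_bound_def by blast
  from someI_ex[OF this]
  show "norm (zeta_reg z) \<le> exp ((SOME B. \<forall>z. norm (zeta_reg z) \<le> exp (B * (1 + norm z) powr (3/2))) * (1 + norm z) powr (3/2))" for z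
    by blast
qed (auto simp: zeta_reg_holomorphic zeta_reg_0)

text \<open>The - 1 is the logarithmic derivative of s - 1 at 0. The factor exp s in the Weierstrass
  factor of the pole will cancel it.\<close>

lemma zeta_hadamard_c: "zeta_hadamard.c = of_real (ln (2 * pi)) - 1"
  by (simp add: zeta_hadamard.c_def zeta_reg_0 deriv_zeta_reg_0 algebra_simps)

lemma zeta_hadamard_S: "\<rho> \<in> zeta_hadamard.S \<Longrightarrow> Re \<rho> \<le> 1" "1 \<notin> zeta_hadamard.S" "0 \<notin> zeta_hadamard.S"
proof -
  show "1 \<notin> zeta_hadamard.S" "0 \<notin> zeta_hadamard.S" by (auto simp: zeta_hadamard.S_def zeta_reg_0 zeta_reg_1)
  show "Re \<rho> \<le> 1" if "\<rho> \<in> zeta_hadamard.S"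
  proof (rule ccontr)
    assume "\<not> Re \<rho> \<le> 1"
    thus False using zeta_reg_eq_zeta_series[of \<rho>] zeta_series_nonzero[of \<rho>] that by (auto simp: zeta_hadamard.S_def)
  qed
qed

section \<open>The divisor of zeta, read off from (s - 1) zeta(s)\<close>

lemma zorder_zeta_reg: "zeta_reg \<rho> = 0 \<Longrightarrow> zorder zeta_reg \<rho> > 0" "zeta_reg \<rho> \<noteq> 0 \<Longrightarrow> zorder zeta_reg \<rho> = 0"
proof -
  have "\<exists>w\<in>UNIV. zeta_reg w \<noteq> 0" using zeta_reg_1 by (intro bexI[of _ 1]) auto
  from conjunct1[OF zorder_exist_zero[OF zeta_reg_holomorphic open_UNIV connected_UNIV UNIV_I this, of \<rho>]]
  show "zeta_reg \<rho> = 0 \<Longrightarrow> zorder zeta_reg \<rho> > 0" "zeta_reg \<rho> \<noteq> 0 \<Longrightarrow> zorder zeta_reg \<rho> = 0" by (auto split: if_splits)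
qed

lemma zorder_zeta_1: "zorder riemann_zeta 1 = -1"
proof -
  have "zorder (\<lambda>w. zeta_reg w / (w - 1) ^ 1) 1 = - int 1"
    by (rule zorder_nonzero_div_power[OF open_UNIV _ zeta_reg_holomorphic]) (auto simp: zeta_reg_1)
  also have "zorder (\<lambda>w. zeta_reg w / (w - 1) ^ 1) 1 = zorder zeta_mero 1"
    by (rule zorder_cong) (auto simp: eventually_at_filter zeta_mero_def)
  finally show ?thesis by (simp add: riemann_zeta_eq)
qed

lemma zorder_zeta: "\<rho> \<noteq> 1 \<Longrightarrow> zorder riemann_zeta \<rho> = zorder zeta_reg \<rho>"
proof -
  assume \<rho>: "\<rho> \<noteq> 1"
  let ?g = "\<lambda>w. 1 / (w - 1)"
  have an: "zeta_reg analytic_on {\<rho>}" "?g analytic_on {\<rho>}"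
  proof -
    have "zeta_reg analytic_on UNIV" using zeta_reg_holomorphic by (simp add: analytic_on_open)
    thus "zeta_reg analytic_on {\<rho>}" by (rule analytic_on_subset) simp
    show "?g analytic_on {\<rho>}" using \<rho> by (intro analytic_intros) auto
  qed
  have "\<exists>w\<in>UNIV. zeta_reg w \<noteq> 0" using zeta_reg_1 by (intro bexI[of _ 1]) auto
  hence "eventually (\<lambda>w. zeta_reg w \<noteq> 0) (at \<rho>)"
    using non_zero_neighbour_alt[OF zeta_reg_holomorphic open_UNIV connected_UNIV UNIV_I, of _ \<rho>] by (auto elim!: eventually_mono)
  moreover have "eventually (\<lambda>w. w \<in> -{1}) (at \<rho>)" using \<rho> by (intro eventually_at_in_open') auto
  ultimately have "eventually (\<lambda>w. zeta_reg w * ?g w \<noteq> 0) (at \<rho>)" by eventually_elim auto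
  hence "zorder (\<lambda>w. zeta_reg w * ?g w) \<rho> = zorder zeta_reg \<rho> + zorder ?g \<rho>" by (rule zorder_times_analytic[OF an])
  also have "zorder ?g \<rho> = 0" using \<rho> by (intro zorder_eq_0I an) auto
  also have "zorder (\<lambda>w. zeta_reg w * ?g w) \<rho> = zorder zeta_mero \<rho>"
  proof (rule zorder_cong)
    have "eventually (\<lambda>w. zeta_mero w = zeta_reg w / (w - 1)) (at \<rho>)" using zeta_mero_ev[OF \<rho>] by (simp add: eventually_nhds_conv_at)
    thus "eventually (\<lambda>w. zeta_reg w * ?g w = zeta_mero w) (at \<rho>)" by eventually_elim simp
  qed auto
  finally show ?thesis by (simp add: riemann_zeta_eq)
qed

lemma divisor_support_zeta: "divisor_support riemann_zeta = insert 1 zeta_hadamard.S"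
proof -
  have "zorder riemann_zeta \<rho> \<noteq> 0 \<longleftrightarrow> \<rho> = 1 \<or> zeta_reg \<rho> = 0" for \<rho>
    using zorder_zeta_reg[of \<rho>] by (cases "\<rho> = 1") (auto simp: zorder_zeta_1 zorder_zeta)
  thus ?thesis by (auto simp: divisor_support_def zeta_hadamard.S_def)
qed

lemma zorder_zeta_S: "\<rho> \<in> zeta_hadamard.S \<Longrightarrow> zorder riemann_zeta \<rho> = int (zeta_hadamard.m \<rho>)"
proof -
  assume \<rho>: "\<rho> \<in> zeta_hadamard.S"
  hence "\<rho> \<noteq> 1" using zeta_hadamard_S(2) by metis
  thus ?thesis using zorder_zeta_reg(1)[of \<rho>] \<rho> by (simp add: zorder_zeta zeta_hadamard.m_def zeta_hadamard.S_def)
qed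

lemma zorder_zeta_0: "zorder riemann_zeta 0 = 0"
  using zorder_zeta_reg(2)[of 0] by (simp add: zorder_zeta zeta_reg_0)

text \<open>The pole adds one factor E_1(s)^(-1). Along the finite subsets of the enlarged divisor,
  1 eventually belongs to F, and F - {1} runs through the finite sets of zeros.\<close>

lemma zeta_product_tendsto:
  assumes "s \<noteq> 1"
  shows "((\<lambda>F. \<Prod>\<rho>\<in>F. weierstrass_factor 1 (s / \<rho>) powi zorder riemann_zeta \<rho>) \<longlongrightarrow>
           zeta_reg s / (zeta_reg 0 * exp (zeta_hadamard.c * s)) * inverse ((1 - s) * exp s)) (finite_subsets_at_top (insert 1 zeta_hadamard.S))"
proof -
  have "filterlim (\<lambda>F. F - {1}) (finite_subsets_at_top zeta_hadamard.S) (finite_subsets_at_top (insert 1 zeta_hadamard.S))"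
    unfolding filterlim_iff eventually_finite_subsets_at_top
  proof (intro allI impI)
    fix P assume "\<exists>X. finite X \<and> X \<subseteq> zeta_hadamard.S \<and> (\<forall>Y. finite Y \<and> X \<subseteq> Y \<and> Y \<subseteq> zeta_hadamard.S \<longrightarrow> P Y)"
    then obtain X where X: "finite X" "X \<subseteq> zeta_hadamard.S" and PX: "\<forall>Y. finite Y \<and> X \<subseteq> Y \<and> Y \<subseteq> zeta_hadamard.S \<longrightarrow> P Y"
      by (elim exE conjE)
    show "\<exists>X. finite X \<and> X \<subseteq> insert 1 zeta_hadamard.S \<and> (\<forall>Y. finite Y \<and> X \<subseteq> Y \<and> Y \<subseteq> insert 1 zeta_hadamard.S \<longrightarrow> P (Y - {1}))"
    proof (intro exI[of _ X] conjI allI impI X(1))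
      show "X \<subseteq> insert 1 zeta_hadamard.S" using X(2) by blast
      show "P (Y - {1})" if "finite Y \<and> X \<subseteq> Y \<and> Y \<subseteq> insert 1 zeta_hadamard.S" for Y
        by (rule PX[rule_format], intro conjI) (use that X(2) zeta_hadamard_S(2) in blast)+
    qed
  qed
  from filterlim_compose[OF zeta_hadamard.product_tendsto[of s] this]
  have lim: "((\<lambda>F. zeta_hadamard.E (F - {1}) s * inverse ((1 - s) * exp s)) \<longlongrightarrow>
      zeta_reg s / (zeta_reg 0 * exp (zeta_hadamard.c * s)) * inverse ((1 - s) * exp s)) (finite_subsets_at_top (insert 1 zeta_hadamard.S))"
    by (intro tendsto_mult tendsto_const)
  have "eventually (\<lambda>F. finite F \<and> 1 \<in> F \<and> F \<subseteq> insert 1 zeta_hadamard.S) (finite_subsets_at_top (insert 1 zeta_hadamard.S))"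
    unfolding eventually_finite_subsets_at_top by (intro exI[of _ "{1}"]) auto
  hence "eventually (\<lambda>F. zeta_hadamard.E (F - {1}) s * inverse ((1 - s) * exp s) =
     (\<Prod>\<rho>\<in>F. weierstrass_factor 1 (s / \<rho>) powi zorder riemann_zeta \<rho>)) (finite_subsets_at_top (insert 1 zeta_hadamard.S))"
  proof eventually_elim
    case (elim F)
    have "(\<Prod>\<rho>\<in>F. weierstrass_factor 1 (s / \<rho>) powi zorder riemann_zeta \<rho>) =
      weierstrass_factor 1 (s / 1) powi zorder riemann_zeta 1 * (\<Prod>\<rho>\<in>F - {1}. weierstrass_factor 1 (s / \<rho>) powi zorder riemann_zeta \<rho>)"
      using elim by (intro prod.remove) auto
    also have "weierstrass_factor 1 (s / 1) powi zorder riemann_zeta 1 = inverse ((1 - s) * exp s)"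
      by (simp add: zorder_zeta_1 weierstrass_factor_def power_int_minus)
    also have "(\<Prod>\<rho>\<in>F - {1}. weierstrass_factor 1 (s / \<rho>) powi zorder riemann_zeta \<rho>) = zeta_hadamard.E (F - {1}) s"
      unfolding zeta_hadamard.E_def using elim by (intro prod.cong refl) (auto simp: zorder_zeta_S)
    finally show ?case by (simp add: mult.commute)
  qed
  with lim show ?thesis by (rule Lim_transform_eventually)
qed

text \<open>The constant coefficient is a logarithm of zeta(0) = - 1/2, with i pi for the sign; the
  linear one is \<open>zeta_hadamard.c + 1\<close>.\<close>

lemma hadamard_factorization_zeta:
  "hadamard_factorization riemann_zeta [:of_real (ln (1/2)) + \<i> * of_real pi, of_real (ln (2 * pi)):]"
  unfolding hadamard_factorization_def
proof (intro allI impI)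
  fix s assume "\<not> is_pole riemann_zeta s"
  hence s: "s \<noteq> 1" using zeta_mero_pole by (auto simp: riemann_zeta_eq)
  have D: "divisor_support riemann_zeta - {0} = insert 1 zeta_hadamard.S" using zeta_hadamard_S(3) by (auto simp: divisor_support_zeta)
  let ?P = "zeta_reg s / (zeta_reg 0 * exp (zeta_hadamard.c * s)) * inverse ((1 - s) * exp s)"
  let ?Q = "[:of_real (ln (1/2)) + \<i> * of_real pi, of_real (ln (2 * pi)):]"
  have "exp (poly ?Q s) = - (1 / 2) * exp (of_real (ln (2 * pi)) * s)"
  proof -
    have "exp (complex_of_real (ln (1/2)) + \<i> * of_real pi) = - (1 / 2)"
      unfolding exp_add exp_of_real by simp
    moreover have "poly ?Q s = (complex_of_real (ln (1/2)) + \<i> * of_real pi) + of_real (ln (2 * pi)) * s"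
      by simp
    ultimately show ?thesis by (simp only: exp_add)
  qed
  moreover have "exp (zeta_hadamard.c * s) * exp s = exp (of_real (ln (2 * pi)) * s)"
    by (simp add: zeta_hadamard_c algebra_simps flip: exp_add)
  ultimately have "exp (poly ?Q s) * ?P = zeta_reg s / (s - 1)"
    using s by (simp add: zeta_reg_0 field_simps)
  moreover have "riemann_zeta s = zeta_reg s / (s - 1)" using s by (simp add: riemann_zeta_eq zeta_mero_def)
  ultimately have "riemann_zeta s = s powi zorder riemann_zeta 0 * exp (poly ?Q s) * ?P"
    by (simp only: zorder_zeta_0 power_int_0_right mult_1)
  thus "\<exists>P. ((\<lambda>F. \<Prod>\<rho>\<in>F. weierstrass_factor 1 (s / \<rho>) powi zorder riemann_zeta \<rho>) \<longlongrightarrow> P)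
        (finite_subsets_at_top (divisor_support riemann_zeta - {0})) \<and>
       riemann_zeta s = s powi zorder riemann_zeta 0 * exp (poly ?Q s) * P"
    unfolding D using zeta_product_tendsto[OF s] by blast
qed

text \<open>Near 0 zeta does not vanish, so exp (Q - R) = 1 there and its derivative at 0 is 0. In
  \<open>c0\<close> the derivative is a constant polynomial, hence the value at 0 determines
  it.\<close>

lemma hadamard_factorization_unique:
  assumes "hadamard_factorization riemann_zeta Q" "hadamard_factorization riemann_zeta R"
  shows "poly (pderiv Q) 0 = poly (pderiv R) 0"
proof -
  have eq: "exp (poly (Q - R) s) = 1" if s: "s \<noteq> 1" "zeta_reg s \<noteq> 0" for s
  proof -
    have "isCont zeta_mero s" using zeta_mero_analytic s by (intro analytic_at_imp_isCont) (auto intro: analytic_on_subset)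
    hence np: "\<not> is_pole riemann_zeta s"
      using not_tendsto_and_filterlim_at_infinity[of "at s" zeta_mero "zeta_mero s"] by (auto simp: isCont_def is_pole_def riemann_zeta_eq)
    obtain P P' where P: "((\<lambda>F. \<Prod>\<rho>\<in>F. weierstrass_factor 1 (s / \<rho>) powi zorder riemann_zeta \<rho>) \<longlongrightarrow> P)
        (finite_subsets_at_top (divisor_support riemann_zeta - {0}))"
      "riemann_zeta s = s powi zorder riemann_zeta 0 * exp (poly Q s) * P"
      and P': "((\<lambda>F. \<Prod>\<rho>\<in>F. weierstrass_factor 1 (s / \<rho>) powi zorder riemann_zeta \<rho>) \<longlongrightarrow> P')
        (finite_subsets_at_top (divisor_support riemann_zeta - {0}))"
      "riemann_zeta s = s powi zorder riemann_zeta 0 * exp (poly R s) * P'"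
      using assms np unfolding hadamard_factorization_def by blast
    have "P = P'" using P(1) P'(1) by (intro tendsto_unique) auto
    moreover have "riemann_zeta s \<noteq> 0" using s by (simp add: riemann_zeta_eq zeta_mero_def)
    ultimately have "exp (poly Q s) = exp (poly R s)" using P(2) P'(2) by (auto simp: zorder_zeta_0)
    thus ?thesis by (simp add: exp_diff)
  qed
  have "open {s. zeta_reg s \<noteq> 0}"
    using holomorphic_on_imp_continuous_on[OF zeta_reg_holomorphic] by (intro open_Collect_neq continuous_on_const)
  hence "eventually (\<lambda>s. s \<in> {s. zeta_reg s \<noteq> 0}) (nhds 0)" by (rule eventually_nhds_in_open) (simp add: zeta_reg_0)
  moreover have "eventually (\<lambda>s. s \<in> -{1}) (nhds (0::complex))" by (intro eventually_nhds_in_open) auto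
  ultimately have "eventually (\<lambda>s. exp (poly (Q - R) s) = 1) (nhds 0)" by eventually_elim (use eq in auto)
  hence "((\<lambda>s. exp (poly (Q - R) s)) has_field_derivative 0) (at 0) \<longleftrightarrow> ((\<lambda>s. 1 :: complex) has_field_derivative 0) (at 0)"
    by (intro DERIV_cong_ev) auto
  hence "((\<lambda>s. exp (poly (Q - R) s)) has_field_derivative 0) (at 0)" by simp
  moreover have "((\<lambda>s. exp (poly (Q - R) s)) has_field_derivative exp (poly (Q - R) 0) * poly (pderiv (Q - R)) 0) (at 0)"
    by (intro DERIV_fun_exp poly_DERIV)
  ultimately have "exp (poly (Q - R) 0) * poly (pderiv (Q - R)) 0 = 0" using DERIV_unique by blast
  thus ?thesis by (simp add: pderiv_diff)
qed

lemma c0_zeta: "c0 riemann_zeta = - of_real (ln (2 * pi))"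
  unfolding c0_def
proof (rule the_equality)
  let ?Q = "[:of_real (ln (1/2)) + \<i> * of_real pi, of_real (ln (2 * pi)):] :: complex poly"
  show "\<exists>Q. hadamard_factorization riemann_zeta Q \<and> - pderiv Q = [:- of_real (ln (2 * pi)):]"
    by (intro exI[of _ ?Q] conjI hadamard_factorization_zeta) (simp add: pderiv_pCons)
  fix c assume "\<exists>Q. hadamard_factorization riemann_zeta Q \<and> - pderiv Q = [:c:]"
  then obtain Q where Q: "hadamard_factorization riemann_zeta Q" "- pderiv Q = [:c:]" by blast
  have "poly (pderiv Q) 0 = poly (pderiv ?Q) 0"
    by (rule hadamard_factorization_unique[OF Q(1) hadamard_factorization_zeta])
  moreover have "poly (pderiv Q) 0 = - c" using arg_cong[OF Q(2), of "\<lambda>p. poly p 0"] by (simp add: minus_equation_iff)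
  ultimately show "c = - of_real (ln (2 * pi))" by (simp add: pderiv_pCons) (metis minus_minus)
qed

section \<open>Zeros against primes\<close>

text \<open>By linearity g is orthogonal to all polynomials. With p uniformly \<epsilon>-close to g,
  the integral of g^2 equals that of (g - p) g and is at most \<epsilon> M.\<close>

lemma moment_zero_real:
  fixes g :: "real \<Rightarrow> real"
  assumes g: "continuous_on {0..1} g" and mom: "\<And>j. integral {0..1} (\<lambda>u. u ^ j * g u) = 0" and u: "u \<in> {0..1}"
  shows "g u = 0"
proof -
  have int: "f integrable_on {0..1}" if "continuous_on {0..1} f" for f :: "real \<Rightarrow> real"
    using that by (rule integrable_continuous_interval)
  obtain M where "\<forall>x\<in>g ` {0..1}. norm x \<le> M"
    using compact_imp_bounded[OF compact_continuous_image[OF g compact_Icc]] unfolding bounded_iff by blast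
  hence M: "\<bar>g x\<bar> \<le> M" if "x \<in> {0..1}" for x using that by auto
  have M0: "M \<ge> 0" using M[of 0] by auto
  have le: "integral {0..1} (\<lambda>u. g u * g u) \<le> \<epsilon> * M" if \<epsilon>: "\<epsilon> > 0" for \<epsilon>
  proof -
    obtain p where p: "real_polynomial_function p" "\<And>x. x \<in> {0..1} \<Longrightarrow> \<bar>g x - p x\<bar> < \<epsilon>"
      using Stone_Weierstrass_real_polynomial_function[OF compact_Icc g \<epsilon>] by blast
    obtain a n where pa: "p = (\<lambda>x. \<Sum>i\<le>n. a i * x ^ i)"
      using p(1) unfolding real_polynomial_function_iff_sum by blast
    have pc: "continuous_on {0..1} p" unfolding pa by (intro continuous_intros)
    have "integral {0..1} (\<lambda>u. p u * g u) = integral {0..1} (\<lambda>u. \<Sum>i\<le>n. a i * (u ^ i * g u))"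
      by (simp only: pa sum_distrib_right mult.assoc)
    also have "\<dots> = (\<Sum>i\<le>n. integral {0..1} (\<lambda>u. a i * (u ^ i * g u)))"
      by (intro integral_sum int continuous_intros g) auto
    also have "\<dots> = 0" using mom by simp
    finally have p0: "integral {0..1} (\<lambda>u. p u * g u) = 0" .
    have "integral {0..1} (\<lambda>u. g u * g u) - integral {0..1} (\<lambda>u. p u * g u) = integral {0..1} (\<lambda>u. (g u - p u) * g u)"
      by (subst integral_diff [symmetric]) (auto intro!: int continuous_intros g pc simp: algebra_simps)
    also have "\<dots> \<le> \<bar>\<dots>\<bar>" by simp
    also have "\<dots> \<le> \<epsilon> * M * (1 - 0)"
    proof -
      have "norm (integral {0..1} (\<lambda>u. (g u - p u) * g u)) \<le> \<epsilon> * M * (1 - 0)"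
      proof (rule integral_bound)
        show "norm ((g t - p t) * g t) \<le> \<epsilon> * M" if "t \<in> {0..1}" for t
          unfolding real_norm_def abs_mult using p(2)[OF that] M[OF that] \<epsilon> by (intro mult_mono) auto
      qed (auto intro!: continuous_intros g pc)
      thus ?thesis by simp
    qed
    finally show ?thesis using p0 by simp
  qed
  have nonneg: "integral {0..1} (\<lambda>u. g u * g u) \<ge> 0" by (intro integral_nonneg int continuous_intros g) auto
  have "integral {0..1} (\<lambda>u. g u * g u) \<le> 0"
  proof (rule field_le_epsilon)
    fix e :: real assume "e > 0"
    have "integral {0..1} (\<lambda>u. g u * g u) \<le> e / (M + 1) * M" using \<open>e > 0\<close> M0 by (intro le) auto
    also have "\<dots> \<le> e" using \<open>e > 0\<close> M0 by (simp add: field_simps)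
    finally show "integral {0..1} (\<lambda>u. g u * g u) \<le> 0 + e" by simp
  qed
  with nonneg have "integral {0..1} (\<lambda>u. g u * g u) = 0" by linarith
  hence "\<forall>x\<in>{0..1}. g x * g x = 0"
    by (subst (asm) integral_eq_0_iff) (auto intro!: continuous_intros g)
  thus ?thesis using u by auto
qed

lemma moment_zero:
  fixes g :: "real \<Rightarrow> complex"
  assumes g: "continuous_on {0..1} g" and mom: "\<And>j. ((\<lambda>u. of_real u ^ j * g u) has_integral 0) {0..1}" and u: "u \<in> {0..1}"
  shows "g u = 0"
proof -
  have "Re (g u) = 0"
  proof (rule moment_zero_real[OF _ _ u])
    show "integral {0..1} (\<lambda>u. u ^ j * Re (g u)) = 0" for j
      using integral_unique[OF has_integral_linear[OF mom[of j] bounded_linear_Re]]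
      by (simp add: o_def flip: of_real_power)
  qed (intro continuous_intros g)
  moreover have "Im (g u) = 0"
  proof (rule moment_zero_real[OF _ _ u])
    show "integral {0..1} (\<lambda>u. u ^ j * Im (g u)) = 0" for j
      using integral_unique[OF has_integral_linear[OF mom[of j] bounded_linear_Im]]
      by (simp add: o_def flip: of_real_power)
  qed (intro continuous_intros g)
  ultimately show ?thesis by (simp add: complex_eq_iff)
qed

section \<open>Moments on [0,1] of complex powers and of ramps\<close>

lemma continuous_on_cpowr:
  assumes "Re a > 0"
  shows "continuous_on {0..1} (\<lambda>u. complex_of_real u powr a)"
  using assms by (intro continuous_on_powr_complex continuous_intros) auto

lemma cpowr_has_integral:
  assumes "Re a > 0"
  shows "((\<lambda>u. complex_of_real u powr a) has_integral 1 / (a + 1)) {0..1}"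
proof -
  have nz: "a + 1 \<noteq> 0" using assms by (auto simp: complex_eq_iff)
  have "((\<lambda>u. complex_of_real u powr a) has_integral of_real 1 powr (a + 1) / (a + 1) - of_real 0 powr (a + 1) / (a + 1)) {0..1}"
  proof (rule fundamental_theorem_of_calculus_interior)
    show "continuous_on {0..1} (\<lambda>u. complex_of_real u powr (a + 1) / (a + 1))"
      using assms nz by (intro continuous_intros continuous_on_cpowr) auto
    show "((\<lambda>u. complex_of_real u powr (a + 1) / (a + 1)) has_vector_derivative complex_of_real x powr a) (at x)"
      if x: "x \<in> {0<..<1}" for x
    proof -
      have "((\<lambda>z. z powr (a + 1) / (a + 1)) has_field_derivative (a + 1) * complex_of_real x powr (a + 1 - 1) / (a + 1)) (at (of_real x))"
        using x by (intro DERIV_cdivide has_field_derivative_powr) auto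
      hence "((\<lambda>z. z powr (a + 1) / (a + 1)) has_field_derivative complex_of_real x powr a) (at (of_real x))"
        using nz by simp
      from field_vector_diff_chain_at[OF has_vector_derivative_of_real[OF DERIV_ident] this]
      show ?thesis by (simp add: o_def)
    qed
  qed auto
  thus ?thesis by simp
qed

text \<open>With \<open>u = exp (- t)\<close> this is \<open>exp (- 2 * t) * max 0 (t - ln q)\<close>.\<close>

definition ramp :: "real \<Rightarrow> real \<Rightarrow> real" where
  "ramp q u = (if 0 < u \<and> u \<le> 1 / q then - (u\<^sup>2 * ln (q * u)) else 0)"

text \<open>All from ln x \<le> x - 1 at x = 1/(q u). The bound u/q gives continuity at 0; 1/q^2 is
  uniform in u and, with q = p^k and weight log p, summable.\<close>

lemma ramp_bounds:
  assumes "q \<ge> 1" "u \<in> {0..1}"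
  shows "0 \<le> ramp q u" "ramp q u \<le> u / q" "ramp q u \<le> 1 / q\<^sup>2"
proof -
  have *: "0 \<le> ramp q u \<and> ramp q u \<le> u / q \<and> ramp q u \<le> 1 / q\<^sup>2"
  proof (cases "0 < u \<and> u \<le> 1 / q")
    case True
    hence qu: "0 < q * u" "q * u \<le> 1" using assms by (auto simp: field_simps)
    have "ln (1 / (q * u)) \<le> 1 / (q * u) - 1" using qu by (intro ln_le_minus_one) auto
    hence l: "- ln (q * u) \<le> 1 / (q * u)" using True assms by (simp add: ln_div)
    have "u\<^sup>2 * - ln (q * u) \<le> u\<^sup>2 * (1 / (q * u))" by (intro mult_left_mono l) auto
    also have "\<dots> = u / q" using True by (simp add: power2_eq_square)
    finally have 1: "ramp q u \<le> u / q" using True by (simp add: ramp_def)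
    also have "u / q \<le> (1 / q) / q" using True assms by (intro divide_right_mono) auto
    finally have 2: "ramp q u \<le> 1 / q\<^sup>2" by (simp add: power2_eq_square)
    have "ln (q * u) \<le> 0" using qu by simp
    hence "0 \<le> ramp q u" using True by (simp add: ramp_def mult_nonneg_nonpos)
    thus ?thesis using 1 2 by simp
  qed (use assms in \<open>auto simp: ramp_def\<close>)
  thus "0 \<le> ramp q u" "ramp q u \<le> u / q" "ramp q u \<le> 1 / q\<^sup>2" by auto
qed

lemma ramp_continuous:
  assumes q: "q \<ge> 1"
  shows "continuous_on {0..1} (ramp q)"
proof -
  have "continuous (at x within {0..1}) (ramp q)" if x: "x \<in> {0..1}" for x
  proof (cases "x = 0")
    case True
    have "(ramp q \<longlongrightarrow> 0) (at 0 within {0..1})"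
    proof (rule tendsto_sandwich)
      show "eventually (\<lambda>u. 0 \<le> ramp q u) (at 0 within {0..1})"
        using ramp_bounds[OF q] by (auto simp: eventually_at_filter)
      show "eventually (\<lambda>u. ramp q u \<le> u / q) (at 0 within {0..1})"
        using ramp_bounds[OF q] by (auto simp: eventually_at_filter)
      show "((\<lambda>u. u / q) \<longlongrightarrow> 0) (at 0 within {0..1})" using q by (auto intro!: tendsto_eq_intros)
    qed auto
    thus ?thesis using True by (simp add: continuous_within ramp_def)
  next
    case False
    hence x0: "x > 0" using x by auto
    have "isCont (\<lambda>u. u\<^sup>2 * max 0 (- ln (q * u))) x" using x0 q by (intro continuous_intros) auto
    hence "continuous (at x within {0..1}) (\<lambda>u. u\<^sup>2 * max 0 (- ln (q * u)))" by (rule continuous_at_imp_continuous_at_within)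
    moreover have "u\<^sup>2 * max 0 (- ln (q * u)) = ramp q u" if "u > 0" for u
    proof (cases "u \<le> 1 / q")
      case True
      hence "q * u \<le> 1" "0 < q * u" using q that by (auto simp: field_simps)
      thus ?thesis using True that by (simp add: ramp_def max_def)
    next
      case False
      hence "q * u > 1" using q by (simp add: field_simps)
      thus ?thesis using False that by (simp add: ramp_def max_def)
    qed
    moreover have "eventually (\<lambda>u. u > 0) (nhds x)" using x0 by (intro eventually_nhds_in_open[of "{0<..}", simplified]) auto
    hence "eventually (\<lambda>u. u > 0) (at x within {0..1})" by (auto simp: eventually_at_filter elim: eventually_mono)
    ultimately show ?thesis
      unfolding continuous_within using x0 by (subst tendsto_cong[where g = "\<lambda>u. u\<^sup>2 * max 0 (- ln (q * u))"]) (auto elim!: eventually_mono)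
  qed
  thus ?thesis by (simp add: continuous_on_eq_continuous_within)
qed

text \<open>In the variable t this is the Laplace transform q^(-s) / s^2 of (t - ln q)_+ at s = j +
  3: the 3 collects u^2 from the ramp and du = - exp (-t) dt.\<close>

lemma ramp_has_integral:
  assumes q: "q \<ge> 1"
  shows "((\<lambda>u. u ^ j * ramp q u) has_integral q powr (-(real j + 3)) / (real j + 3)\<^sup>2) {0..1}"
proof -
  define k where "k = real j + 3"
  have k: "k > 0" "real (Suc j) + 2 = k" by (auto simp: k_def)
  \<comment> \<open>The antiderivative is written through \<open>ramp\<close>, whose continuity at 0
    replaces a discussion of u^(j+3) ln u.\<close>
  define F where "F = (\<lambda>u. u ^ (Suc j) * ramp q u / k + u ^ (j + 3) / k\<^sup>2)"
  have "((\<lambda>u. u ^ j * ramp q u) has_integral F (1 / q) - F 0) {0..1 / q}"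
  proof (rule fundamental_theorem_of_calculus_interior)
    have "continuous_on {0..1 / q} (ramp q)" by (rule continuous_on_subset[OF ramp_continuous[OF q]]) (use q in \<open>auto simp: divide_le_eq intro: order_trans\<close>)
    thus "continuous_on {0..1 / q} F" unfolding F_def by (intro continuous_intros) (use k in auto)
    fix x assume x: "x \<in> {0<..<1 / q}"
    have "((\<lambda>u. - (u ^ (j + 3) * ln (q * u)) / k + u ^ (j + 3) / k\<^sup>2) has_field_derivative
        - (real (j + 3) * x ^ (j + 2) * ln (q * x) + x ^ (j + 3) * (q / (q * x))) / k + real (j + 3) * x ^ (j + 2) / k\<^sup>2) (at x)"
      using x q k by (auto intro!: derivative_eq_intros simp: divide_simps)
    also have "- (real (j + 3) * x ^ (j + 2) * ln (q * x) + x ^ (j + 3) * (q / (q * x))) / k + real (j + 3) * x ^ (j + 2) / k\<^sup>2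
       = x ^ j * ramp q x"
    proof -
      have "x ^ (j + 3) * (q / (q * x)) = x ^ (j + 2)" using x q by (simp add: numeral_3_eq_3)
      moreover have "real (j + 3) = k" by (simp add: k_def)
      ultimately have "- (real (j + 3) * x ^ (j + 2) * ln (q * x) + x ^ (j + 3) * (q / (q * x))) / k + real (j + 3) * x ^ (j + 2) / k\<^sup>2
        = - (x ^ (j + 2) * ln (q * x))" using k by (simp add: field_simps power2_eq_square)
      thus ?thesis using x by (simp add: ramp_def power_add power2_eq_square mult_ac)
    qed
    finally have "((\<lambda>u. - (u ^ (j + 3) * ln (q * u)) / k + u ^ (j + 3) / k\<^sup>2) has_field_derivative x ^ j * ramp q x) (at x)" .
    also have "?this \<longleftrightarrow> (F has_field_derivative x ^ j * ramp q x) (at x)"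
    proof (rule DERIV_cong_ev)
      have "eventually (\<lambda>u. u \<in> {0<..<1 / q}) (nhds x)" using x by (intro eventually_nhds_in_open) auto
      thus "eventually (\<lambda>u. - (u ^ (j + 3) * ln (q * u)) / k + u ^ (j + 3) / k\<^sup>2 = F u) (nhds x)"
        by eventually_elim (simp add: F_def ramp_def numeral_3_eq_3 power2_eq_square)
    qed auto
    finally show "(F has_vector_derivative x ^ j * ramp q x) (at x)" by (simp add: has_real_derivative_iff_has_vector_derivative)
  qed (use q in auto)
  moreover have "F (1 / q) - F 0 = q powr (-(real j + 3)) / (real j + 3)\<^sup>2"
  proof -
    have "(1 / q) ^ (j + 3) = q powr (- k)"
    proof -
      have "q powr k = q ^ (j + 3)" using q powr_realpow[of q "j + 3"] by (simp add: k_def)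
      thus ?thesis unfolding powr_minus_divide power_divide by simp
    qed
    moreover have "F (1 / q) - F 0 = (1 / q) ^ (j + 3) / k\<^sup>2" using q by (simp add: F_def ramp_def)
    ultimately show ?thesis by (simp add: k_def)
  qed
  ultimately have "((\<lambda>u. u ^ j * ramp q u) has_integral q powr (-(real j + 3)) / (real j + 3)\<^sup>2) {0..1 / q}" by simp
  thus ?thesis
  proof (rule has_integral_on_superset)
    show "u ^ j * ramp q u = 0" if "u \<notin> {0..1 / q}" for u using that by (auto simp: ramp_def)
  qed (use q in \<open>auto simp: divide_le_eq intro: order_trans\<close>)
qed

lemma has_sum_diff:
  fixes f g :: "'a \<Rightarrow> complex" and S T :: complex
  assumes "(f has_sum S) A" "(g has_sum T) A"
  shows "((\<lambda>x. f x - g x) has_sum (S - T)) A"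
  using has_sum_add[OF assms(1) has_sum_uminusI[OF assms(2)]] by simp

text \<open>Uniform convergence along the finite subsets of the index set, so the conclusion is
  unconditional like \<open>infsum\<close> itself; neither index set comes with an
  enumeration.\<close>

lemma has_integral_infsum:
  fixes f :: "'a \<Rightarrow> real \<Rightarrow> complex" and I :: "'a \<Rightarrow> complex"
  assumes cont: "\<And>x. x \<in> A \<Longrightarrow> continuous_on {0..1} (f x)"
    and bound: "\<And>x u. x \<in> A \<Longrightarrow> u \<in> {0..1} \<Longrightarrow> norm (f x u) \<le> M x" and M: "M summable_on A"
    and int: "\<And>x. x \<in> A \<Longrightarrow> (f x has_integral I x) {0..1}"
  shows "\<exists>J. (I has_sum J) A \<and> ((\<lambda>u. \<Sum>\<^sub>\<infinity>x\<in>A. f x u) has_integral J) {0..1}"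
    and "continuous_on {0..1} (\<lambda>u. \<Sum>\<^sub>\<infinity>x\<in>A. f x u)"
proof -
  \<comment> \<open>Extension by 0 makes the partial sum continuous for every X, not only for
    subsets of A.\<close>
  define f' where "f' = (\<lambda>x u. if x \<in> A then f x u else 0)"
  have f': "continuous_on {0..1} (f' x)" for x using cont[of x] by (cases "x \<in> A") (auto simp: f'_def)
  have "uniform_limit {0..1} (\<lambda>X u. \<Sum>x\<in>X. f' x u) (\<lambda>u. \<Sum>\<^sub>\<infinity>x\<in>A. f' x u) (finite_subsets_at_top A)"
    by (rule Weierstrass_m_test_general[OF _ M]) (auto simp: f'_def bound)
  also have "(\<lambda>u. \<Sum>\<^sub>\<infinity>x\<in>A. f' x u) = (\<lambda>u. \<Sum>\<^sub>\<infinity>x\<in>A. f x u)"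
    by (intro ext infsum_cong) (simp add: f'_def)
  finally have lim: "uniform_limit {0..1} (\<lambda>X u. \<Sum>x\<in>X. f' x u) (\<lambda>u. \<Sum>\<^sub>\<infinity>x\<in>A. f x u) (finite_subsets_at_top A)" .
  have c: "continuous_on {0..1} (\<lambda>u. \<Sum>x\<in>X. f' x u)" for X by (intro continuous_intros f')
  show "continuous_on {0..1} (\<lambda>u. \<Sum>\<^sub>\<infinity>x\<in>A. f x u)"
    by (rule uniform_limit_theorem[OF _ lim]) (simp_all add: c)
  obtain I' J where IJ: "\<And>X. ((\<lambda>u. \<Sum>x\<in>X. f' x u) has_integral I' X) {0..1}"
    "((\<lambda>u. \<Sum>\<^sub>\<infinity>x\<in>A. f x u) has_integral J) {0..1}" "(I' \<longlongrightarrow> J) (finite_subsets_at_top A)"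
    by (rule uniform_limit_integral[OF lim c]) auto
  have "I' X = sum I X" if "finite X" "X \<subseteq> A" for X
  proof (rule has_integral_unique[OF IJ(1)])
    have "((\<lambda>u. \<Sum>x\<in>X. f x u) has_integral sum I X) {0..1}" using that int by (intro has_integral_sum) auto
    also have "(\<lambda>u. \<Sum>x\<in>X. f x u) = (\<lambda>u. \<Sum>x\<in>X. f' x u)"
      using that by (intro ext sum.cong) (auto simp: f'_def)
    finally show "((\<lambda>u. \<Sum>x\<in>X. f' x u) has_integral sum I X) {0..1}" .
  qed
  hence "eventually (\<lambda>X. I' X = sum I X) (finite_subsets_at_top A)"
    by (auto simp: eventually_finite_subsets_at_top)
  with IJ(3) have "(sum I \<longlongrightarrow> J) (finite_subsets_at_top A)" by (rule Lim_transform_eventually)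
  with IJ(2) show "\<exists>J. (I has_sum J) A \<and> ((\<lambda>u. \<Sum>\<^sub>\<infinity>x\<in>A. f x u) has_integral J) {0..1}"
    by (auto simp: has_sum_def)
qed

section \<open>The sums over the divisor and over the primes, compared through their moments\<close>

definition zeta_divisor :: "complex set" where "zeta_divisor = insert 1 zeta_hadamard.S"
definition zeta_mult :: "complex \<Rightarrow> complex" where "zeta_mult \<rho> = of_int (zorder riemann_zeta \<rho>)"

lemma zeta_divisor: "\<rho> \<in> zeta_divisor \<Longrightarrow> Re \<rho> \<le> 1" "\<rho> \<in> zeta_divisor \<Longrightarrow> \<rho> \<noteq> 0"
  using zeta_hadamard_S by (auto simp: zeta_divisor_def)

lemma zeta_divisor_summable: "(\<lambda>\<rho>. norm (zeta_mult \<rho>) / (norm \<rho>)\<^sup>2) summable_on zeta_divisor"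
proof -
  have "(\<lambda>\<rho>. norm (zeta_mult \<rho>) / (norm \<rho>)\<^sup>2) summable_on zeta_hadamard.S"
    using zeta_hadamard.summable_zeros by (rule summable_on_cong[THEN iffD1, rotated]) (simp add: zeta_mult_def zorder_zeta_S)
  thus ?thesis unfolding zeta_divisor_def by (simp add: summable_on_insert_iff)
qed

text \<open>For (s - 1) zeta(s) the sum over zeros is 1/(s - 1) + zeta'/zeta - c. The pole, of
  multiplicity - 1, contributes - 1/(s - 1) - 1, which removes the first term and turns c into c + 1
  = log (2 pi).\<close>

lemma log_deriv_zeta:
  assumes s: "Re s > 1"
  shows "((\<lambda>\<rho>. zeta_mult \<rho> * (1 / (s - \<rho>) + 1 / \<rho>)) has_sum (- mangoldt_series s - of_real (ln (2 * pi)))) zeta_divisor"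
proof -
  have s1: "s \<noteq> 1" using s by auto
  have Zs: "zeta_reg s = (s - 1) * zeta_series s" "zeta_series s \<noteq> 0" using zeta_reg_eq_zeta_series[OF s] zeta_series_nonzero[OF s] by auto
  have "((\<lambda>s. (s - 1) * zeta_series s) has_field_derivative 1 * zeta_series s + deriv zeta_series s * (s - 1)) (at s)"
    by (intro DERIV_mult holomorphic_derivI[OF zeta_series(1) open_halfspace_Re_gt]) (use s in \<open>auto intro!: derivative_eq_intros\<close>)
  also have "?this \<longleftrightarrow> (zeta_reg has_field_derivative 1 * zeta_series s + deriv zeta_series s * (s - 1)) (at s)"
  proof (rule DERIV_cong_ev)
    have "eventually (\<lambda>w. w \<in> {w. Re w > 1}) (nhds s)" using s by (intro eventually_nhds_in_open open_halfspace_Re_gt) auto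
    thus "eventually (\<lambda>w. (w - 1) * zeta_series w = zeta_reg w) (nhds s)" by eventually_elim (simp add: zeta_reg_eq_zeta_series)
  qed auto
  finally have dZ: "deriv zeta_reg s = zeta_series s + deriv zeta_series s * (s - 1)" by (simp add: DERIV_imp_deriv)
  have "deriv zeta_series s = - (mangoldt_series s * zeta_series s)" using mangoldt_series(2)[OF s] by simp
  hence ld: "deriv zeta_reg s / zeta_reg s = 1 / (s - 1) - mangoldt_series s" unfolding dZ Zs(1) using Zs(2) s1 by (simp add: field_simps)
  have "((\<lambda>\<rho>. of_nat (zeta_hadamard.m \<rho>) * (1 / (s - \<rho>) + 1 / \<rho>)) has_sum (1 / (s - 1) - mangoldt_series s - zeta_hadamard.c)) zeta_hadamard.S"
    using zeta_hadamard.log_deriv_has_sum[of s] Zs(2) s1 unfolding ld by (simp add: Zs(1))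
  hence "((\<lambda>\<rho>. zeta_mult \<rho> * (1 / (s - \<rho>) + 1 / \<rho>)) has_sum (1 / (s - 1) - mangoldt_series s - zeta_hadamard.c)) zeta_hadamard.S"
    by (rule has_sum_cong[THEN iffD1, rotated]) (simp add: zeta_mult_def zorder_zeta_S)
  from has_sum_insert[OF zeta_hadamard_S(2) this]
  show ?thesis by (simp add: zeta_divisor_def zeta_mult_def zorder_zeta_1 zeta_hadamard_c minus_diff_commute)
qed

text \<open>
  In \<open>u = exp (- t)\<close>, \<open>zero_sum\<close> is \<open>exp (- 2 * t) * (K\<^sub>2(t) - K\<^sub>2(0))\<close>, and \<open>prime_sum\<close> is its counterpart
  for the primes. The factor \<open>u\<^sup>2\<close> makes both continuous at \<open>u = 0\<close>, where \<open>\<rho> = 1\<close> contributes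
  \<open>u\<^bsup>2-\<rho>\<^esup>\<close>; their \<open>j\<close>-th moments are Laplace transforms at \<open>s = j + 3\<close>.
\<close>

definition zero_sum :: "real \<Rightarrow> complex" where
  "zero_sum u = (\<Sum>\<^sub>\<infinity>\<rho>\<in>zeta_divisor. zeta_mult \<rho> / \<rho>\<^sup>2 * (of_real u powr (2 - \<rho>) - of_real u powr 2))"

definition prime_sum :: "real \<Rightarrow> complex" where
  "prime_sum u = (\<Sum>\<^sub>\<infinity>(p, k)\<in>prime_exps. of_real (ln (real p) * ramp (real (p ^ k)) u))"

text \<open>The moment of u^(2-\<rho>) - u^2 is 1/(s - \<rho>) - 1/s = \<rho> / (s (s - \<rho>))
  with s = j + 3. Divided by \<rho>^2 it becomes s^(-2) (1/(s - \<rho>) + 1/\<rho>), so the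
  subtraction of K2(0) produces exactly the 1/\<rho> of genus one.\<close>

lemma zero_sum_integral:
  shows "continuous_on {0..1} zero_sum"
    and "((\<lambda>u. of_real u ^ j * zero_sum u) has_integral (- mangoldt_series (of_nat (j + 3)) - of_real (ln (2 * pi))) / (of_nat (j + 3))\<^sup>2) {0..1}"
proof -
  define f where "f = (\<lambda>j \<rho> u. complex_of_real u ^ j * (zeta_mult \<rho> / \<rho>\<^sup>2 * (of_real u powr (2 - \<rho>) - of_real u powr 2)))"
  have c: "continuous_on {0..1} (f j \<rho>)" if "\<rho> \<in> zeta_divisor" for j \<rho>
    unfolding f_def using zeta_divisor(1)[OF that] by (intro continuous_intros continuous_on_cpowr) auto
  have b: "norm (f j \<rho> u) \<le> norm (zeta_mult \<rho>) / (norm \<rho>)\<^sup>2 * 2" if "\<rho> \<in> zeta_divisor" "u \<in> {0..1}" for j \<rho> u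
  proof -
    \<comment> \<open>Re \<rho> \<le> 1 makes Re (2 - \<rho>) \<ge> 1, so both powers have modulus
      at most 1 on [0,1].\<close>
    have "norm (of_real u powr (2 - \<rho>)) \<le> 1" "norm (complex_of_real u powr 2) \<le> 1"
      using that zeta_divisor(1)[OF that(1)] by (auto simp: norm_powr_real_powr norm_power intro!: powr_le1 power_le_one)
    hence "norm (of_real u powr (2 - \<rho>) - complex_of_real u powr 2) \<le> 2"
      using norm_triangle_ineq4[of "of_real u powr (2 - \<rho>)" "complex_of_real u powr 2"] by linarith
    hence 1: "norm (zeta_mult \<rho> / \<rho>\<^sup>2 * (of_real u powr (2 - \<rho>) - of_real u powr 2)) \<le> norm (zeta_mult \<rho>) / (norm \<rho>)\<^sup>2 * 2"
      unfolding norm_mult norm_divide norm_power by (intro mult_left_mono) auto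
    have "norm (complex_of_real u ^ j) \<le> 1" using that by (simp add: norm_power power_le_one)
    hence "norm (f j \<rho> u) \<le> 1 * (norm (zeta_mult \<rho>) / (norm \<rho>)\<^sup>2 * 2)"
      unfolding f_def norm_mult[of "complex_of_real u ^ j"] by (intro mult_mono 1) auto
    thus ?thesis by simp
  qed
  have sm: "(\<lambda>\<rho>. norm (zeta_mult \<rho>) / (norm \<rho>)\<^sup>2 * 2) summable_on zeta_divisor" by (intro summable_on_cmult_left zeta_divisor_summable)
  have int: "(f j \<rho> has_integral zeta_mult \<rho> * (1 / (of_nat (j + 3) - \<rho>) + 1 / \<rho>) * (1 / (of_nat (j + 3))\<^sup>2)) {0..1}" if \<rho>: "\<rho> \<in> zeta_divisor" for j \<rho>
  proof -
    define s :: complex where "s = of_nat (j + 3)"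
    have sj: "Re s = real j + 3" by (simp add: s_def)
    have ne: "s \<noteq> 0" "s - \<rho> \<noteq> 0" "\<rho> \<noteq> 0" using zeta_divisor[OF \<rho>] sj by (auto simp: complex_eq_iff)
    have "((\<lambda>u. zeta_mult \<rho> / \<rho>\<^sup>2 * (of_real u powr (of_nat j + 2 - \<rho>) - of_real u powr (of_nat j + 2))) has_integral
       zeta_mult \<rho> / \<rho>\<^sup>2 * (1 / (of_nat j + 2 - \<rho> + 1) - 1 / (of_nat j + 2 + 1))) {0..1}"
      using zeta_divisor(1)[OF \<rho>] by (intro has_integral_mult_right has_integral_diff cpowr_has_integral) auto
    also have "zeta_mult \<rho> / \<rho>\<^sup>2 * (1 / (of_nat j + 2 - \<rho> + 1) - 1 / (of_nat j + 2 + 1)) = zeta_mult \<rho> / \<rho>\<^sup>2 * (1 / (s - \<rho>) - 1 / s)"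
      by (simp add: s_def algebra_simps)
    also have "1 / (s - \<rho>) - 1 / s = \<rho> / (s * (s - \<rho>))" using ne by (simp add: field_simps)
    also have "zeta_mult \<rho> / \<rho>\<^sup>2 * (\<rho> / (s * (s - \<rho>))) = zeta_mult \<rho> * (s / (\<rho> * (s - \<rho>))) * (1 / s\<^sup>2)"
      using ne by (simp add: power2_eq_square)
    also have "s / (\<rho> * (s - \<rho>)) = 1 / (s - \<rho>) + 1 / \<rho>" using ne by (simp add: field_simps)
    finally have I: "((\<lambda>u. zeta_mult \<rho> / \<rho>\<^sup>2 * (of_real u powr (of_nat j + 2 - \<rho>) - of_real u powr (of_nat j + 2))) has_integral
       zeta_mult \<rho> * (1 / (s - \<rho>) + 1 / \<rho>) * (1 / s\<^sup>2)) {0..1}" .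
    show ?thesis unfolding s_def [symmetric]
    proof (rule has_integral_eq[OF _ I])
      fix u :: real assume "u \<in> {0..1}"
      show "zeta_mult \<rho> / \<rho>\<^sup>2 * (of_real u powr (of_nat j + 2 - \<rho>) - of_real u powr (of_nat j + 2)) = f j \<rho> u"
      proof (cases "u = 0")
        case False
        have "of_real u powr (of_nat j + 2 - \<rho>) = complex_of_real u ^ j * of_real u powr (2 - \<rho>)"
          "of_real u powr (of_nat j + 2) = complex_of_real u ^ j * of_real u powr 2"
          using False powr_add[of "complex_of_real u" "of_nat j" "2 - \<rho>"] powr_add[of "complex_of_real u" "of_nat j" 2]
          by (simp_all add: add_diff_eq)
        thus ?thesis by (simp add: f_def algebra_simps)
      qed (simp add: f_def)
    qed
  qed
  have sum_f: "(\<lambda>u. \<Sum>\<^sub>\<infinity>\<rho>\<in>zeta_divisor. f j \<rho> u) = (\<lambda>u. of_real u ^ j * zero_sum u)" for j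
    by (simp only: f_def zero_sum_def infsum_cmult_right')
  have "continuous_on {0..1} (\<lambda>u. \<Sum>\<^sub>\<infinity>\<rho>\<in>zeta_divisor. f 0 \<rho> u)"
    by (rule has_integral_infsum(2)[OF c b sm int])
  thus "continuous_on {0..1} zero_sum" unfolding sum_f by simp
  have "\<exists>J. ((\<lambda>\<rho>. zeta_mult \<rho> * (1 / (of_nat (j + 3) - \<rho>) + 1 / \<rho>) * (1 / (of_nat (j + 3))\<^sup>2)) has_sum J) zeta_divisor \<and>
    ((\<lambda>u. \<Sum>\<^sub>\<infinity>\<rho>\<in>zeta_divisor. f j \<rho> u) has_integral J) {0..1}"
    by (rule has_integral_infsum(1)[OF c b sm int])
  then obtain J where J: "((\<lambda>\<rho>. zeta_mult \<rho> * (1 / (of_nat (j + 3) - \<rho>) + 1 / \<rho>) * (1 / (of_nat (j + 3))\<^sup>2)) has_sum J) zeta_divisor"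
    "((\<lambda>u. \<Sum>\<^sub>\<infinity>\<rho>\<in>zeta_divisor. f j \<rho> u) has_integral J) {0..1}" by blast
  have "((\<lambda>\<rho>. zeta_mult \<rho> * (1 / (of_nat (j + 3) - \<rho>) + 1 / \<rho>) * (1 / (of_nat (j + 3))\<^sup>2)) has_sum
      (- mangoldt_series (of_nat (j + 3)) - of_real (ln (2 * pi))) * (1 / (of_nat (j + 3))\<^sup>2)) zeta_divisor"
    by (intro has_sum_cmult_left log_deriv_zeta) auto
  with J(1) have "J = (- mangoldt_series (of_nat (j + 3)) - of_real (ln (2 * pi))) * (1 / (of_nat (j + 3))\<^sup>2)" by (rule has_sum_unique)
  with J(2) show "((\<lambda>u. of_real u ^ j * zero_sum u) has_integral (- mangoldt_series (of_nat (j + 3)) - of_real (ln (2 * pi))) / (of_nat (j + 3))\<^sup>2) {0..1}"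
    unfolding sum_f by simp
qed

lemma prime_sum_integral:
  shows "continuous_on {0..1} prime_sum"
    and "((\<lambda>u. of_real u ^ j * prime_sum u) has_integral mangoldt_series (of_nat (j + 3)) / (of_nat (j + 3))\<^sup>2) {0..1}"
proof -
  define f where "f = (\<lambda>j x u. complex_of_real (case x of (p, k) \<Rightarrow> u ^ j * (ln (real p) * ramp (real (p ^ k)) u)))"
  define M where "M = (\<lambda>x. case x of (p, k) \<Rightarrow> ln (real p) * real (p ^ k) powr (-2))"
  define I where "I = (\<lambda>j x. case x of (p, k) \<Rightarrow> complex_of_real (ln (real p)) * of_nat (p ^ k) powr (- of_nat (j + 3)) * (1 / (of_nat (j + 3))\<^sup>2))"
  have q1: "real (p ^ k) \<ge> 1" if "(p, k) \<in> prime_exps" for p k using prime_exps_pos(1)[OF that] by linarith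
  have c: "continuous_on {0..1} (f j x)" if "x \<in> prime_exps" for j x
    unfolding f_def using that by (cases x) (auto intro!: continuous_intros ramp_continuous q1 simp del: of_nat_power)
  have b: "norm (f j x u) \<le> M x" if "x \<in> prime_exps" "u \<in> {0..1}" for j x u
  proof -
    obtain p k where x: "x = (p, k)" by (cases x)
    note P = prime_exps_pos[OF that(1)[unfolded x]]
    note v = ramp_bounds[OF q1[OF that(1)[unfolded x]] that(2)]
    have "ramp (real (p ^ k)) u \<le> real (p ^ k) powr (-2)" using v(3) P by (simp add: powr_minus_divide del: of_nat_power)
    hence "ln (real p) * ramp (real (p ^ k)) u \<le> ln (real p) * real (p ^ k) powr (-2)" by (intro mult_left_mono P)
    moreover have "u ^ j * (ln (real p) * ramp (real (p ^ k)) u) \<le> 1 * (ln (real p) * ramp (real (p ^ k)) u)"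
      using that P v by (intro mult_right_mono power_le_one mult_nonneg_nonneg) auto
    moreover have "u ^ j * (ln (real p) * ramp (real (p ^ k)) u) \<ge> 0" using that P v by (intro mult_nonneg_nonneg) auto
    ultimately show ?thesis by (simp add: f_def x M_def del: of_nat_power of_real_mult)
  qed
  have sm: "M summable_on prime_exps" unfolding M_def by (rule prime_exps_summable) simp
  have int: "(f j x has_integral I j x) {0..1}" if "x \<in> prime_exps" for j x
  proof -
    obtain p k where x: "x = (p, k)" by (cases x)
    define q where "q = real (p ^ k)"
    have q: "q \<ge> 1" using q1 that x by (simp add: q_def del: of_nat_power)
    have "((\<lambda>u. complex_of_real (ln (real p) * (u ^ j * ramp q u))) has_integral
       of_real (ln (real p) * (q powr (-(real j + 3)) / (real j + 3)\<^sup>2))) {0..1}"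
      by (intro has_integral_of_real has_integral_mult_right ramp_has_integral q)
    moreover have "(\<lambda>u. complex_of_real (ln (real p) * (u ^ j * ramp q u))) = f j x"
      by (simp add: f_def x q_def mult_ac)
    moreover have "complex_of_real (ln (real p) * (q powr (-(real j + 3)) / (real j + 3)\<^sup>2)) = I j x"
    proof -
      have "complex_of_real (q powr (-(real j + 3))) = of_nat (p ^ k) powr (- of_nat (j + 3))"
        using powr_of_real[of q "-(real j + 3)"] q by (simp add: q_def)
      thus ?thesis by (simp add: I_def x)
    qed
    ultimately show ?thesis by simp
  qed
  have sum_f: "(\<lambda>u. \<Sum>\<^sub>\<infinity>x\<in>prime_exps. f j x u) = (\<lambda>u. of_real u ^ j * prime_sum u)" for j
    unfolding f_def prime_sum_def by (simp add: split_def flip: infsum_cmult_right')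
  have "continuous_on {0..1} (\<lambda>u. \<Sum>\<^sub>\<infinity>x\<in>prime_exps. f 0 x u)"
    by (rule has_integral_infsum(2)[OF c b sm int])
  thus "continuous_on {0..1} prime_sum" unfolding sum_f by simp
  have "\<exists>J. (I j has_sum J) prime_exps \<and> ((\<lambda>u. \<Sum>\<^sub>\<infinity>x\<in>prime_exps. f j x u) has_integral J) {0..1}"
    by (rule has_integral_infsum(1)[OF c b sm int])
  then obtain J where J: "(I j has_sum J) prime_exps" "((\<lambda>u. \<Sum>\<^sub>\<infinity>x\<in>prime_exps. f j x u) has_integral J) {0..1}" by blast
  have "((\<lambda>x. (case x of (p, k) \<Rightarrow> of_real (ln (real p)) * of_nat (p ^ k) powr (- of_nat (j + 3))) * (1 / (of_nat (j + 3))\<^sup>2)) has_sum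
      mangoldt_series (of_nat (j + 3)) * (1 / (of_nat (j + 3))\<^sup>2)) prime_exps"
    by (intro has_sum_cmult_left mangoldt_series(1)) auto
  also have "(\<lambda>x. (case x of (p, k) \<Rightarrow> of_real (ln (real p)) * of_nat (p ^ k) powr (- of_nat (j + 3))) * (1 / (of_nat (j + 3))\<^sup>2)) = I j"
    by (auto simp: I_def fun_eq_iff)
  finally have "J = mangoldt_series (of_nat (j + 3)) * (1 / (of_nat (j + 3))\<^sup>2)" using J(1) has_sum_unique by blast
  with J(2) show "((\<lambda>u. of_real u ^ j * prime_sum u) has_integral mangoldt_series (of_nat (j + 3)) / (of_nat (j + 3))\<^sup>2) {0..1}"
    unfolding sum_f by simp
qed

text \<open>\<open>ramp 1\<close> stands for the linear function t and has the moments 1/s^2, so it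
  accounts for the constant log (2 pi) and the Mangoldt series cancel: every moment of the
  difference is 0.\<close>

lemma zero_sum_eq:
  assumes "u \<in> {0..1}"
  shows "zero_sum u = - of_real (ln (2 * pi)) * of_real (ramp 1 u) - prime_sum u"
proof -
  let ?L = "complex_of_real (ln (2 * pi))"
  have "zero_sum u + ?L * of_real (ramp 1 u) + prime_sum u = 0"
  proof (rule moment_zero[OF _ _ assms])
    show "continuous_on {0..1} (\<lambda>u. zero_sum u + ?L * of_real (ramp 1 u) + prime_sum u)"
      by (intro continuous_intros zero_sum_integral prime_sum_integral ramp_continuous) auto
    fix j
    have "((\<lambda>u. complex_of_real (u ^ j * ramp 1 u)) has_integral of_real (1 powr (-(real j + 3)) / (real j + 3)\<^sup>2)) {0..1}"
      by (intro has_integral_of_real ramp_has_integral) auto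
    hence v: "((\<lambda>u. ?L * (of_real u ^ j * of_real (ramp 1 u))) has_integral ?L * (1 / (of_nat (j + 3))\<^sup>2)) {0..1}"
      by (intro has_integral_mult_right) simp
    from has_integral_add[OF has_integral_add[OF zero_sum_integral(2)[of j] v] prime_sum_integral(2)[of j]]
    show "((\<lambda>u. of_real u ^ j * (zero_sum u + ?L * of_real (ramp 1 u) + prime_sum u)) has_integral 0) {0..1}"
      by (simp add: distrib_left mult_ac diff_divide_distrib)
  qed
  thus ?thesis by (simp add: algebra_simps eq_neg_iff_add_eq_0)
qed

lemma ramp_exp:
  assumes "q \<ge> 1"
  shows "ramp q (exp (-t)) = exp (-2 * t) * max 0 (t - ln q)"
proof (cases "t \<ge> ln q")
  case True
  hence "exp (-t) \<le> exp (- ln q)" by simp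
  also have "\<dots> = 1 / q" using assms by (simp add: exp_minus inverse_eq_divide)
  finally show ?thesis using assms True by (simp add: ramp_def ln_mult algebra_simps flip: exp_double)
next
  case False
  hence "exp (- ln q) < exp (-t)" by simp
  hence "1 / q < exp (-t)" using assms by (simp add: exp_minus inverse_eq_divide)
  thus ?thesis using False by (simp add: ramp_def)
qed

text \<open>The substitution u = exp (-t) is undone and the factor exp (-2t) cancelled. Since Re
  \<rho> \<le> 1, the series for K2 converges absolutely at each t \<ge> 0, so K2(0) may be
  subtracted term by term.\<close>

theorem zeta_zeros_primes:
  assumes t: "t \<ge> 0"
  shows "K2 riemann_zeta 0 t - K2 riemann_zeta 0 0 =
    - of_real (ln (2 * pi)) * of_real t - (\<Sum>\<^sub>\<infinity>(p, k)\<in>prime_exps. of_real (ln (real p) * max 0 (t - real k * ln (real p))))"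
proof -
  have D: "divisor_support riemann_zeta - {0} = zeta_divisor" using zeta_hadamard_S(3) by (auto simp: divisor_support_zeta zeta_divisor_def)
  have K: "K2 riemann_zeta 0 x = (\<Sum>\<^sub>\<infinity>\<rho>\<in>zeta_divisor. zeta_mult \<rho> / \<rho>\<^sup>2 * exp (\<rho> * of_real x))" if "x \<ge> 0" for x
    using that by (simp add: K2_def D zorder_zeta_0 zeta_mult_def)
  have sm: "(\<lambda>\<rho>. zeta_mult \<rho> / \<rho>\<^sup>2 * exp (\<rho> * of_real x)) summable_on zeta_divisor" if "x \<ge> 0" for x
  proof (rule abs_summable_summable, rule summable_on_comparison_test)
    show "(\<lambda>\<rho>. norm (zeta_mult \<rho>) / (norm \<rho>)\<^sup>2 * exp x) summable_on zeta_divisor" by (intro summable_on_cmult_left zeta_divisor_summable)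
    fix \<rho> assume "\<rho> \<in> zeta_divisor"
    hence "Re \<rho> * x \<le> 1 * x" using zeta_divisor(1) that by (intro mult_right_mono)
    hence "norm (exp (\<rho> * of_real x)) \<le> exp x" by simp
    thus "norm (zeta_mult \<rho> / \<rho>\<^sup>2 * exp (\<rho> * of_real x)) \<le> norm (zeta_mult \<rho>) / (norm \<rho>)\<^sup>2 * exp x"
      unfolding norm_mult norm_divide norm_power by (intro mult_left_mono) auto
  qed auto
  have "exp (-2 * t) * (K2 riemann_zeta 0 t - K2 riemann_zeta 0 0) = zero_sum (exp (-t))"
  proof -
    have "K2 riemann_zeta 0 t - K2 riemann_zeta 0 0 =
       (\<Sum>\<^sub>\<infinity>\<rho>\<in>zeta_divisor. zeta_mult \<rho> / \<rho>\<^sup>2 * exp (\<rho> * of_real t) - zeta_mult \<rho> / \<rho>\<^sup>2 * exp (\<rho> * of_real 0))"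
      unfolding K[OF t] K[OF order.refl] by (rule infsumI [symmetric], rule has_sum_diff) (intro has_sum_infsum sm t order.refl)+
    hence "of_real (exp (-2 * t)) * (K2 riemann_zeta 0 t - K2 riemann_zeta 0 0) =
       (\<Sum>\<^sub>\<infinity>\<rho>\<in>zeta_divisor. of_real (exp (-2 * t)) * (zeta_mult \<rho> / \<rho>\<^sup>2 * exp (\<rho> * of_real t) - zeta_mult \<rho> / \<rho>\<^sup>2 * exp (\<rho> * of_real 0)))"
      by (simp only: infsum_cmult_right')
    also have "\<dots> = zero_sum (exp (-t))"
      unfolding zero_sum_def
    proof (rule infsum_cong)
      fix \<rho> assume "\<rho> \<in> zeta_divisor"
      have pw: "complex_of_real (exp (-t)) powr a = exp (- of_real t * a)" for a
        by (simp add: powr_def Ln_of_real mult.commute flip: exp_of_real)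
      have "exp (- of_real t * (2 - \<rho>)) = exp (-2 * of_real t) * exp (\<rho> * of_real t)"
        by (simp add: algebra_simps flip: exp_add)
      thus "complex_of_real (exp (-2 * t)) * (zeta_mult \<rho> / \<rho>\<^sup>2 * exp (\<rho> * of_real t) - zeta_mult \<rho> / \<rho>\<^sup>2 * exp (\<rho> * of_real 0)) =
         zeta_mult \<rho> / \<rho>\<^sup>2 * (of_real (exp (- t)) powr (2 - \<rho>) - of_real (exp (- t)) powr 2)"
        unfolding pw by (simp add: algebra_simps flip: exp_of_real)
    qed
    finally show ?thesis by simp
  qed
  also have "zero_sum (exp (-t)) = - of_real (ln (2 * pi)) * of_real (ramp 1 (exp (-t))) - prime_sum (exp (-t))"
    using t by (intro zero_sum_eq) auto
  also have "ramp 1 (exp (-t)) = exp (-2 * t) * t" using t by (simp add: ramp_exp)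
  also have "prime_sum (exp (-t)) = of_real (exp (-2 * t)) * (\<Sum>\<^sub>\<infinity>(p, k)\<in>prime_exps. of_real (ln (real p) * max 0 (t - real k * ln (real p))))"
    unfolding prime_sum_def infsum_cmult_right' [symmetric]
  proof (rule infsum_cong, clarify)
    fix p k assume pk: "(p, k) \<in> prime_exps"
    have q: "real (p ^ k) \<ge> 1" using prime_exps_pos(1)[OF pk] by linarith
    have "p > 0" using pk by (auto simp: prime_exps_def prime_gt_0_nat)
    hence "ln (real (p ^ k)) = real k * ln (real p)" by (simp add: ln_realpow)
    thus "complex_of_real (ln (real p) * ramp (real (p ^ k)) (exp (-t))) =
        of_real (exp (-2 * t)) * of_real (ln (real p) * max 0 (t - real k * ln (real p)))"
      by (simp add: ramp_exp[OF q] mult_ac del: of_nat_power)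
  qed
  finally have "of_real (exp (-2 * t)) * (K2 riemann_zeta 0 t - K2 riemann_zeta 0 0) =
    of_real (exp (-2 * t)) * (- of_real (ln (2 * pi)) * of_real t - (\<Sum>\<^sub>\<infinity>(p, k)\<in>prime_exps. of_real (ln (real p) * max 0 (t - real k * ln (real p)))))"
    by (simp add: algebra_simps)
  moreover have "complex_of_real (exp (-2 * t)) \<noteq> 0" by simp
  ultimately show ?thesis by (simp only: mult_left_cancel not_False_eq_True)
qed

section \<open>Passage to distributions\<close>

lemma test_function_has_vector_derivative:
  assumes "test_function \<phi>"
  shows "((vderiv ^^ n) \<phi> has_vector_derivative (vderiv ^^ Suc n) \<phi> t) (at t)"
  using assms by (auto simp: test_function_def differentiable_on_def vector_derivative_works [symmetric])

lemma test_function_continuous: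
  assumes "test_function \<phi>"
  shows "continuous_on A ((vderiv ^^ n) \<phi>)"
  using test_function_has_vector_derivative[OF assms, of n]
  by (meson continuous_at_imp_continuous_on has_vector_derivative_continuous)

lemma test_function_support:
  assumes "test_function \<phi>"
  obtains a where "a > 0" "\<And>t. \<bar>t\<bar> > a \<Longrightarrow> \<phi> t = 0"
proof -
  have "bounded {t. \<phi> t \<noteq> 0}" using assms by (simp add: test_function_def)
  then obtain a where "\<forall>t\<in>{t. \<phi> t \<noteq> 0}. norm t \<le> a" unfolding bounded_iff by blast
  thus ?thesis by (intro that[of "\<bar>a\<bar> + 1"]) force+
qed

lemma vderiv_eq_0:
  assumes "\<And>t. \<bar>t\<bar> > a \<Longrightarrow> \<phi> t = 0" "\<bar>t\<bar> > a"
  shows "(vderiv ^^ n) \<phi> t = 0"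
  using assms(2)
proof (induction n arbitrary: t)
  case 0
  thus ?case using assms(1) by simp
next
  case (Suc n)
  have "open {t. \<bar>t\<bar> > a}" by (intro open_Collect_less continuous_intros)
  hence "((vderiv ^^ n) \<phi> has_vector_derivative 0) (at t)"
    using Suc by (intro has_vector_derivative_transform_within_open[OF has_vector_derivative_const[of 0]]) auto
  thus ?case by (simp add: vector_derivative_at)
qed

lemma vderiv_funpow_add:
  assumes "test_function \<phi>" "test_function \<psi>"
  shows "(vderiv ^^ n) (\<lambda>t. \<phi> t + \<psi> t) = (\<lambda>t. (vderiv ^^ n) \<phi> t + (vderiv ^^ n) \<psi> t)"
proof (induction n)
  case (Suc n)
  have "vector_derivative (\<lambda>t. (vderiv ^^ n) \<phi> t + (vderiv ^^ n) \<psi> t) (at t) = (vderiv ^^ Suc n) \<phi> t + (vderiv ^^ Suc n) \<psi> t" for t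
    by (intro vector_derivative_at has_vector_derivative_add test_function_has_vector_derivative assms)
  thus ?case using Suc by simp
qed simp

lemma vderiv_funpow_cmult:
  assumes "test_function \<phi>"
  shows "(vderiv ^^ n) (\<lambda>t. c * \<phi> t) = (\<lambda>t. c * (vderiv ^^ n) \<phi> t)"
proof (induction n)
  case (Suc n)
  have "vector_derivative (\<lambda>t. c * (vderiv ^^ n) \<phi> t) (at t) = c * (vderiv ^^ Suc n) \<phi> t" for t
    by (intro vector_derivative_at has_vector_derivative_mult_right test_function_has_vector_derivative assms)
  thus ?case using Suc by simp
qed simp

lemma vderiv_funpow_reflect:
  assumes "test_function \<phi>"
  shows "(vderiv ^^ n) (\<lambda>t. \<phi> (-t)) = (\<lambda>t. (-1) ^ n * (vderiv ^^ n) \<phi> (-t))"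
    and "((\<lambda>t. (-1) ^ n * (vderiv ^^ n) \<phi> (-t)) has_vector_derivative (-1) ^ Suc n * (vderiv ^^ Suc n) \<phi> (-t)) (at t)"
proof -
  have d: "((\<lambda>t. (-1) ^ n * (vderiv ^^ n) \<phi> (-t)) has_vector_derivative (-1) ^ Suc n * (vderiv ^^ Suc n) \<phi> (-t)) (at t)" for n t
  proof -
    have "(uminus has_vector_derivative -1) (at t)" by (auto intro!: derivative_eq_intros)
    from vector_diff_chain_at[OF this test_function_has_vector_derivative[OF assms, of n "-t"]]
    have "((\<lambda>t. (vderiv ^^ n) \<phi> (-t)) has_vector_derivative - (vderiv ^^ Suc n) \<phi> (-t)) (at t)" by (simp add: o_def)
    from has_vector_derivative_mult_right[OF this, of "(-1) ^ n"] show ?thesis by simp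
  qed
  show "((\<lambda>t. (-1) ^ n * (vderiv ^^ n) \<phi> (-t)) has_vector_derivative (-1) ^ Suc n * (vderiv ^^ Suc n) \<phi> (-t)) (at t)" by (rule d)
  show "(vderiv ^^ n) (\<lambda>t. \<phi> (-t)) = (\<lambda>t. (-1) ^ n * (vderiv ^^ n) \<phi> (-t))"
  proof (induction n)
    case (Suc n)
    have "(vderiv ^^ Suc n) (\<lambda>t. \<phi> (-t)) = vderiv ((vderiv ^^ n) (\<lambda>t. \<phi> (-t)))" by simp
    thus ?case unfolding Suc.IH by (simp only:) (intro ext vector_derivative_at d)
  qed simp
qed

lemma test_functionI:
  assumes "\<And>n t. (vderiv ^^ n) \<phi> differentiable (at t)" "\<And>t. \<bar>t\<bar> > a \<Longrightarrow> \<phi> t = 0"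
  shows "test_function \<phi>"
proof -
  have "\<bar>t\<bar> \<le> a" if "\<phi> t \<noteq> 0" for t using assms(2)[of t] that by force
  hence "bounded {t. \<phi> t \<noteq> 0}" unfolding bounded_iff by auto
  thus ?thesis using assms(1) by (auto simp: test_function_def differentiable_on_def)
qed

lemma test_function_add:
  assumes "test_function \<phi>" "test_function \<psi>"
  shows "test_function (\<lambda>t. \<phi> t + \<psi> t)"
proof -
  obtain a b where "\<And>t. \<bar>t\<bar> > a \<Longrightarrow> \<phi> t = 0" "\<And>t. \<bar>t\<bar> > b \<Longrightarrow> \<psi> t = 0"
    using assms by (metis test_function_support)
  note supp = this
  show ?thesis
  proof (rule test_functionI[of _ "max a b"])
    show "(vderiv ^^ n) (\<lambda>t. \<phi> t + \<psi> t) differentiable (at t)" for n t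
      unfolding vderiv_funpow_add[OF assms]
      by (rule differentiableI_vector[OF has_vector_derivative_add[OF
            test_function_has_vector_derivative[OF assms(1)] test_function_has_vector_derivative[OF assms(2)]]])
  qed (simp add: supp)
qed

lemma test_function_cmult:
  assumes "test_function \<phi>"
  shows "test_function (\<lambda>t. c * \<phi> t)"
proof -
  obtain a where "\<And>t. \<bar>t\<bar> > a \<Longrightarrow> \<phi> t = 0" using assms by (metis test_function_support)
  note supp = this
  show ?thesis
  proof (rule test_functionI[of _ a])
    show "(vderiv ^^ n) (\<lambda>t. c * \<phi> t) differentiable (at t)" for n t
      unfolding vderiv_funpow_cmult[OF assms]
      by (rule differentiableI_vector[OF has_vector_derivative_mult_right[OF test_function_has_vector_derivative[OF assms]]])
  qed (simp add: supp)
qed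

lemma test_function_reflect:
  assumes "test_function \<phi>"
  shows "test_function (\<lambda>t. \<phi> (-t))"
proof -
  obtain a where "\<And>t. \<bar>t\<bar> > a \<Longrightarrow> \<phi> t = 0" using assms by (metis test_function_support)
  note supp = this
  show ?thesis
  proof (rule test_functionI[of _ a])
    show "(vderiv ^^ n) (\<lambda>t. \<phi> (-t)) differentiable (at t)" for n t
      unfolding vderiv_funpow_reflect(1)[OF assms]
      by (rule differentiableI_vector[OF vderiv_funpow_reflect(2)[OF assms]])
  qed (simp add: supp)
qed

text \<open>The second distributional derivative of (t - b)_+ is \<delta>_b; the antiderivative (t -
  b) \<phi>' - \<phi> on [b, a] performs both integrations by parts at once.\<close>

lemma ramp_integral:
  assumes \<phi>: "test_function \<phi>" and b: "0 \<le> b" "b \<le> a" and z: "\<phi> a = 0" "vderiv \<phi> a = 0"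
  shows "((\<lambda>t. of_real (max 0 (t - b)) * vderiv (vderiv \<phi>) t) has_integral \<phi> b) {0..a}"
proof -
  define F where "F = (\<lambda>t. of_real (t - b) * vderiv \<phi> t - \<phi> t)"
  have "((\<lambda>t. of_real (t - b) * vderiv (vderiv \<phi>) t) has_integral F a - F b) {b..a}"
  proof (rule fundamental_theorem_of_calculus[OF b(2)])
    fix t
    have d: "(\<phi> has_vector_derivative vderiv \<phi> t) (at t)" "(vderiv \<phi> has_vector_derivative vderiv (vderiv \<phi>) t) (at t)"
      using test_function_has_vector_derivative[OF \<phi>, of 0 t] test_function_has_vector_derivative[OF \<phi>, of 1 t] by simp_all
    have "((\<lambda>t. of_real (t - b)) has_vector_derivative complex_of_real 1) (at t)"
      by (intro has_vector_derivative_of_real) (auto intro!: derivative_eq_intros)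
    from has_vector_derivative_diff[OF has_vector_derivative_mult[OF this d(2)] d(1)]
    have "(F has_vector_derivative of_real (t - b) * vderiv (vderiv \<phi>) t) (at t)" by (simp add: F_def)
    thus "(F has_vector_derivative of_real (t - b) * vderiv (vderiv \<phi>) t) (at t within {b..a})"
      by (rule has_vector_derivative_at_within)
  qed
  moreover have "F a - F b = \<phi> b" by (simp add: F_def z)
  ultimately have "((\<lambda>t. of_real (t - b) * vderiv (vderiv \<phi>) t) has_integral \<phi> b) {b..a}" by simp
  hence 1: "((\<lambda>t. of_real (max 0 (t - b)) * vderiv (vderiv \<phi>) t) has_integral \<phi> b) {b..a}"
    by (rule has_integral_eq[rotated]) (simp add: max_def)
  have 2: "((\<lambda>t. of_real (max 0 (t - b)) * vderiv (vderiv \<phi>) t) has_integral 0) {0..b}"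
    by (rule has_integral_is_0) (simp add: max_def)
  show ?thesis using has_integral_combine[OF b 2 1] by simp
qed

text \<open>The prime powers visible to a test function supported in [-a, a]; finite because p \<le>
  exp a and k \<le> a / ln 2.\<close>

definition prime_exps_upto :: "real \<Rightarrow> (nat \<times> nat) set" where "prime_exps_upto a = {(p, k) \<in> prime_exps. real k * ln (real p) \<le> a}"

lemma finite_prime_exps_upto: "finite (prime_exps_upto a)"
proof (rule finite_subset)
  show "prime_exps_upto a \<subseteq> {..nat \<lceil>exp a\<rceil>} \<times> {..nat \<lceil>a / ln 2\<rceil>}"
  proof (rule subsetI)
    fix x assume x: "x \<in> prime_exps_upto a"
    obtain p k where xpk: "x = (p, k)" by (cases x)
    have pk: "prime p" "k \<ge> 1" "real k * ln (real p) \<le> a" using x by (auto simp: xpk prime_exps_upto_def prime_exps_def)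
    have p: "real p \<ge> 2" using prime_ge_2_nat[OF pk(1)] by simp
    have l: "ln 2 \<le> ln (real p)" "ln (2::real) > 0" "ln (real p) \<ge> 0" using p by auto
    have "1 * ln (real p) \<le> real k * ln (real p)" using pk l by (intro mult_right_mono) auto
    hence "exp (ln (real p)) \<le> exp a" using pk by simp
    hence "real p \<le> exp a" using p by simp
    hence p': "p \<le> nat \<lceil>exp a\<rceil>" by linarith
    have "real k * ln 2 \<le> real k * ln (real p)" using l by (intro mult_left_mono) auto
    with pk(3) have "real k * ln 2 \<le> a" by linarith
    hence "real k \<le> a / ln 2" using pk(3) l(2) by (simp add: pos_le_divide_eq)
    hence "k \<le> nat \<lceil>a / ln 2\<rceil>" by linarith
    with p' show "x \<in> {..nat \<lceil>exp a\<rceil>} \<times> {..nat \<lceil>a / ln 2\<rceil>}" by (simp add: xpk)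
  qed
qed auto

lemma prime_exps_infsum_eq:
  fixes g :: "nat \<Rightarrow> nat \<Rightarrow> complex"
  assumes "\<And>p k. (p, k) \<in> prime_exps \<Longrightarrow> real k * ln (real p) > a \<Longrightarrow> g p k = 0"
  shows "(\<Sum>\<^sub>\<infinity>(p, k)\<in>prime_exps. g p k) = (\<Sum>(p, k)\<in>prime_exps_upto a. g p k)"
proof -
  have "(\<Sum>\<^sub>\<infinity>(p, k)\<in>prime_exps. g p k) = (\<Sum>\<^sub>\<infinity>(p, k)\<in>prime_exps_upto a. g p k)"
    using assms by (intro infsum_cong_neutral) (force simp: prime_exps_upto_def)+
  thus ?thesis using finite_prime_exps_upto by simp
qed

text \<open>The two signs of \<open>distr_deriv\<close> cancel and the weight is 1 at \<sigma> = 0,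
  so \<open>zeta_zeros_primes\<close> is paired with \<phi>''. Each ramp then turns into the value
  of \<phi> at its corner.\<close>

lemma newton_cramer_zeta:
  assumes \<phi>: "test_function \<phi>" and a: "a > 0" and supp: "\<And>t. \<bar>t\<bar> > a \<Longrightarrow> \<phi> t = 0"
  shows "newton_cramer riemann_zeta 0 \<phi> = - of_real (ln (2 * pi)) * \<phi> 0 - (\<Sum>(p, k)\<in>prime_exps_upto a. of_real (ln (real p)) * \<phi> (real k * ln (real p)))"
proof -
  \<comment> \<open>The hypothesis says nothing at t = a itself; one unit further out \<phi> and
    \<phi>' both vanish, as \<open>ramp_integral\<close> requires.\<close>
  define d where "d = a + 1"
  define R where "R = (\<lambda>t. - of_real (ln (2 * pi)) * of_real t - (\<Sum>(p, k)\<in>prime_exps_upto d. of_real (ln (real p) * max 0 (t - real k * ln (real p)))) :: complex)"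
  have z: "(vderiv ^^ n) \<phi> t = 0" if "\<bar>t\<bar> > a" for n t by (rule vderiv_eq_0[OF supp that])
  have zd: "\<phi> d = 0" "vderiv \<phi> d = 0" using z[of d 0] z[of d 1] a by (simp_all add: d_def)
  \<comment> \<open>For t \<le> d the ramps with corner beyond d vanish, so the prime sum becomes
    finite; beyond d, \<phi>'' vanishes.\<close>
  have G: "(K2 riemann_zeta 0 t - K2 riemann_zeta 0 0) * indicator {0..} t * vderiv (vderiv \<phi>) t =
    indicator {0..d} t *\<^sub>R (R t * vderiv (vderiv \<phi>) t)" for t
  proof (cases "t \<in> {0..d}")
    case True
    have "(\<Sum>\<^sub>\<infinity>(p, k)\<in>prime_exps. complex_of_real (ln (real p) * max 0 (t - real k * ln (real p)))) =
      (\<Sum>(p, k)\<in>prime_exps_upto d. of_real (ln (real p) * max 0 (t - real k * ln (real p))))"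
      using True by (intro prime_exps_infsum_eq) auto
    thus ?thesis using zeta_zeros_primes[of t] True by (simp add: R_def)
  next
    case False
    hence "t < 0 \<or> \<bar>t\<bar> > a" using a by (auto simp: d_def)
    thus ?thesis using z[of t 2] False by (auto simp: numeral_2_eq_2)
  qed
  have cont: "continuous_on {0..d} (\<lambda>t. R t * vderiv (vderiv \<phi>) t)"
    using test_function_continuous[OF \<phi>, of _ 2] unfolding R_def split_def
    by (intro continuous_intros) (simp add: numeral_2_eq_2)
  have "newton_cramer riemann_zeta 0 \<phi> = (LINT t|lborel. (K2 riemann_zeta 0 t - K2 riemann_zeta 0 0) * indicator {0..} t * vderiv (vderiv \<phi>) t)"
    by (simp add: newton_cramer_def distr_mult_def distr_deriv_def distr_of_def)
  also have "\<dots> = (LINT t:{0..d}|lborel. R t * vderiv (vderiv \<phi>) t)" unfolding G set_lebesgue_integral_def ..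
  also have "\<dots> = integral {0..d} (\<lambda>t. R t * vderiv (vderiv \<phi>) t)"
    by (intro set_borel_integral_eq_integral borel_integrable_atLeastAtMost' cont)
  also have "\<dots> = - of_real (ln (2 * pi)) * \<phi> 0 - (\<Sum>(p, k)\<in>prime_exps_upto d. of_real (ln (real p)) * \<phi> (real k * ln (real p)))"
  proof (rule integral_unique)
    have r: "((\<lambda>t. of_real (max 0 (t - real (snd x) * ln (real (fst x)))) * vderiv (vderiv \<phi>) t) has_integral \<phi> (real (snd x) * ln (real (fst x)))) {0..d}"
      if "x \<in> prime_exps_upto d" for x
      using that prime_exps_pos(3)[of "fst x" "snd x"] by (intro ramp_integral \<phi> zd) (auto simp: prime_exps_upto_def)
    have "((\<lambda>t. - of_real (ln (2 * pi)) * (of_real (max 0 (t - 0)) * vderiv (vderiv \<phi>) t)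
         - (\<Sum>x\<in>prime_exps_upto d. of_real (ln (real (fst x))) * (of_real (max 0 (t - real (snd x) * ln (real (fst x)))) * vderiv (vderiv \<phi>) t)))
       has_integral - of_real (ln (2 * pi)) * \<phi> 0 - (\<Sum>x\<in>prime_exps_upto d. of_real (ln (real (fst x))) * \<phi> (real (snd x) * ln (real (fst x))))) {0..d}"
      using a by (intro has_integral_diff has_integral_mult_right has_integral_sum finite_prime_exps_upto r ramp_integral \<phi> zd) (auto simp: d_def)
    thus "((\<lambda>t. R t * vderiv (vderiv \<phi>) t) has_integral - of_real (ln (2 * pi)) * \<phi> 0
        - (\<Sum>(p, k)\<in>prime_exps_upto d. of_real (ln (real p)) * \<phi> (real k * ln (real p)))) {0..d}"
      unfolding split_def
      by (rule has_integral_eq[rotated]) (simp add: R_def split_def sum_distrib_right left_diff_distrib mult.assoc)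
  qed
  \<comment> \<open>Pairs with a < k log p \<le> d lie outside the support of \<phi>.\<close>
  also have "(\<Sum>(p, k)\<in>prime_exps_upto d. of_real (ln (real p)) * \<phi> (real k * ln (real p))) = (\<Sum>(p, k)\<in>prime_exps_upto a. of_real (ln (real p)) * \<phi> (real k * ln (real p)))"
    by (rule sum.mono_neutral_right[OF finite_prime_exps_upto]) (auto simp: prime_exps_upto_def d_def intro!: supp)
  finally show ?thesis .
qed

section \<open>The prime side as a distribution, and the conclusion\<close>

definition prime_side :: distr where
  "prime_side = (\<lambda>\<phi>. 2 * c0 riemann_zeta * dirac 0 \<phi> -
    (\<Sum>\<^sub>\<infinity>(p, k)\<in>prime_exps. of_real (ln (real p)) * (dirac (real k * ln (real p)) \<phi> + dirac (- (real k * ln (real p))) \<phi>)))"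

lemma prime_side_eq:
  assumes "\<And>t. \<bar>t\<bar> > a \<Longrightarrow> \<phi> t = 0"
  shows "prime_side \<phi> = - 2 * of_real (ln (2 * pi)) * \<phi> 0 -
    (\<Sum>(p, k)\<in>prime_exps_upto a. of_real (ln (real p)) * (\<phi> (real k * ln (real p)) + \<phi> (- (real k * ln (real p)))))"
proof -
  have "(\<Sum>\<^sub>\<infinity>(p, k)\<in>prime_exps. of_real (ln (real p)) * (\<phi> (real k * ln (real p)) + \<phi> (- (real k * ln (real p))))) =
    (\<Sum>(p, k)\<in>prime_exps_upto a. of_real (ln (real p)) * (\<phi> (real k * ln (real p)) + \<phi> (- (real k * ln (real p)))))"
    by (intro prime_exps_infsum_eq) (auto simp: assms)
  thus ?thesis by (simp add: prime_side_def dirac_def c0_zeta)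
qed

text \<open>Only finitely many atoms lie in [-a, a], so the total mass there bounds the functional
  by the supremum of |\<phi>|: the order is 0.\<close>

lemma prime_side_is_distribution: "is_distribution prime_side"
  unfolding is_distribution_def
proof (intro conjI allI impI; (elim conjE)?)
  fix \<phi> \<psi> assume "test_function \<phi>" "test_function \<psi>"
  then obtain a b where ab: "\<And>t. \<bar>t\<bar> > a \<Longrightarrow> \<phi> t = 0" "\<And>t. \<bar>t\<bar> > b \<Longrightarrow> \<psi> t = 0"
    by (metis test_function_support)
  \<comment> \<open>A common bound \<open>max a b\<close> for the supports lets all three sums run
    over the same finite set.\<close>
  have e1: "prime_side (\<lambda>t. \<phi> t + \<psi> t) = - 2 * of_real (ln (2 * pi)) * (\<phi> 0 + \<psi> 0) -
    (\<Sum>(p, k)\<in>prime_exps_upto (max a b). of_real (ln (real p)) * (\<phi> (real k * ln (real p)) + \<psi> (real k * ln (real p))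
       + (\<phi> (- (real k * ln (real p))) + \<psi> (- (real k * ln (real p))))))"
    by (subst prime_side_eq[of "max a b"]) (simp_all add: ab algebra_simps)
  have e2: "prime_side \<phi> = - 2 * of_real (ln (2 * pi)) * \<phi> 0 -
    (\<Sum>(p, k)\<in>prime_exps_upto (max a b). of_real (ln (real p)) * (\<phi> (real k * ln (real p)) + \<phi> (- (real k * ln (real p)))))"
    by (rule prime_side_eq) (simp add: ab)
  have e3: "prime_side \<psi> = - 2 * of_real (ln (2 * pi)) * \<psi> 0 -
    (\<Sum>(p, k)\<in>prime_exps_upto (max a b). of_real (ln (real p)) * (\<psi> (real k * ln (real p)) + \<psi> (- (real k * ln (real p)))))"
    by (rule prime_side_eq) (simp add: ab)
  show "prime_side (\<lambda>t. \<phi> t + \<psi> t) = prime_side \<phi> + prime_side \<psi>"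
    unfolding e1 e2 e3 by (simp add: split_def sum.distrib algebra_simps)
next
  fix c \<phi> assume "test_function \<phi>"
  then obtain a where a: "\<And>t. \<bar>t\<bar> > a \<Longrightarrow> \<phi> t = 0" by (metis test_function_support)
  have "prime_side (\<lambda>t. c * \<phi> t) = - 2 * of_real (ln (2 * pi)) * (c * \<phi> 0) -
    (\<Sum>(p, k)\<in>prime_exps_upto a. of_real (ln (real p)) * (c * \<phi> (real k * ln (real p)) + c * \<phi> (- (real k * ln (real p)))))"
    by (rule prime_side_eq) (simp add: a)
  moreover have "prime_side \<phi> = - 2 * of_real (ln (2 * pi)) * \<phi> 0 -
    (\<Sum>(p, k)\<in>prime_exps_upto a. of_real (ln (real p)) * (\<phi> (real k * ln (real p)) + \<phi> (- (real k * ln (real p)))))"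
    by (rule prime_side_eq) (simp add: a)
  ultimately show "prime_side (\<lambda>t. c * \<phi> t) = c * prime_side \<phi>"
    by (simp add: split_def sum_distrib_left right_diff_distrib distrib_left mult.left_commute)
next
  fix a
  define C where "C = 2 * \<bar>ln (2 * pi)\<bar> + (\<Sum>(p, k)\<in>prime_exps_upto a. ln (real p) * 2)"
  show "\<exists>C N. \<forall>\<phi>. test_function \<phi> \<and> closure {t. \<phi> t \<noteq> 0} \<subseteq> {- a..a} \<longrightarrow>
           norm (prime_side \<phi>) \<le> C * (\<Sum>k\<le>N. SUP t. norm ((vderiv ^^ k) \<phi> t))"
  proof (intro exI[of _ C] exI[of _ 0] allI impI; elim conjE)
    fix \<phi> assume \<phi>: "test_function \<phi>" and supp: "closure {t. \<phi> t \<noteq> 0} \<subseteq> {- a..a}"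
    have z: "\<phi> t = 0" if "\<bar>t\<bar> > a" for t
    proof (rule ccontr)
      assume "\<phi> t \<noteq> 0"
      hence "t \<in> {-a..a}" by (intro subsetD[OF order_trans[OF closure_subset supp]]) simp
      thus False using that by auto
    qed
    define M where "M = (SUP t. norm (\<phi> t))"
    \<comment> \<open>A real \<open>SUP\<close> dominates the values only if they are bounded
      above.\<close>
    have "bdd_above (range (\<lambda>t. norm (\<phi> t)))"
    proof -
      have "compact (\<phi> ` {-a..a})" using test_function_continuous[OF \<phi>, of _ 0] by (intro compact_continuous_image) auto
      then obtain B where B: "\<forall>x\<in>\<phi> ` {-a..a}. norm x \<le> B" using compact_imp_bounded bounded_iff by blast
      have "norm (\<phi> t) \<le> max B 0" for t using B z[of t] by (cases "\<bar>t\<bar> > a") (auto simp: le_max_iff_disj not_less abs_le_iff)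
      thus ?thesis by (intro bdd_aboveI2)
    qed
    hence M: "norm (\<phi> t) \<le> M" for t unfolding M_def by (intro cSUP_upper) auto
    have e: "prime_side \<phi> = - 2 * of_real (ln (2 * pi)) * \<phi> 0 -
      (\<Sum>(p, k)\<in>prime_exps_upto a. of_real (ln (real p)) * (\<phi> (real k * ln (real p)) + \<phi> (- (real k * ln (real p)))))"
      by (rule prime_side_eq[OF z])
    have "norm (prime_side \<phi>) \<le> norm (- 2 * of_real (ln (2 * pi)) * \<phi> 0) + norm (\<Sum>(p, k)\<in>prime_exps_upto a. of_real (ln (real p)) *
        (\<phi> (real k * ln (real p)) + \<phi> (- (real k * ln (real p)))))"
      unfolding e by (rule norm_triangle_ineq4)
    also have "norm (- 2 * of_real (ln (2 * pi)) * \<phi> 0) \<le> 2 * \<bar>ln (2 * pi)\<bar> * M"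
      using M[of 0] by (simp add: norm_mult mult_left_mono del: ln_mult_pos)
    also have "norm (\<Sum>(p, k)\<in>prime_exps_upto a. of_real (ln (real p)) * (\<phi> (real k * ln (real p)) + \<phi> (- (real k * ln (real p)))))
      \<le> (\<Sum>(p, k)\<in>prime_exps_upto a. ln (real p) * 2 * M)"
      unfolding split_def
    proof (rule sum_norm_le)
      fix x assume "x \<in> prime_exps_upto a"
      hence l: "ln (real (fst x)) \<ge> 0" using prime_exps_pos(3)[of "fst x" "snd x"] by (auto simp: prime_exps_upto_def)
      have "norm (\<phi> (real (snd x) * ln (real (fst x))) + \<phi> (- (real (snd x) * ln (real (fst x))))) \<le> 2 * M"
        using order_trans[OF norm_triangle_ineq add_mono[OF M M]] by simp
      from mult_left_mono[OF this l]
      show "norm (of_real (ln (real (fst x))) * (\<phi> (real (snd x) * ln (real (fst x))) + \<phi> (- (real (snd x) * ln (real (fst x))))))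
        \<le> ln (real (fst x)) * 2 * M" using l by (simp add: norm_mult mult.assoc)
    qed
    also have "2 * \<bar>ln (2 * pi)\<bar> * M + (\<Sum>(p, k)\<in>prime_exps_upto a. ln (real p) * 2 * M) = C * M"
      by (simp add: C_def split_def sum_distrib_right distrib_right)
    finally show "norm (prime_side \<phi>) \<le> C * (\<Sum>k\<le>0. SUP t. norm ((vderiv ^^ k) \<phi> t))"
      by (simp add: M_def)
  qed
qed

text \<open>\<open>is_distribution\<close> evaluates its functional at test functions only, and
  these are closed under sums and multiples. The left-hand side of the theorem thus inherits its
  continuity from the prime side.\<close>

lemma is_distribution_cong:
  assumes T: "is_distribution T" and eq: "\<And>\<phi>. test_function \<phi> \<Longrightarrow> S \<phi> = T \<phi>"
  shows "is_distribution S"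
  using T unfolding is_distribution_def
  by (simp add: eq test_function_add test_function_cmult cong: conj_cong imp_cong)

theorem theorem7p2:
  shows "eq_distr
           (\<lambda>\<phi>. newton_cramer riemann_zeta 0 \<phi> + distr_reflect (newton_cramer riemann_zeta 0) \<phi>)
           (\<lambda>\<phi>. 2 * c0 riemann_zeta * dirac 0 \<phi> -
              (\<Sum>\<^sub>\<infinity>(p, k)\<in>{(p :: nat, k :: nat). prime p \<and> k \<ge> 1}.
                 of_real (ln (real p)) *
                   (dirac (real k * ln (real p)) \<phi> + dirac (- (real k * ln (real p))) \<phi>))) \<and>
         c0 riemann_zeta = - of_real (ln (2 * pi))"
proof -
  let ?L = "\<lambda>\<phi>. newton_cramer riemann_zeta 0 \<phi> + distr_reflect (newton_cramer riemann_zeta 0) \<phi>"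
  have eq: "?L \<phi> = prime_side \<phi>" if \<phi>: "test_function \<phi>" for \<phi>
  proof -
    obtain a where a: "a > 0" "\<And>t. \<bar>t\<bar> > a \<Longrightarrow> \<phi> t = 0" using test_function_support[OF \<phi>] by blast
    have 1: "newton_cramer riemann_zeta 0 \<phi> = - of_real (ln (2 * pi)) * \<phi> 0 - (\<Sum>(p, k)\<in>prime_exps_upto a. of_real (ln (real p)) * \<phi> (real k * ln (real p)))"
      by (rule newton_cramer_zeta[OF \<phi> a])
    \<comment> \<open>The reflected test function has the same support bound; its values at k log p
      are those of \<phi> at - k log p, and its value at 0 repeats the atom.\<close>
    have 2: "newton_cramer riemann_zeta 0 (\<lambda>t. \<phi> (-t)) = - of_real (ln (2 * pi)) * \<phi> (-0) - (\<Sum>(p, k)\<in>prime_exps_upto a. of_real (ln (real p)) * \<phi> (- (real k * ln (real p))))"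
      by (rule newton_cramer_zeta[OF test_function_reflect[OF \<phi>] a(1)]) (simp add: a(2))
    have 3: "prime_side \<phi> = - 2 * of_real (ln (2 * pi)) * \<phi> 0 -
        (\<Sum>(p, k)\<in>prime_exps_upto a. of_real (ln (real p)) * (\<phi> (real k * ln (real p)) + \<phi> (- (real k * ln (real p)))))"
      by (rule prime_side_eq[OF a(2)])
    show ?thesis unfolding distr_reflect_def 1 2 3
      by (simp add: split_def sum.distrib distrib_left algebra_simps)
  qed
  have "eq_distr ?L prime_side"
    unfolding eq_distr_def using eq is_distribution_cong[OF prime_side_is_distribution eq] prime_side_is_distribution by blast
  thus ?thesis using c0_zeta by (simp add: prime_side_def prime_exps_def)
qed

end
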